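(* Let $\rho_k\to\rho\ge0$, $\nu_k\to\nu\ge0$ and $h_k\to h\ge0$ be sequences of nonnegative numbers, each of which is either constant or convergent to $0$. Let $(u,z)_{\rho,\nu,h}$ denote the unique minimizer of $\mathcal I_{\rho,\nu}$ over $\mathcal Y^\nu_h(u^{\rm Dir})$. Then $$(u,z)_{\rho_k,\nu_k,h_k}\to(u,z)_{\rho,\nu,h}\quad\text{weakly in }\mathcal Y^\nu\ \ (\text{weakly in }\mathcal Y^\nu_h\text{ if }h>0).$$
   Context: Tensors: $\mathbb R^{3\times3}_{\rm sym}$ is the space of symmetric $3\times3$ matrices with $a:b=\mathrm{tr}(ab)$ and norm $|\cdot|$; $\mathbb R^{3\times3}_{\rm dev}$ is its trace-free subspace. $\mathbb C:\mathbb R^{3\times3}_{\rm sym}\to\mathbb R^{3\times3}_{\rm sym}$ is linear, symmetric, positive definite, and leaves $\mathbb R^{3\times3}_{\rm dev}$ and $\mathbb R 1_2$ invariant. Domain: $\Omega\subset\mathbb R^3$ is nonempty, bounded, connected, open, with Lipschitz boundary; $\Gamma_{\rm Dir},\Gamma_{\rm tr}$ are disjoint relatively open subsets partitioning $\partial\Omega$ with common relative boundary, and Korn's inequality $c_0\|u\|_{H^1}^2\le\|u\|^2_{L^2(\Gamma_{\rm Dir})}+\|\varepsilon(u)\|^2_{L^2(\Omega)}$ holds on $H^1(\Omega;\mathbb R^3)$ with some $c_0>0$. Energy: $c_1,c_2,c_3>0$; $F_0(a)=c_1|a|+c_2|a|^2+I(a)$ on $\mathbb R^{3\times3}_{\rm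 dev}$, $I(a)=0$ if $|a|\le c_3$, $+\infty$ otherwise. For $\rho>0$, $F_\rho(a)=c_1(\sqrt{\rho^2+|a|^2}-\rho)+c_2|a|^2+\varphi(|a|)/\rho$ with a fixed $\varphi\in C^{2,1}(\mathbb R)$, convex, non-decreasing, $\varphi'\in L^\infty(\mathbb R)$, $\varphi(r)=0$ iff $r\le c_3$. $\mathcal U=H^1(\Omega;\mathbb R^3)$; $\mathcal Z^\nu=H^1(\Omega;\mathbb R^{3\times3}_{\rm dev})$ if $\nu>0$ and $\mathcal Z^0=L^2(\Omega;\mathbb R^{3\times3}_{\rm dev})$; $\mathcal Y^\nu=\mathcal U\times\mathcal Z^\nu$; $\mathcal Y^\nu(\bar u)=\{(u,z)\in\mathcal Y^\nu:u=\bar u\text{ on }\Gamma_{\rm Dir}\}$. $\mathcal W_{\rho,\nu}(u,z)=\frac12\int_\Omega\mathbb C(\varepsilon(u)-z):(\varepsilon(u)-z)+\int_\Omega(F_\rho(z)+\frac\nu2|\nabla z|^2)$ (no gradient term if $\nu=0$). $D:\mathbb R^{3\times3}_{\rm dev}\to[0,\infty)$ is lower semicontinuous, positively 1-homogeneous, subadditive, with $D(a)\ge c_D|a|$, $c_D>0$; $\mathcal D(a)=\int_\Omega D(a)\,dx$. Data: $u^{\rm Dir}\in H^1(\Omega;\mathbb R^3)$, $\ell\in(H^1(\Omega;\mathbb R^3))'$, $\bar z\in L^2(\Omega;\mathbb R^{3\times3}_{\rm dev})$ fixed, and $\mathcal I_{\rho,\nu}(u,z)=\mathcal W_{\rho,\nu}(u,z)-\langle\ell,u\rangle+\mathcal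 D(z-\bar z)$. Space approximation: for $h>0$, $\mathcal Y^\nu_h=\mathcal U_h\times\mathcal Z^\nu_h\subset\mathcal Y^\nu$ are closed subspaces, non-decreasing as $h$ decreases, with union dense in $\mathcal Y^\nu$, and $\mathcal Y^0_h=\mathcal Y^1_h\subset\mathcal Y^1$. $\mathcal Y^\nu_{h,0}=\mathcal Y^\nu_h\cap\mathcal Y^\nu(0)$, with $\bigcup_{h>0}\mathcal Y^\nu_{h,0}$ dense in $\mathcal Y^\nu(0)$. It is assumed that $u^{\rm Dir}\in\mathcal U_h$ for $h$ small enough. For $h>0$, $\mathcal Y^\nu_h(u^{\rm Dir})=\mathcal Y^\nu_{h,0}+(u^{\rm Dir},0)$; for $h=0$, $\mathcal Y^\nu_h(u^{\rm Dir})=\mathcal Y^\nu(u^{\rm Dir})$. There are operators $q_h:\mathcal U\to\mathcal U_h$, $r^\nu_h:\mathcal Z^\nu\to\mathcal Z^\nu_h$ converging pointwise to the identity as $h\to0$ (also $r^\nu_h(z)\to z$ as $h\to0$ and $\nu\to0$ simultaneously), such that $|z|\le c_3$ a.e. implies $|r^\nu_h(z)|\le c_3$ a.e., and $r^0_h:\mathcal Z^1\to\mathcal Z^1$ maps bounded sets into bounded sets. *)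

theory Defs
  imports "HOL-Analysis.Analysis" "HOL-Library.Function_Algebras"
begin

instantiation "fun" :: (type, real_vector) real_vector
begin

definition scaleR_fun :: "real \<Rightarrow> ('a \<Rightarrow> 'b) \<Rightarrow> 'a \<Rightarrow> 'b"
  where "scaleR_fun c f = (\<lambda>x. c *\<^sub>R f x)"

instance
  by standard (auto simp: scaleR_fun_def fun_eq_iff scaleR_add_right scaleR_add_left)

end


section \<open>Seminormed spaces\<close>

text \<open>Lebesgue and Sobolev spaces are sets of representatives carrying a seminorm that vanishes
  exactly on the null functions; the usual Banach space is the quotient. A set that is closed in the
  sense below is automatically saturated with respect to a.e. equality, and a bounded functional
  automatically respects it.\<close>

definition seminorm_closed :: "'v::real_vector set \<Rightarrow> ('v \<Rightarrow> real) \<Rightarrow> 'v set \<Rightarrow> bool"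
  where "seminorm_closed S N A \<longleftrightarrow> A \<subseteq> S \<and>
    (\<forall>X x. (\<forall>n. X n \<in> A) \<and> x \<in> S \<and> (\<lambda>n. N (X n - x)) \<longlonglongrightarrow> 0 \<longrightarrow> x \<in> A)"

definition seminorm_dense :: "'v::real_vector set \<Rightarrow> ('v \<Rightarrow> real) \<Rightarrow> 'v set \<Rightarrow> bool"
  where "seminorm_dense S N A \<longleftrightarrow> A \<subseteq> S \<and> (\<forall>x\<in>S. \<forall>e>0. \<exists>a\<in>A. N (a - x) < e)"

definition dual_space :: "'v::real_vector set \<Rightarrow> ('v \<Rightarrow> real) \<Rightarrow> ('v \<Rightarrow> real) set"
  where "dual_space S N = {f.
    (\<forall>x\<in>S. \<forall>y\<in>S. f (x + y) = f x + f y) \<and>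
    (\<forall>c. \<forall>x\<in>S. f (c *\<^sub>R x) = c * f x) \<and>
    (\<exists>K. \<forall>x\<in>S. \<bar>f x\<bar> \<le> K * N x)}"

definition weakly_converges ::
    "'v::real_vector set \<Rightarrow> ('v \<Rightarrow> real) \<Rightarrow> (nat \<Rightarrow> 'v) \<Rightarrow> 'v \<Rightarrow> bool"
  where "weakly_converges S N X x \<longleftrightarrow> (\<forall>k. X k \<in> S) \<and> x \<in> S \<and>
    (\<forall>f\<in>dual_space S N. (\<lambda>k. f (X k)) \<longlonglongrightarrow> f x)"


section \<open>Tensors\<close>

definition sym_mat :: "(real^3^3) set"
  where "sym_mat = {a. transpose a = a}"

definition dev_mat :: "(real^3^3) set"
  where "dev_mat = {a \<in> sym_mat. trace a = 0}"

text \<open>On symmetric matrices the library inner product of \<^typ>\<open>real^3^3\<close> is \<open>tr (a b)\<close> and its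
  norm is the Frobenius norm. Only the restriction of \<open>C\<close> to symmetric matrices matters.\<close>

definition elasticity_tensor :: "(real^3^3 \<Rightarrow> real^3^3) \<Rightarrow> bool"
  where "elasticity_tensor C \<longleftrightarrow>
    (\<forall>a\<in>sym_mat. C a \<in> sym_mat) \<and>
    (\<forall>a\<in>sym_mat. \<forall>b\<in>sym_mat. C (a + b) = C a + C b) \<and>
    (\<forall>r. \<forall>a\<in>sym_mat. C (r *\<^sub>R a) = r *\<^sub>R C a) \<and>
    (\<forall>a\<in>sym_mat. \<forall>b\<in>sym_mat. C a \<bullet> b = a \<bullet> C b) \<and>
    (\<forall>a\<in>sym_mat. a \<noteq> 0 \<longrightarrow> 0 < C a \<bullet> a) \<and>
    C ` dev_mat \<subseteq> dev_mat \<and>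
    C ` span {mat 1} \<subseteq> span {mat 1}"


section \<open>Lebesgue and Sobolev spaces\<close>

definition L2 :: "(real^3) set \<Rightarrow> 'b::euclidean_space set \<Rightarrow> (real^3 \<Rightarrow> 'b) set"
  where "L2 \<Omega> V = {f \<in> borel_measurable (lebesgue_on \<Omega>).
    integrable (lebesgue_on \<Omega>) (\<lambda>x. (norm (f x))\<^sup>2) \<and> (\<forall>x\<in>\<Omega>. f x \<in> V)}"

definition L2_norm :: "(real^3) set \<Rightarrow> (real^3 \<Rightarrow> 'b::euclidean_space) \<Rightarrow> real"
  where "L2_norm \<Omega> f = sqrt (LINT x|lebesgue_on \<Omega>. (norm (f x))\<^sup>2)"

primrec Ck :: "nat \<Rightarrow> (real^3 \<Rightarrow> real) \<Rightarrow> bool"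
  where
    "Ck 0 f \<longleftrightarrow> continuous_on UNIV f"
  | "Ck (Suc k) f \<longleftrightarrow> (\<exists>g. (\<forall>x. (f has_derivative (\<lambda>v. g x \<bullet> v)) (at x)) \<and>
       (\<forall>j. Ck k (\<lambda>x. g x $ j)))"

definition smooth :: "(real^3 \<Rightarrow> real) \<Rightarrow> bool"
  where "smooth f \<longleftrightarrow> (\<forall>k. Ck k f)"

definition test_functions :: "(real^3) set \<Rightarrow> (real^3 \<Rightarrow> real) set"
  where "test_functions \<Omega> = {\<psi>. smooth \<psi> \<and>
    compact (closure {x. \<psi> x \<noteq> 0}) \<and> closure {x. \<psi> x \<noteq> 0} \<subseteq> \<Omega>}"

text \<open>The component \<open>g x $ j\<close> is the weak partial derivative of \<open>f\<close> in direction \<open>j\<close>.\<close>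

definition has_weak_gradient ::
    "(real^3) set \<Rightarrow> (real^3 \<Rightarrow> 'b::euclidean_space) \<Rightarrow> (real^3 \<Rightarrow> 'b^3) \<Rightarrow> bool"
  where "has_weak_gradient \<Omega> f g \<longleftrightarrow> (\<forall>\<psi>\<in>test_functions \<Omega>. \<forall>j.
    (LINT x|lebesgue_on \<Omega>. frechet_derivative \<psi> (at x) (axis j 1) *\<^sub>R f x) =
    - (LINT x|lebesgue_on \<Omega>. \<psi> x *\<^sub>R (g x $ j)))"

definition H1 :: "(real^3) set \<Rightarrow> 'b::euclidean_space set \<Rightarrow> (real^3 \<Rightarrow> 'b) set"
  where "H1 \<Omega> V = {f \<in> L2 \<Omega> V. \<exists>g\<in>L2 \<Omega> UNIV. has_weak_gradient \<Omega> f g}"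

definition weak_gradient ::
    "(real^3) set \<Rightarrow> (real^3 \<Rightarrow> 'b::euclidean_space) \<Rightarrow> real^3 \<Rightarrow> 'b^3"
  where "weak_gradient \<Omega> f = (SOME g. g \<in> L2 \<Omega> UNIV \<and> has_weak_gradient \<Omega> f g)"

definition H1_norm :: "(real^3) set \<Rightarrow> (real^3 \<Rightarrow> 'b::euclidean_space) \<Rightarrow> real"
  where "H1_norm \<Omega> f = sqrt ((L2_norm \<Omega> f)\<^sup>2 + (L2_norm \<Omega> (weak_gradient \<Omega> f))\<^sup>2)"

definition strain :: "(real^3) set \<Rightarrow> (real^3 \<Rightarrow> real^3) \<Rightarrow> real^3 \<Rightarrow> real^3^3"
  where "strain \<Omega> u x =
    (1 / 2) *\<^sub>R (weak_gradient \<Omega> u x + transpose (weak_gradient \<Omega> u x))"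


section \<open>Boundary, surface measure and traces\<close>

definition lipschitz_boundary :: "(real^3) set \<Rightarrow> bool"
  where "lipschitz_boundary \<Omega> \<longleftrightarrow> (\<forall>p\<in>frontier \<Omega>.
    \<exists>(Q :: real^3 \<Rightarrow> real^3) (\<gamma> :: real \<times> real \<Rightarrow> real) L r.
      orthogonal_transformation Q \<and> L-lipschitz_on UNIV \<gamma> \<and> 0 < r \<and>
      \<Omega> \<inter> ball p r = {x \<in> ball p r. \<gamma> (Q x $ 1, Q x $ 2) < Q x $ 3})"

text \<open>The two parts of the boundary exhaust it up to their common relative boundary. (A partition
  without remainder would force both parts to be unions of components of the boundary; that case is
  included.)\<close>

definition boundary_partition :: "(real^3) set \<Rightarrow> (real^3) set \<Rightarrow> (real^3) set \<Rightarrow> bool"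
  where "boundary_partition \<Omega> \<Gamma>\<^sub>D \<Gamma>\<^sub>t \<longleftrightarrow>
    openin (top_of_set (frontier \<Omega>)) \<Gamma>\<^sub>D \<and>
    openin (top_of_set (frontier \<Omega>)) \<Gamma>\<^sub>t \<and>
    \<Gamma>\<^sub>D \<inter> \<Gamma>\<^sub>t = {} \<and>
    (top_of_set (frontier \<Omega>)) frontier_of \<Gamma>\<^sub>D = (top_of_set (frontier \<Omega>)) frontier_of \<Gamma>\<^sub>t \<and>
    frontier \<Omega> = \<Gamma>\<^sub>D \<union> \<Gamma>\<^sub>t \<union> (top_of_set (frontier \<Omega>)) frontier_of \<Gamma>\<^sub>D"

text \<open>Two-dimensional Hausdorff outer measure; the factor \<open>pi / 4\<close> makes it agree with area on
  planes. It is a metric outer measure, hence a measure on the Borel sets.\<close>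

definition hausdorff2_pre :: "real \<Rightarrow> (real^3) set \<Rightarrow> ennreal"
  where "hausdorff2_pre \<delta> A = (INF B \<in> {B :: nat \<Rightarrow> (real^3) set.
      A \<subseteq> (\<Union>i. B i) \<and> (\<forall>i. bounded (B i) \<and> diameter (B i) \<le> \<delta>)}.
    (\<Sum>i. ennreal (pi / 4 * (diameter (B i))\<^sup>2)))"

definition hausdorff2 :: "(real^3) set \<Rightarrow> ennreal"
  where "hausdorff2 A = (SUP \<delta>\<in>{0<..}. hausdorff2_pre \<delta> A)"

definition surface_measure :: "(real^3) measure"
  where "surface_measure = measure_of UNIV (sets borel) hausdorff2"

text \<open>The trace on \<open>\<Gamma>\<close> is the continuous extension from smooth functions to \<open>H1\<close> of the
  restriction to \<open>\<Gamma>\<close>, with values in the square integrable functions for the surface measure;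
  it is given here by its graph.\<close>

definition has_trace ::
    "(real^3) set \<Rightarrow> (real^3) set \<Rightarrow> (real^3 \<Rightarrow> real^3) \<Rightarrow> (real^3 \<Rightarrow> real^3) \<Rightarrow> bool"
  where "has_trace \<Omega> \<Gamma> u t \<longleftrightarrow> t \<in> borel_measurable borel \<and>
    (\<exists>w :: nat \<Rightarrow> real^3 \<Rightarrow> real^3.
      (\<forall>n i. smooth (\<lambda>x. w n x $ i)) \<and>
      (\<lambda>n. H1_norm \<Omega> (w n - u)) \<longlonglongrightarrow> 0 \<and>
      (\<lambda>n. \<integral>\<^sup>+x\<in>\<Gamma>. ennreal ((norm (w n x - t x))\<^sup>2) \<partial>surface_measure) \<longlonglongrightarrow> 0)"

definition equal_on_boundary ::
    "(real^3) set \<Rightarrow> (real^3) set \<Rightarrow> (real^3 \<Rightarrow> real^3) \<Rightarrow> (real^3 \<Rightarrow> real^3) \<Rightarrow> bool"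
  where "equal_on_boundary \<Omega> \<Gamma> u v \<longleftrightarrow> has_trace \<Omega> \<Gamma> (u - v) (\<lambda>_. 0)"

definition korn_inequality :: "(real^3) set \<Rightarrow> (real^3) set \<Rightarrow> real \<Rightarrow> bool"
  where "korn_inequality \<Omega> \<Gamma> c \<longleftrightarrow> (\<forall>u\<in>H1 \<Omega> UNIV. \<forall>t. has_trace \<Omega> \<Gamma> u t \<longrightarrow>
    ennreal (c * (H1_norm \<Omega> u)\<^sup>2) \<le>
      (\<integral>\<^sup>+x\<in>\<Gamma>. ennreal ((norm (t x))\<^sup>2) \<partial>surface_measure) +
      ennreal ((L2_norm \<Omega> (strain \<Omega> u))\<^sup>2))"


section \<open>State spaces\<close>

definition Z_space :: "(real^3) set \<Rightarrow> real \<Rightarrow> (real^3 \<Rightarrow> real^3^3) set"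
  where "Z_space \<Omega> \<nu> = (if \<nu> > 0 then H1 \<Omega> dev_mat else L2 \<Omega> dev_mat)"

definition Z_norm :: "(real^3) set \<Rightarrow> real \<Rightarrow> (real^3 \<Rightarrow> real^3^3) \<Rightarrow> real"
  where "Z_norm \<Omega> \<nu> = (if \<nu> > 0 then H1_norm \<Omega> else L2_norm \<Omega>)"

type_synonym state = "(real^3 \<Rightarrow> real^3) \<times> (real^3 \<Rightarrow> real^3^3)"

definition Y_space :: "(real^3) set \<Rightarrow> real \<Rightarrow> state set"
  where "Y_space \<Omega> \<nu> = H1 \<Omega> UNIV \<times> Z_space \<Omega> \<nu>"

definition Y_norm :: "(real^3) set \<Rightarrow> real \<Rightarrow> state \<Rightarrow> real"
  where "Y_norm \<Omega> \<nu> y = sqrt ((H1_norm \<Omega> (fst y))\<^sup>2 + (Z_norm \<Omega> \<nu> (snd y))\<^sup>2)"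

definition Y_dir :: "(real^3) set \<Rightarrow> (real^3) set \<Rightarrow> real \<Rightarrow> (real^3 \<Rightarrow> real^3) \<Rightarrow> state set"
  where "Y_dir \<Omega> \<Gamma> \<nu> v = {y \<in> Y_space \<Omega> \<nu>. equal_on_boundary \<Omega> \<Gamma> (fst y) v}"


section \<open>Energy and dissipation\<close>

definition penalty_function :: "(real \<Rightarrow> real) \<Rightarrow> real \<Rightarrow> bool"
  where "penalty_function \<phi> c\<^sub>3 \<longleftrightarrow>
    (\<forall>r. \<phi> differentiable at r) \<and> (\<forall>r. deriv \<phi> differentiable at r) \<and>
    (\<exists>L. L-lipschitz_on UNIV (deriv (deriv \<phi>))) \<and>
    convex_on UNIV \<phi> \<and> mono \<phi> \<and> bounded (range (deriv \<phi>)) \<and>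
    (\<forall>r. \<phi> r = 0 \<longleftrightarrow> r \<le> c\<^sub>3)"

definition hardening ::
    "real \<Rightarrow> real \<Rightarrow> real \<Rightarrow> (real \<Rightarrow> real) \<Rightarrow> real \<Rightarrow> real^3^3 \<Rightarrow> ennreal"
  where "hardening c\<^sub>1 c\<^sub>2 c\<^sub>3 \<phi> \<rho> a =
    (if \<rho> = 0
     then ennreal (c\<^sub>1 * norm a + c\<^sub>2 * (norm a)\<^sup>2) + (if norm a \<le> c\<^sub>3 then 0 else \<infinity>)
     else ennreal (c\<^sub>1 * (sqrt (\<rho>\<^sup>2 + (norm a)\<^sup>2) - \<rho>) + c\<^sub>2 * (norm a)\<^sup>2 + \<phi> (norm a) / \<rho>))"

definition stored_energy ::
    "(real^3) set \<Rightarrow> (real^3^3 \<Rightarrow> real^3^3) \<Rightarrow> real \<Rightarrow> real \<Rightarrow> real \<Rightarrow> (real \<Rightarrow> real) \<Rightarrow>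
     real \<Rightarrow> real \<Rightarrow> state \<Rightarrow> ereal"
  where "stored_energy \<Omega> C c\<^sub>1 c\<^sub>2 c\<^sub>3 \<phi> \<rho> \<nu> = (\<lambda>(u, z).
    ereal (1 / 2 * (LINT x|lebesgue_on \<Omega>.
      C (strain \<Omega> u x - z x) \<bullet> (strain \<Omega> u x - z x))) +
    enn2ereal (\<integral>\<^sup>+x. hardening c\<^sub>1 c\<^sub>2 c\<^sub>3 \<phi> \<rho> (z x) +
      (if \<nu> = 0 then 0 else ennreal (\<nu> / 2 * (norm (weak_gradient \<Omega> z x))\<^sup>2))
      \<partial>lebesgue_on \<Omega>))"

definition dissipation_density :: "(real^3^3 \<Rightarrow> real) \<Rightarrow> bool"
  where "dissipation_density D \<longleftrightarrow>
    (\<forall>a\<in>dev_mat. 0 \<le> D a) \<and>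
    (\<forall>a\<in>dev_mat. \<forall>s<D a. \<forall>\<^sub>F b in at a within dev_mat. s < D b) \<and>
    (\<forall>a\<in>dev_mat. \<forall>r\<ge>0. D (r *\<^sub>R a) = r * D a) \<and>
    (\<forall>a\<in>dev_mat. \<forall>b\<in>dev_mat. D (a + b) \<le> D a + D b) \<and>
    (\<exists>c>0. \<forall>a\<in>dev_mat. c * norm a \<le> D a)"

definition dissipation :: "(real^3) set \<Rightarrow> (real^3^3 \<Rightarrow> real) \<Rightarrow> (real^3 \<Rightarrow> real^3^3) \<Rightarrow> real"
  where "dissipation \<Omega> D a = (LINT x|lebesgue_on \<Omega>. D (a x))"

definition incremental_energy ::
    "(real^3) set \<Rightarrow> (real^3^3 \<Rightarrow> real^3^3) \<Rightarrow> real \<Rightarrow> real \<Rightarrow> real \<Rightarrow> (real \<Rightarrow> real) \<Rightarrow>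
     (real^3^3 \<Rightarrow> real) \<Rightarrow> ((real^3 \<Rightarrow> real^3) \<Rightarrow> real) \<Rightarrow> (real^3 \<Rightarrow> real^3^3) \<Rightarrow>
     real \<Rightarrow> real \<Rightarrow> state \<Rightarrow> ereal"
  where "incremental_energy \<Omega> C c\<^sub>1 c\<^sub>2 c\<^sub>3 \<phi> D \<l> zbar \<rho> \<nu> = (\<lambda>(u, z).
    stored_energy \<Omega> C c\<^sub>1 c\<^sub>2 c\<^sub>3 \<phi> \<rho> \<nu> (u, z) - ereal (\<l> u) +
    ereal (dissipation \<Omega> D (z - zbar)))"


section \<open>Space approximation\<close>

definition Y_approx ::
    "(real \<Rightarrow> (real^3 \<Rightarrow> real^3) set) \<Rightarrow> (real \<Rightarrow> real \<Rightarrow> (real^3 \<Rightarrow> real^3^3) set) \<Rightarrow>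
     real \<Rightarrow> real \<Rightarrow> state set"
  where "Y_approx Uh Zh \<nu> h = Uh h \<times> Zh \<nu> h"

text \<open>The spaces \<open>Y_approx Uh Zh \<nu> h\<close>, like \<open>Y_space \<Omega> \<nu>\<close>, depend on \<open>\<nu>\<close> at most through
  whether it is positive; the value 1 stands for all positive \<open>\<nu>\<close>.\<close>

definition approximation_spaces ::
    "(real^3) set \<Rightarrow> (real^3) set \<Rightarrow>
     (real \<Rightarrow> (real^3 \<Rightarrow> real^3) set) \<Rightarrow> (real \<Rightarrow> real \<Rightarrow> (real^3 \<Rightarrow> real^3^3) set) \<Rightarrow> bool"
  where "approximation_spaces \<Omega> \<Gamma> Uh Zh \<longleftrightarrow>
    (\<forall>\<nu>\<ge>0. \<forall>h>0. subspace (Y_approx Uh Zh \<nu> h) \<and>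
       seminorm_closed (Y_space \<Omega> \<nu>) (Y_norm \<Omega> \<nu>) (Y_approx Uh Zh \<nu> h)) \<and>
    (\<forall>\<nu>\<ge>0. \<forall>h>0. \<forall>h'\<ge>h. Y_approx Uh Zh \<nu> h' \<subseteq> Y_approx Uh Zh \<nu> h) \<and>
    (\<forall>\<nu>\<ge>0. seminorm_dense (Y_space \<Omega> \<nu>) (Y_norm \<Omega> \<nu>) (\<Union>h\<in>{0<..}. Y_approx Uh Zh \<nu> h)) \<and>
    (\<forall>\<nu>>0. \<forall>h>0. Y_approx Uh Zh \<nu> h = Y_approx Uh Zh 1 h) \<and>
    (\<forall>h>0. Y_approx Uh Zh 0 h = Y_approx Uh Zh 1 h \<and> Y_approx Uh Zh 1 h \<subseteq> Y_space \<Omega> 1) \<and>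
    (\<forall>\<nu>\<ge>0. seminorm_dense (Y_dir \<Omega> \<Gamma> \<nu> 0) (Y_norm \<Omega> \<nu>)
       (\<Union>h\<in>{0<..}. Y_approx Uh Zh \<nu> h \<inter> Y_dir \<Omega> \<Gamma> \<nu> 0))"

text \<open>For positive \<open>\<nu>\<close> the operator \<open>r \<nu> h\<close> acts on \<open>Z_space \<Omega> 1\<close>; its joint limit as \<open>h\<close> and
  \<open>\<nu>\<close> tend to 0 is taken there, in the norm of the limit space \<open>Z_space \<Omega> 0\<close>.\<close>

definition approximation_operators ::
    "(real^3) set \<Rightarrow> real \<Rightarrow>
     (real \<Rightarrow> (real^3 \<Rightarrow> real^3) set) \<Rightarrow> (real \<Rightarrow> real \<Rightarrow> (real^3 \<Rightarrow> real^3^3) set) \<Rightarrow>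
     (real \<Rightarrow> (real^3 \<Rightarrow> real^3) \<Rightarrow> real^3 \<Rightarrow> real^3) \<Rightarrow>
     (real \<Rightarrow> real \<Rightarrow> (real^3 \<Rightarrow> real^3^3) \<Rightarrow> real^3 \<Rightarrow> real^3^3) \<Rightarrow> bool"
  where "approximation_operators \<Omega> c\<^sub>3 Uh Zh q r \<longleftrightarrow>
    (\<forall>h>0. \<forall>u\<in>H1 \<Omega> UNIV. q h u \<in> Uh h) \<and>
    (\<forall>\<nu>\<ge>0. \<forall>h>0. \<forall>z\<in>Z_space \<Omega> \<nu>. r \<nu> h z \<in> Zh \<nu> h) \<and>
    (\<forall>u\<in>H1 \<Omega> UNIV. ((\<lambda>h. H1_norm \<Omega> (q h u - u)) \<longlongrightarrow> 0) (at_right 0)) \<and>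
    (\<forall>\<nu>\<ge>0. \<forall>z\<in>Z_space \<Omega> \<nu>. ((\<lambda>h. Z_norm \<Omega> \<nu> (r \<nu> h z - z)) \<longlongrightarrow> 0) (at_right 0)) \<and>
    (\<forall>z\<in>Z_space \<Omega> 1. ((\<lambda>(h, \<nu>). Z_norm \<Omega> 0 (r \<nu> h z - z)) \<longlongrightarrow> 0)
       (at_right 0 \<times>\<^sub>F at_right 0)) \<and>
    (\<forall>\<nu>\<ge>0. \<forall>h>0. \<forall>z\<in>Z_space \<Omega> \<nu>.
       (AE x in lebesgue_on \<Omega>. norm (z x) \<le> c\<^sub>3) \<longrightarrow>
       (AE x in lebesgue_on \<Omega>. norm (r \<nu> h z x) \<le> c\<^sub>3)) \<and>
    (\<forall>h>0. \<forall>R. \<exists>R'. \<forall>z\<in>Z_space \<Omega> 1. Z_norm \<Omega> 1 z \<le> R \<longrightarrow> Z_norm \<Omega> 1 (r 0 h z) \<le> R')"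

definition admissible ::
    "(real^3) set \<Rightarrow> (real^3) set \<Rightarrow>
     (real \<Rightarrow> (real^3 \<Rightarrow> real^3) set) \<Rightarrow> (real \<Rightarrow> real \<Rightarrow> (real^3 \<Rightarrow> real^3^3) set) \<Rightarrow>
     (real^3 \<Rightarrow> real^3) \<Rightarrow> real \<Rightarrow> real \<Rightarrow> state set"
  where "admissible \<Omega> \<Gamma> Uh Zh uDir \<nu> h =
    (if h = 0 then Y_dir \<Omega> \<Gamma> \<nu> uDir
     else (\<lambda>y. y + (uDir, 0)) ` (Y_approx Uh Zh \<nu> h \<inter> Y_dir \<Omega> \<Gamma> \<nu> 0))"

definition ae_unique_minimizer :: "(real^3) set \<Rightarrow> (state \<Rightarrow> ereal) \<Rightarrow> state set \<Rightarrow> bool"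
  where "ae_unique_minimizer \<Omega> E A \<longleftrightarrow>
    (\<exists>y. is_arg_min E (\<lambda>y. y \<in> A) y) \<and>
    (\<forall>u z u' z'. is_arg_min E (\<lambda>y. y \<in> A) (u, z) \<and> is_arg_min E (\<lambda>y. y \<in> A) (u', z') \<longrightarrow>
       (AE x in lebesgue_on \<Omega>. u x = u' x \<and> z x = z' x))"

end

theory Submission
  imports Defs
begin

text \<open>The convergence is even strong. Since \<open>C\<close> is positive definite, the hardening contains the term
  \<open>c\<^sub>2 \<bar>z\<bar>\<^sup>2\<close>, and Korn's inequality holds for functions with zero trace, the energy is uniformly convex
  in the norm of the limit space, with a modulus that does not depend on \<open>\<rho>\<close>. Hence minimizing
  sequences are Cauchy sequences, minimizers exist and are unique, and an almost minimizer is close to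
  the minimizer. The energy increases as \<open>\<rho>\<close> decreases to 0, with supremum the constrained energy; so
  the minima for \<open>\<rho> > 0\<close> increase to the minimum for \<open>\<rho> = 0\<close>, again because the minimizers form a
  Cauchy sequence. Dropping the gradient term and enlarging the space only lowers the minimum, so it
  remains to bound the minima of the approximating problems from above: for that, one discrete
  competitor, built with the operators \<open>r\<close>, which respect the constraint, serves all small \<open>h\<close> and
  \<open>\<nu>\<close>, and its gradient term vanishes with \<open>\<nu>\<close>.\<close>

text \<open>One inequality drives all convergence statements: the midpoint of two competitors cannot
  lie below the minimum, so their squared distance is at most the mean excess of their levels over
  the minimum, divided by the modulus. This takes the place of weak compactness and tolerates
  infinite energies. The obstacle is that minimizers for positive \<rho> may violate the constraint
  \<open>norm z \<le> c\<^sub>3\<close> and then have infinite energy for \<rho> = 0. They are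
  therefore not inserted into the limit functional; instead the limit minimizer is inserted into the
  problem with parameter \<open>\<rho>s k\<close>, where by monotonicity its energy is at most the
  limit minimum. The modulus comes from the quadratic part alone: penalty and dissipation contribute
  convexity, the load is affine. A second obstacle is that \<open>weak_gradient\<close> is a choice
  among representatives, so that it is linear only almost everywhere. This rests on the uniqueness
  of weak gradients and thus on a supply of test functions, built by hand from
  \<open>exp (- c / t)\<close>.\<close>

section \<open>Uniformly convex families of functionals\<close>

text \<open>The parameter of \<open>E\<close> is \<rho>; \<nu> and h are frozen in \<open>A\<close>
  and \<open>N\<close>. Values are extended because the constraint is hard for \<rho> = 0. The bound
  \<open>below\<close> is only linear, as a load term allows; coercivity results from the quadratic
  gain in \<open>convex\<close>. With \<open>antimono\<close>, the assumption \<open>sup\<close>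
  says that \<open>E 0\<close> is the supremum of the functionals with positive parameter.\<close>

locale convex_family =
  fixes A :: "'v::real_vector set" and N :: "'v \<Rightarrow> real" and E :: "real \<Rightarrow> 'v \<Rightarrow> ereal"
    and \<alpha> K B :: real and y\<^sub>0 :: 'v
  assumes alpha: "0 < \<alpha>" and K_nonneg: "0 \<le> K"
    and N_nonneg: "\<And>x. 0 \<le> N x"
    and N_half: "\<And>x. x \<in> A \<Longrightarrow> N ((1/2) *\<^sub>R (x + y\<^sub>0) - y\<^sub>0) \<le> N (x - y\<^sub>0)"
    and y0: "y\<^sub>0 \<in> A" "\<And>\<rho>. 0 \<le> \<rho> \<Longrightarrow> E \<rho> y\<^sub>0 \<le> ereal B"
    and mid: "\<And>x y. x \<in> A \<Longrightarrow> y \<in> A \<Longrightarrow> (1/2) *\<^sub>R (x + y) \<in> A"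
    and convex: "\<And>\<rho> x y a b. 0 \<le> \<rho> \<Longrightarrow> x \<in> A \<Longrightarrow> y \<in> A \<Longrightarrow> E \<rho> x \<le> ereal a \<Longrightarrow>
      E \<rho> y \<le> ereal b \<Longrightarrow> E \<rho> ((1/2) *\<^sub>R (x + y)) \<le> ereal ((a + b) / 2 - \<alpha> * (N (x - y))\<^sup>2)"
    and below: "\<And>\<rho> x. 0 \<le> \<rho> \<Longrightarrow> x \<in> A \<Longrightarrow> ereal (- K * N (x - y\<^sub>0) - K) \<le> E \<rho> x"
    and antimono: "\<And>\<rho> \<sigma> x. 0 \<le> \<sigma> \<Longrightarrow> \<sigma> \<le> \<rho> \<Longrightarrow> x \<in> A \<Longrightarrow> E \<rho> x \<le> E \<sigma> x"
    and lsc: "\<And>\<rho> X x b. 0 \<le> \<rho> \<Longrightarrow> (\<And>n. X n \<in> A) \<Longrightarrow> x \<in> A \<Longrightarrow>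
      (\<lambda>n. N (X n - x)) \<longlonglongrightarrow> 0 \<Longrightarrow> (\<And>n. E \<rho> (X n) \<le> ereal b) \<Longrightarrow> E \<rho> x \<le> ereal b"
    and sup: "\<And>x b. x \<in> A \<Longrightarrow> (\<And>\<rho>. 0 < \<rho> \<Longrightarrow> E \<rho> x \<le> ereal b) \<Longrightarrow> E 0 x \<le> ereal b"
    and complete: "\<And>X. (\<And>n. X n \<in> A) \<Longrightarrow> (\<And>e. 0 < e \<Longrightarrow> \<exists>M. \<forall>m\<ge>M. \<forall>n\<ge>M. N (X m - X n) < e) \<Longrightarrow>
      \<exists>x\<in>A. (\<lambda>n. N (X n - x)) \<longlonglongrightarrow> 0"
begin

text \<open>The infimum ranges over real levels rather than extended values, so that it is a real
  number; \<open>y\<^sub>0\<close> makes the set of levels nonempty.\<close>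

definition min_value :: "real \<Rightarrow> real"
  where "min_value \<rho> = Inf {a. \<exists>x\<in>A. E \<rho> x \<le> ereal a}"

text \<open>At the midpoint of \<open>x\<close> and \<open>y\<^sub>0\<close> the linear lower bound
  meets the quadratic gain of convexity, and a quadratic beats a linear term.\<close>

lemma levels_bounded_below:
  assumes "0 \<le> \<rho>"
  shows "bdd_below {a. \<exists>x\<in>A. E \<rho> x \<le> ereal a}"
proof (rule bdd_belowI)
  fix a assume "a \<in> {a. \<exists>x\<in>A. E \<rho> x \<le> ereal a}"
  then obtain x where x: "x \<in> A" "E \<rho> x \<le> ereal a" by auto
  let ?t = "N (x - y\<^sub>0)" and ?y = "(1/2) *\<^sub>R (x + y\<^sub>0)"
  have "ereal (- K * N (?y - y\<^sub>0) - K) \<le> E \<rho> ?y"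
    using below[OF assms mid[OF x(1) y0(1)]] .
  also have "\<dots> \<le> ereal ((a + B) / 2 - \<alpha> * ?t\<^sup>2)"
    using convex[OF assms x(1) y0(1) x(2) y0(2)[OF assms]] .
  finally have "- K * N (?y - y\<^sub>0) - K \<le> (a + B) / 2 - \<alpha> * ?t\<^sup>2" by simp
  moreover have "K * N (?y - y\<^sub>0) \<le> K * ?t"
    by (rule mult_left_mono[OF N_half[OF x(1)] K_nonneg])
  \<comment> \<open>Completing the square: the least value of
    \<open>\<alpha> * t\<^sup>2 - K * t\<close> is \<open>- K\<^sup>2 / (4 * \<alpha>)\<close>,
    which, doubled, is the first term of the final bound.\<close>
  moreover have "\<alpha> * (?t - K / (2 * \<alpha>))\<^sup>2 = \<alpha> * ?t\<^sup>2 - K * ?t + K\<^sup>2 / (4 * \<alpha>)"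
    using alpha by (simp add: power2_eq_square field_simps)
  then have "0 \<le> \<alpha> * ?t\<^sup>2 - K * ?t + K\<^sup>2 / (4 * \<alpha>)"
    using alpha by (metis less_imp_le mult_nonneg_nonneg zero_le_power2)
  ultimately show "- K\<^sup>2 / (2 * \<alpha>) - 2 * K - B \<le> a" by (simp add: field_simps)
qed

lemma min_value_le:
  assumes "0 \<le> \<rho>" "x \<in> A" "E \<rho> x \<le> ereal a"
  shows "min_value \<rho> \<le> a"
  unfolding min_value_def
  using assms by (intro cInf_lower levels_bounded_below) auto

lemma min_value_le_energy:
  assumes "0 \<le> \<rho>" "x \<in> A"
  shows "ereal (min_value \<rho>) \<le> E \<rho> x"
proof (rule ereal_le_real)
  fix a assume "E \<rho> x \<le> ereal a"
  then show "ereal (min_value \<rho>) \<le> ereal a" using min_value_le assms by simp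
qed

lemma near_minimizer:
  assumes "0 \<le> \<rho>" "0 < e"
  obtains x where "x \<in> A" "E \<rho> x \<le> ereal (min_value \<rho> + e)"
proof -
  have "\<exists>a\<in>{a. \<exists>x\<in>A. E \<rho> x \<le> ereal a}. a < min_value \<rho> + e"
    unfolding min_value_def
    by (rule cInf_lessD) (use y0 assms in auto)
  then obtain a x where "x \<in> A" "E \<rho> x \<le> ereal a" "a < min_value \<rho> + e" by auto
  then have "E \<rho> x \<le> ereal (min_value \<rho> + e)"
    by (meson ereal_less_eq(3) less_imp_le order_trans)
  then show thesis using that \<open>x \<in> A\<close> by blast
qed

text \<open>The midpoint is a competitor, so its energy is at least the minimum, while convexity
  bounds it by the mean level minus the gain. All later estimates of distances are instances of
  this.\<close>

lemma distance_bound: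
  assumes "0 \<le> \<rho>" "x \<in> A" "y \<in> A" "E \<rho> x \<le> ereal a" "E \<rho> y \<le> ereal b"
  shows "(N (x - y))\<^sup>2 \<le> ((a + b) / 2 - min_value \<rho>) / \<alpha>"
  using min_value_le[OF assms(1) mid[OF assms(2,3)] convex[OF assms]] alpha
  by (simp add: field_simps)

text \<open>As \<open>E\<close> grows when its parameter decreases, later points compete in the earlier problems, and
  convexity bounds their distance by the gap between the minima.\<close>

lemma limit_of_near_minimizers:
  fixes \<sigma> :: "nat \<Rightarrow> real"
  assumes \<sigma>: "\<And>n. 0 \<le> \<sigma> n" "antimono \<sigma>"
    and X: "\<And>n. X n \<in> A" "\<And>n. E (\<sigma> n) (X n) \<le> ereal (min_value (\<sigma> n) + e n)"
    and e: "e \<longlonglongrightarrow> 0" and m: "\<And>n. min_value (\<sigma> n) \<le> m" "(\<lambda>n. min_value (\<sigma> n)) \<longlonglongrightarrow> m"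
  obtains x where "x \<in> A" "(\<lambda>n. N (X n - x)) \<longlonglongrightarrow> 0"
proof -
  let ?m = "\<lambda>n. min_value (\<sigma> n)"
  \<comment> \<open>The smaller of the two minima belongs to the earlier index; \<open>min\<close>
    makes the bound independent of the order of \<open>k\<close> and \<open>l\<close>.\<close>
  have *: "(N (X k - X l))\<^sup>2 \<le> (m - min (?m k) (?m l) + \<bar>e k\<bar> + \<bar>e l\<bar>) / \<alpha>" for k l
  proof -
    \<comment> \<open>Both differences are treated, since \<open>N\<close> is not assumed to be
      symmetric.\<close>
    have aux: "(N (X k - X l))\<^sup>2 \<le> (m - ?m k + \<bar>e k\<bar> + \<bar>e l\<bar>) / \<alpha>"
        "(N (X l - X k))\<^sup>2 \<le> (m - ?m k + \<bar>e k\<bar> + \<bar>e l\<bar>) / \<alpha>" if "k \<le> l" for k l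
    proof -
      have "E (\<sigma> k) (X l) \<le> E (\<sigma> l) (X l)"
        using antimono \<sigma> X that by (simp add: antimonoD)
      then have l: "E (\<sigma> k) (X l) \<le> ereal (?m l + e l)" using X(2) order_trans by blast
      have "((?m k + e k + (?m l + e l)) / 2 - ?m k) / \<alpha> \<le> (m - ?m k + \<bar>e k\<bar> + \<bar>e l\<bar>) / \<alpha>"
        using m(1)[of l] m(1)[of k] alpha by (intro divide_right_mono) (auto simp: field_simps)
      then show "(N (X k - X l))\<^sup>2 \<le> (m - ?m k + \<bar>e k\<bar> + \<bar>e l\<bar>) / \<alpha>"
        "(N (X l - X k))\<^sup>2 \<le> (m - ?m k + \<bar>e k\<bar> + \<bar>e l\<bar>) / \<alpha>"
        using distance_bound[OF \<sigma>(1) X(1) X(1) X(2) l] distance_bound[OF \<sigma>(1) X(1) X(1) l X(2)]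
        by (auto simp: add.commute)
    qed
    have "(m - ?m j + \<bar>e k\<bar> + \<bar>e l\<bar>) / \<alpha> \<le> (m - min (?m k) (?m l) + \<bar>e k\<bar> + \<bar>e l\<bar>) / \<alpha>"
      if "j = k \<or> j = l" for j
      using that alpha by (intro divide_right_mono) auto
    then show ?thesis
      using aux(1)[of k l] aux(2)[of l k] by (cases "k \<le> l") (force simp: algebra_simps)+
  qed
  have "\<exists>M. \<forall>k\<ge>M. \<forall>l\<ge>M. N (X k - X l) < d" if "0 < d" for d
  proof -
    \<comment> \<open>One third each for the gap of the minima and for the two errors
      \<open>e k\<close> and \<open>e l\<close>.\<close>
    have pos: "0 < \<alpha> * d\<^sup>2 / 3" using alpha that by simp
    from LIMSEQ_D[OF e pos] LIMSEQ_D[OF m(2) pos] obtain M1 M2 where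
      M: "\<And>n. n \<ge> M1 \<Longrightarrow> \<bar>e n\<bar> < \<alpha> * d\<^sup>2 / 3" "\<And>n. n \<ge> M2 \<Longrightarrow> \<bar>?m n - m\<bar> < \<alpha> * d\<^sup>2 / 3"
      by auto
    have "N (X k - X l) < d" if "k \<ge> max M1 M2" "l \<ge> max M1 M2" for k l
    proof -
      have "m - min (?m k) (?m l) + \<bar>e k\<bar> + \<bar>e l\<bar> < \<alpha> * d\<^sup>2"
      proof -
        have "m - ?m k < \<alpha> * d\<^sup>2 / 3" "m - ?m l < \<alpha> * d\<^sup>2 / 3"
          using M(2)[of k] M(2)[of l] that by (simp_all only: max.bounded_iff abs_less_iff, linarith+)
        moreover have "\<bar>e k\<bar> < \<alpha> * d\<^sup>2 / 3" "\<bar>e l\<bar> < \<alpha> * d\<^sup>2 / 3"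
          using M(1)[of k] M(1)[of l] that by simp_all
        ultimately show ?thesis unfolding min_def by simp
      qed
      then have "(m - min (?m k) (?m l) + \<bar>e k\<bar> + \<bar>e l\<bar>) / \<alpha> < d\<^sup>2"
        using alpha by (simp add: field_simps)
      then have "(N (X k - X l))\<^sup>2 < d\<^sup>2" using *[of k l] by linarith
      then show ?thesis using \<open>0 < d\<close> by (simp add: power_less_imp_less_base)
    qed
    then show ?thesis by blast
  qed
  then have "\<exists>x\<in>A. (\<lambda>n. N (X n - x)) \<longlonglongrightarrow> 0"
    by (intro complete X(1))
  then show thesis using that by blast
qed

lemma tendsto_inverse_Suc: "(\<lambda>n. c / real (Suc n)) \<longlonglongrightarrow> 0"
  by (rule LIMSEQ_Suc[OF lim_const_over_n])

text \<open>The direct method without compactness: for a constant parameter the near minimizers are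
  already a Cauchy sequence, and lower semicontinuity applies to their strong limit.\<close>

lemma minimizer_exists:
  assumes "0 \<le> \<rho>"
  obtains x where "x \<in> A" "E \<rho> x = ereal (min_value \<rho>)"
proof -
  have "\<exists>x. x \<in> A \<and> E \<rho> x \<le> ereal (min_value \<rho> + 1 / real (Suc n))" for n
    using near_minimizer[OF assms, of "1 / real (Suc n)"] by auto
  then obtain X where X: "\<And>n. X n \<in> A" "\<And>n. E \<rho> (X n) \<le> ereal (min_value \<rho> + 1 / real (Suc n))"
    by metis
  obtain x where x: "x \<in> A" "(\<lambda>n. N (X n - x)) \<longlonglongrightarrow> 0"
    using limit_of_near_minimizers[of "\<lambda>_. \<rho>" X "\<lambda>n. 1 / real (Suc n)" "min_value \<rho>"]
      X assms tendsto_inverse_Suc by (auto simp: antimono_def)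
  have "E \<rho> x \<le> ereal (min_value \<rho> + e)" if "0 < e" for e
  proof -
    obtain M where M: "1 / real (Suc M) < e" using \<open>0 < e\<close> nat_approx_posE by blast
    \<comment> \<open>The tail from \<open>M\<close> on is used because \<open>lsc\<close> asks for
      the bound at every index.\<close>
    have "1 / real (Suc (n + M)) \<le> e" for n
      by (rule order_trans[OF _ less_imp_le[OF M]]) (simp add: field_simps)
    then have "E \<rho> (X (n + M)) \<le> ereal (min_value \<rho> + e)" for n
      using X(2)[of "n + M"] by (meson add_left_mono ereal_less_eq(3) order_trans)
    then show ?thesis
      using lsc[OF assms, of "\<lambda>n. X (n + M)"] X(1) x LIMSEQ_ignore_initial_segment[OF x(2)] by blast
  qed
  then have "E \<rho> x \<le> ereal (min_value \<rho>) + ereal e" if "0 < e" for e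
    using that by simp
  then have "E \<rho> x \<le> ereal (min_value \<rho>)"
    by (simp add: ereal_le_epsilon2)
  then show thesis using that x(1) min_value_le_energy[OF assms x(1)] by (simp add: antisym)
qed

lemma min_value_antimono:
  assumes "0 \<le> \<sigma>" "\<sigma> \<le> \<rho>"
  shows "min_value \<rho> \<le> min_value \<sigma>"
proof -
  obtain x where x: "x \<in> A" "E \<sigma> x = ereal (min_value \<sigma>)" using minimizer_exists assms by blast
  have "0 \<le> \<rho>" using assms by simp
  then show ?thesis using min_value_le[OF _ x(1)] antimono[OF assms x(1)] x(2) by simp
qed

lemma is_arg_min_iff:
  assumes "0 \<le> \<rho>"
  shows "is_arg_min (E \<rho>) (\<lambda>y. y \<in> A) x \<longleftrightarrow> x \<in> A \<and> E \<rho> x = ereal (min_value \<rho>)"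
proof -
  obtain y where y: "y \<in> A" "E \<rho> y = ereal (min_value \<rho>)" using minimizer_exists assms by blast
  show ?thesis
  proof
    assume x: "is_arg_min (E \<rho>) (\<lambda>y. y \<in> A) x"
    then have "\<not> E \<rho> y < E \<rho> x" "x \<in> A" using y(1) by (auto simp: is_arg_min_def)
    then show "x \<in> A \<and> E \<rho> x = ereal (min_value \<rho>)"
      using y(2) min_value_le_energy[OF assms, of x] by (simp add: not_less antisym)
  next
    assume "x \<in> A \<and> E \<rho> x = ereal (min_value \<rho>)"
    then show "is_arg_min (E \<rho>) (\<lambda>y. y \<in> A) x"
      using min_value_le_energy[OF assms] by (simp add: is_arg_min_def not_less)
  qed
qed

text \<open>Both levels equal the minimum, so there is no excess. Equality cannot be expected, as
  \<open>N\<close> will be a seminorm on representatives.\<close>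

lemma minimizers_at_distance_zero:
  assumes "0 \<le> \<rho>" "is_arg_min (E \<rho>) (\<lambda>y. y \<in> A) x" "is_arg_min (E \<rho>) (\<lambda>y. y \<in> A) y"
  shows "N (x - y) = 0"
proof -
  have "(N (x - y))\<^sup>2 \<le> 0"
    using distance_bound[OF assms(1), of x y "min_value \<rho>" "min_value \<rho>"] assms is_arg_min_iff by simp
  then show ?thesis by simp
qed

text \<open>The converse comparison is \<open>min_value_antimono\<close>, which also reduces the
  claim to a single parameter of the form \<open>1 / real (Suc n)\<close>: the bound found there
  persists for all smaller parameters.\<close>

lemma min_value_lower_semicontinuous:
  assumes "0 < e"
  obtains \<delta> where "0 < \<delta>" "\<And>\<rho>. 0 \<le> \<rho> \<Longrightarrow> \<rho> \<le> \<delta> \<Longrightarrow> min_value 0 - e \<le> min_value \<rho>"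
proof -
  have "\<exists>n. min_value 0 - e \<le> min_value (1 / real (Suc n))"
  proof (rule ccontr)
    let ?\<sigma> = "\<lambda>n. 1 / real (Suc n)"
    assume "\<not> ?thesis"
    then have less: "min_value (?\<sigma> n) < min_value 0 - e" for n by (auto simp: not_le)
    have dec: "antimono ?\<sigma>" by (auto simp: antimono_def field_simps)
    then have inc: "incseq (\<lambda>n. min_value (?\<sigma> n))"
      by (auto simp: incseq_def intro!: min_value_antimono dest: antimonoD)
    then obtain m where m: "(\<lambda>n. min_value (?\<sigma> n)) \<longlonglongrightarrow> m"
      using incseq_convergent[of "\<lambda>n. min_value (?\<sigma> n)" "min_value 0 - e"] less less_imp_le by metis
    have mle: "min_value (?\<sigma> n) \<le> m" for n using inc m incseq_le by blast
    have m0: "m \<le> min_value 0 - e" by (rule LIMSEQ_le_const2[OF m]) (use less less_imp_le in blast)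
    have "\<exists>x. x \<in> A \<and> E (?\<sigma> n) x = ereal (min_value (?\<sigma> n))" for n
      using minimizer_exists[of "?\<sigma> n"] by fastforce
    then obtain X where X: "\<And>n. X n \<in> A" "\<And>n. E (?\<sigma> n) (X n) = ereal (min_value (?\<sigma> n))"
      by metis
    obtain x where x: "x \<in> A" "(\<lambda>n. N (X n - x)) \<longlonglongrightarrow> 0"
      using limit_of_near_minimizers[of ?\<sigma> X "\<lambda>_. 0" m] X m mle dec by auto
    \<comment> \<open>For fixed \<open>\<rho>\<close> all late minimizers have
      \<open>E \<rho>\<close> at most \<open>m\<close>, because their own parameters are smaller. So
      lower semicontinuity is applied to one fixed functional, and only then does \<open>sup\<close>
      pass to parameter 0.\<close>
    have "E \<rho> x \<le> ereal m" if pos: "0 < \<rho>" for \<rho>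
    proof -
      obtain M where M: "?\<sigma> M < \<rho>" using nat_approx_posE[OF pos] by auto
      have "E \<rho> (X (n + M)) \<le> ereal m" for n
      proof -
        have "?\<sigma> (n + M) \<le> ?\<sigma> M" by (simp add: field_simps)
        then have "E \<rho> (X (n + M)) \<le> E (?\<sigma> (n + M)) (X (n + M))"
          using M X(1) by (intro antimono) auto
        then show ?thesis unfolding X(2) using mle[of "n + M"] by (meson ereal_less_eq(3) order_trans)
      qed
      then show ?thesis
        using lsc[of \<rho> "\<lambda>n. X (n + M)" x] X(1) x LIMSEQ_ignore_initial_segment[OF x(2)] pos by simp
    qed
    then have "E 0 x \<le> ereal m" using sup x(1) by blast
    then have "min_value 0 \<le> m" using min_value_le x(1) by blast
    then show False using m0 assms by simp
  qed
  then obtain n where n: "min_value 0 - e \<le> min_value (1 / real (Suc n))" by blast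
  show thesis
  proof (rule that)
    show "0 < 1 / real (Suc n)" by simp
    show "min_value 0 - e \<le> min_value \<rho>" if "0 \<le> \<rho>" "\<rho> \<le> 1 / real (Suc n)" for \<rho>
      using n min_value_antimono[OF that] by simp
  qed
qed

text \<open>The points \<open>Y k\<close> are measured with their own parameter
  \<open>\<rho>s k\<close>, since \<open>E \<rho> (Y k)\<close> may be infinite. The comparison
  point \<open>y\<close> moves instead: \<open>\<rho> \<le> \<rho>s k\<close> bounds
  \<open>E (\<rho>s k) y\<close> by the limit minimum.\<close>

lemma almost_minimizers_converge:
  fixes \<rho>s :: "nat \<Rightarrow> real"
  assumes \<rho>s: "\<And>k. 0 \<le> \<rho>s k" "\<rho>s \<longlonglongrightarrow> \<rho>" "(\<forall>k. \<rho>s k = \<rho>) \<or> \<rho> = 0"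
    and Y: "\<And>k. Y k \<in> A" "\<And>e. 0 < e \<Longrightarrow> \<forall>\<^sub>F k in sequentially. E (\<rho>s k) (Y k) \<le> ereal (min_value \<rho> + e)"
    and y: "is_arg_min (E \<rho>) (\<lambda>y. y \<in> A) y"
  shows "(\<lambda>k. N (Y k - y)) \<longlonglongrightarrow> 0"
proof (rule LIMSEQ_I)
  fix d :: real assume d: "0 < d"
  \<comment> \<open>The excess will be at most \<open>3/2 * e\<close>: half of \<open>e\<close> from
    the level of \<open>Y k\<close>, and \<open>e\<close> from the drop of the minimum. Divided by
    \<open>\<alpha>\<close> this is \<open>3/8 * d\<^sup>2\<close>.\<close>
  define e where "e = \<alpha> * d\<^sup>2 / 4"
  have e: "0 < e" using d alpha by (simp add: e_def)
  have \<rho>: "0 \<le> \<rho>" using \<rho>s LIMSEQ_le_const by blast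
  have yA: "y \<in> A" "E \<rho> y = ereal (min_value \<rho>)" using y is_arg_min_iff \<rho> by auto
  have "\<forall>\<^sub>F k in sequentially. min_value \<rho> - e \<le> min_value (\<rho>s k) \<and> \<rho> \<le> \<rho>s k"
  proof (cases "\<forall>k. \<rho>s k = \<rho>")
    case True
    then show ?thesis using e by simp
  next
    case False
    then have "\<rho> = 0" using \<rho>s by blast
    obtain \<delta> where \<delta>: "0 < \<delta>" "\<And>\<rho>. 0 \<le> \<rho> \<Longrightarrow> \<rho> \<le> \<delta> \<Longrightarrow> min_value 0 - e \<le> min_value \<rho>"
      using min_value_lower_semicontinuous[OF e] by blast
    have "\<forall>\<^sub>F k in sequentially. \<rho>s k < \<delta>" using \<rho>s(2) \<open>\<rho> = 0\<close> \<delta>(1) order_tendstoD(2) by blast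
    then show ?thesis by eventually_elim (use \<delta> \<rho>s(1) \<open>\<rho> = 0\<close> in auto)
  qed
  with Y(2)[OF e] have "\<forall>\<^sub>F k in sequentially. norm (N (Y k - y) - 0) < d"
  proof eventually_elim
    case (elim k)
    have "E (\<rho>s k) y \<le> ereal (min_value \<rho>)" using antimono[OF \<rho> _ yA(1), of "\<rho>s k"] elim yA(2) by simp
    then have "(N (Y k - y))\<^sup>2 \<le> ((min_value \<rho> + e + min_value \<rho>) / 2 - min_value (\<rho>s k)) / \<alpha>"
      using distance_bound \<rho>s(1) Y(1) yA(1) elim by blast
    also have "\<dots> \<le> (3 / 2 * e) / \<alpha>" using alpha elim by (intro divide_right_mono) (auto simp: field_simps)
    also have "\<dots> < d\<^sup>2" using alpha d by (simp add: e_def field_simps)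
    finally show ?case using d N_nonneg by (simp add: power_less_imp_less_base)
  qed
  then show "\<exists>no. \<forall>n\<ge>no. norm (N (Y n - y) - 0) < d" by (simp add: eventually_sequentially)
qed

end

section \<open>Square integrable functions\<close>

locale bounded_domain =
  fixes \<Omega> :: "(real^3) set"
  assumes open_domain: "open \<Omega>" and bounded_domain: "bounded \<Omega>"
begin

abbreviation M :: "(real^3) measure"
  where "M \<equiv> lebesgue_on \<Omega>"

lemma domain_lmeasurable: "\<Omega> \<in> lmeasurable"
  using open_domain bounded_domain by (simp add: lmeasurable_open)

lemma domain_sets [simp]: "\<Omega> \<in> sets lebesgue"
  using domain_lmeasurable by (rule fmeasurableD)

sublocale finite_measure M
  by (rule finite_measure_lebesgue_on[OF domain_lmeasurable])

lemma L2_measurable: "f \<in> L2 \<Omega> V \<Longrightarrow> f \<in> borel_measurable M"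
  by (simp add: L2_def)

lemma L2_square_integrable: "f \<in> L2 \<Omega> V \<Longrightarrow> integrable M (\<lambda>x. (norm (f x))\<^sup>2)"
  by (simp add: L2_def)

lemma L2_in: "f \<in> L2 \<Omega> V \<Longrightarrow> x \<in> \<Omega> \<Longrightarrow> f x \<in> V"
  by (simp add: L2_def)

lemma L2_bound:
  assumes "f \<in> borel_measurable M" "g \<in> L2 \<Omega> W" "\<And>x. x \<in> \<Omega> \<Longrightarrow> norm (f x) \<le> c * norm (g x)"
    "\<And>x. x \<in> \<Omega> \<Longrightarrow> f x \<in> V"
  shows "f \<in> L2 \<Omega> V"
proof -
  have "integrable M (\<lambda>x. (norm (f x))\<^sup>2)"
  proof (rule Bochner_Integration.integrable_bound)
    show "integrable M (\<lambda>x. c\<^sup>2 * (norm (g x))\<^sup>2)" using L2_square_integrable[OF assms(2)] by simp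
    show "(\<lambda>x. (norm (f x))\<^sup>2) \<in> borel_measurable M" using assms(1) by simp
    show "AE x in M. norm ((norm (f x))\<^sup>2) \<le> norm (c\<^sup>2 * (norm (g x))\<^sup>2)"
      using assms(3) by (intro AE_I2) (auto simp: power_mult_distrib[symmetric] abs_mult power_mono)
  qed
  then show ?thesis using assms by (simp add: L2_def)
qed

lemma L2_const: "c \<in> V \<Longrightarrow> (\<lambda>_. c) \<in> L2 \<Omega> V"
  by (simp add: L2_def)

lemma L2_add:
  assumes "f \<in> L2 \<Omega> V" "g \<in> L2 \<Omega> W" "\<And>a b. a \<in> V \<Longrightarrow> b \<in> W \<Longrightarrow> a + b \<in> X"
  shows "(\<lambda>x. f x + g x) \<in> L2 \<Omega> X"
proof -
  have [measurable]: "f \<in> borel_measurable M" "g \<in> borel_measurable M"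
    using assms by (auto intro: L2_measurable)
  have "integrable M (\<lambda>x. (norm (f x + g x))\<^sup>2)"
  proof (rule Bochner_Integration.integrable_bound)
    show "integrable M (\<lambda>x. 2 * (norm (f x))\<^sup>2 + 2 * (norm (g x))\<^sup>2)"
      using assms L2_square_integrable by (intro Bochner_Integration.integrable_add) auto
    have "(norm (f x + g x))\<^sup>2 \<le> 2 * (norm (f x))\<^sup>2 + 2 * (norm (g x))\<^sup>2" for x
      using power_mono[OF norm_triangle_ineq[of "f x" "g x"], of 2]
        sum_squares_bound[of "norm (f x)" "norm (g x)"] by (simp add: power2_sum)
    then show "AE x in M. norm ((norm (f x + g x))\<^sup>2) \<le> norm (2 * (norm (f x))\<^sup>2 + 2 * (norm (g x))\<^sup>2)"
      by simp
  qed simp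
  then show ?thesis using assms by (simp add: L2_def)
qed

lemma L2_scaleR:
  assumes "f \<in> L2 \<Omega> V" "\<And>a. a \<in> V \<Longrightarrow> c *\<^sub>R a \<in> X"
  shows "(\<lambda>x. c *\<^sub>R f x) \<in> L2 \<Omega> X"
proof -
  have [measurable]: "f \<in> borel_measurable M" by (rule L2_measurable[OF assms(1)])
  show ?thesis
    by (rule L2_bound[OF _ assms(1), of _ "\<bar>c\<bar>"]) (use assms in \<open>auto intro: L2_in\<close>)
qed

lemma L2_diff:
  assumes "f \<in> L2 \<Omega> V" "g \<in> L2 \<Omega> W" "\<And>a b. a \<in> V \<Longrightarrow> b \<in> W \<Longrightarrow> a - b \<in> X"
  shows "(\<lambda>x. f x - g x) \<in> L2 \<Omega> X"
  using L2_add[OF assms(1) L2_scaleR[OF assms(2), of "-1" UNIV], of UNIV] assms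
  by (simp add: L2_def)

lemma L2_linear:
  assumes "f \<in> L2 \<Omega> V" "bounded_linear T"
  shows "(\<lambda>x. T (f x)) \<in> L2 \<Omega> UNIV"
proof -
  interpret bounded_linear T by fact
  obtain K where K: "\<And>x. norm (T x) \<le> norm x * K" using bounded by blast
  have "T \<in> borel_measurable borel"
    by (intro borel_measurable_continuous_onI continuous_at_imp_continuous_on) (simp add: isCont)
  then show ?thesis
    using assms(1) K
    by (intro L2_bound[OF _ assms(1), of _ K])
      (auto intro: measurable_compose L2_measurable simp: mult.commute)
qed

lemma L2_Pair:
  assumes "f \<in> L2 \<Omega> V" "g \<in> L2 \<Omega> W"
  shows "(\<lambda>x. (f x, g x)) \<in> L2 \<Omega> UNIV"
  using assms by (auto simp: L2_def norm_Pair borel_prod[symmetric])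

lemma L2_norm_power2: "(L2_norm \<Omega> f)\<^sup>2 = (LINT x|M. (norm (f x))\<^sup>2)"
  by (simp add: L2_norm_def integral_nonneg_AE)

lemma L2_norm_nonneg [simp]: "0 \<le> L2_norm \<Omega> f"
  by (simp add: L2_norm_def integral_nonneg_AE)

lemma L2_norm_cong:
  assumes "f \<in> borel_measurable M" "g \<in> borel_measurable M" "AE x in M. norm (f x) = norm (g x)"
  shows "L2_norm \<Omega> f = L2_norm \<Omega> g"
proof -
  have "(LINT x|M. (norm (f x))\<^sup>2) = (LINT x|M. (norm (g x))\<^sup>2)"
    by (rule integral_cong_AE) (use assms in auto)
  then show ?thesis by (simp add: L2_norm_def)
qed

lemma L2_norm_mono:
  assumes "f \<in> L2 \<Omega> V" "g \<in> L2 \<Omega> W" "AE x in M. norm (f x) \<le> norm (g x)"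
  shows "L2_norm \<Omega> f \<le> L2_norm \<Omega> g"
  unfolding L2_norm_def using assms(3)
  by (intro real_sqrt_le_mono integral_mono_AE L2_square_integrable[OF assms(1)]
      L2_square_integrable[OF assms(2)]) (auto elim!: eventually_mono intro!: power_mono)

lemma L2_norm_eq_0_iff:
  assumes "f \<in> L2 \<Omega> V"
  shows "L2_norm \<Omega> f = 0 \<longleftrightarrow> (AE x in M. f x = 0)"
  using integral_nonneg_eq_0_iff_AE[OF L2_square_integrable[OF assms]]
  by (simp add: L2_norm_def)

lemma L2_norm_scaleR: "L2_norm \<Omega> (\<lambda>x. c *\<^sub>R f x) = \<bar>c\<bar> * L2_norm \<Omega> f"
  by (simp add: L2_norm_def power_mult_distrib real_sqrt_mult)

lemma nn_integral_L2:
  assumes "f \<in> L2 \<Omega> V"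
  shows "(\<integral>\<^sup>+x. ennreal ((norm (f x))\<^sup>2) \<partial>M) = ennreal ((L2_norm \<Omega> f)\<^sup>2)"
  using nn_integral_eq_integral[OF L2_square_integrable[OF assms]] by (simp add: L2_norm_power2)

text \<open>Integrability follows by domination with the sum of squares; the inequality is
  Cauchy-Schwarz for nonnegative integrals, carried over to real integrals.\<close>

lemma L2_product:
  assumes "f \<in> L2 \<Omega> V" "g \<in> L2 \<Omega> W"
  shows "integrable M (\<lambda>x. norm (f x) * norm (g x))"
    and "(LINT x|M. norm (f x) * norm (g x)) \<le> L2_norm \<Omega> f * L2_norm \<Omega> g"
proof -
  have [measurable]: "f \<in> borel_measurable M" "g \<in> borel_measurable M"
    using assms by (auto intro: L2_measurable)
  show int: "integrable M (\<lambda>x. norm (f x) * norm (g x))"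
  proof (rule Bochner_Integration.integrable_bound)
    show "integrable M (\<lambda>x. (norm (f x))\<^sup>2 + (norm (g x))\<^sup>2)"
      using L2_square_integrable[OF assms(1)] L2_square_integrable[OF assms(2)] by simp
    have "norm (f x) * norm (g x) \<le> (norm (f x))\<^sup>2 + (norm (g x))\<^sup>2" for x
      using sum_squares_bound[of "norm (f x)" "norm (g x)"] by (simp add: algebra_simps)
        (smt (verit) mult_nonneg_nonneg norm_ge_zero)
    then show "AE x in M. norm (norm (f x) * norm (g x)) \<le> norm ((norm (f x))\<^sup>2 + (norm (g x))\<^sup>2)"
      by simp
  qed simp
  have "(\<integral>\<^sup>+x. ennreal (norm (f x)) * ennreal (norm (g x)) \<partial>M)\<^sup>2
      \<le> (\<integral>\<^sup>+x. (ennreal (norm (f x)))\<^sup>2 \<partial>M) * (\<integral>\<^sup>+x. (ennreal (norm (g x)))\<^sup>2 \<partial>M)"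
    by (rule Cauchy_Schwarz_nn_integral) auto
  also have "\<dots> = ennreal ((L2_norm \<Omega> f * L2_norm \<Omega> g)\<^sup>2)"
    using nn_integral_L2[OF assms(1)] nn_integral_L2[OF assms(2)]
    by (simp add: ennreal_power ennreal_mult power_mult_distrib)
  also have "(\<integral>\<^sup>+x. ennreal (norm (f x)) * ennreal (norm (g x)) \<partial>M)
      = ennreal (LINT x|M. norm (f x) * norm (g x))"
    using nn_integral_eq_integral[OF int] by (simp add: ennreal_mult)
  finally have "(LINT x|M. norm (f x) * norm (g x))\<^sup>2 \<le> (L2_norm \<Omega> f * L2_norm \<Omega> g)\<^sup>2"
    by (simp add: ennreal_power integral_nonneg_AE)
  then show "(LINT x|M. norm (f x) * norm (g x)) \<le> L2_norm \<Omega> f * L2_norm \<Omega> g"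
    by (rule power2_le_imp_le) simp
qed

text \<open>Cauchy-Schwarz against the constant 1, which is square integrable because the domain has
  finite measure.\<close>

lemma L2_integrable:
  assumes "f \<in> L2 \<Omega> V"
  shows "integrable M f"
    and "(LINT x|M. norm (f x)) \<le> sqrt (measure lebesgue \<Omega>) * L2_norm \<Omega> f"
proof -
  have 1: "(\<lambda>_. 1::real) \<in> L2 \<Omega> UNIV" by (simp add: L2_const)
  have "integrable M (\<lambda>x. norm (f x))" using L2_product(1)[OF assms 1] by simp
  then show "integrable M f" using L2_measurable[OF assms] by (simp add: integrable_norm_iff)
  show "(LINT x|M. norm (f x)) \<le> sqrt (measure lebesgue \<Omega>) * L2_norm \<Omega> f"
    using L2_product(2)[OF assms 1] by (simp add: L2_norm_def measure_restrict_space mult.commute)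
qed

lemma L2_norm_triangle:
  assumes "f \<in> L2 \<Omega> V" "g \<in> L2 \<Omega> W"
  shows "L2_norm \<Omega> (\<lambda>x. f x + g x) \<le> L2_norm \<Omega> f + L2_norm \<Omega> g"
proof (rule power2_le_imp_le)
  have [measurable]: "f \<in> borel_measurable M" "g \<in> borel_measurable M"
    using assms by (auto intro: L2_measurable)
  have i: "integrable M (\<lambda>x. (norm (f x))\<^sup>2)" "integrable M (\<lambda>x. (norm (g x))\<^sup>2)"
    "integrable M (\<lambda>x. norm (f x) * norm (g x))"
    using assms L2_square_integrable L2_product(1) by blast+
  have "(L2_norm \<Omega> (\<lambda>x. f x + g x))\<^sup>2 \<le> (LINT x|M. ((norm (f x))\<^sup>2 + (norm (g x))\<^sup>2) + 2 * (norm (f x) * norm (g x)))"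
    unfolding L2_norm_power2
  proof (rule integral_mono)
    show "integrable M (\<lambda>x. (norm (f x + g x))\<^sup>2)"
      using L2_square_integrable[OF L2_add[OF assms, of UNIV]] by simp
    show "(norm (f x + g x))\<^sup>2 \<le> ((norm (f x))\<^sup>2 + (norm (g x))\<^sup>2) + 2 * (norm (f x) * norm (g x))" for x
      using power_mono[OF norm_triangle_ineq[of "f x" "g x"], of 2] by (simp add: power2_sum)
  qed (use i in simp)
  also have "\<dots> = (L2_norm \<Omega> f)\<^sup>2 + (L2_norm \<Omega> g)\<^sup>2 + 2 * (LINT x|M. norm (f x) * norm (g x))"
    using i by (simp add: L2_norm_power2)
  also have "\<dots> \<le> (L2_norm \<Omega> f + L2_norm \<Omega> g)\<^sup>2"
    using L2_product(2)[OF assms] by (simp add: power2_sum)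
  finally show "(L2_norm \<Omega> (\<lambda>x. f x + g x))\<^sup>2 \<le> (L2_norm \<Omega> f + L2_norm \<Omega> g)\<^sup>2" .
qed simp

lemma L2_norm_triangle_diff:
  assumes "f \<in> L2 \<Omega> V" "g \<in> L2 \<Omega> W" "h \<in> L2 \<Omega> X"
  shows "L2_norm \<Omega> (\<lambda>x. f x - h x) \<le> L2_norm \<Omega> (\<lambda>x. f x - g x) + L2_norm \<Omega> (\<lambda>x. g x - h x)"
  using L2_norm_triangle[OF L2_diff[OF assms(1,2), of UNIV] L2_diff[OF assms(2,3), of UNIV]] by simp

text \<open>Convergence in L2 is L1 convergence of the squared distances to 0, for which an almost
  everywhere convergent subsequence is available.\<close>

lemma L2_converges_AE_subseq:
  assumes "\<And>n. X n \<in> L2 \<Omega> V" "f \<in> L2 \<Omega> W" "(\<lambda>n. L2_norm \<Omega> (\<lambda>x. X n x - f x)) \<longlonglongrightarrow> 0"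
  obtains r where "strict_mono r" "AE x in M. (\<lambda>n. X (r n) x) \<longlonglongrightarrow> f x"
proof -
  have int: "integrable M (\<lambda>x. (norm (X n x - f x))\<^sup>2)" for n
    using L2_square_integrable[OF L2_diff[OF assms(1,2), of UNIV]] by simp
  have "(\<lambda>n. (L2_norm \<Omega> (\<lambda>x. X n x - f x))\<^sup>2) \<longlonglongrightarrow> 0"
    using tendsto_power[OF assms(3), of 2] by simp
  then have "(\<lambda>n. LINT x|M. norm ((norm (X n x - f x))\<^sup>2)) \<longlonglongrightarrow> 0"
    by (simp add: L2_norm_power2)
  from tendsto_L1_AE_subseq[OF int this] obtain r where r: "strict_mono r"
    "AE x in M. (\<lambda>n. (norm (X (r n) x - f x))\<^sup>2) \<longlonglongrightarrow> 0" by auto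
  from r(2) have "AE x in M. (\<lambda>n. X (r n) x) \<longlonglongrightarrow> f x"
  proof eventually_elim
    case (elim x)
    have "(\<lambda>n. sqrt ((norm (X (r n) x - f x))\<^sup>2)) \<longlonglongrightarrow> sqrt 0" by (rule tendsto_real_sqrt[OF elim])
    then show ?case by (simp add: LIM_zero_iff tendsto_norm_zero_iff)
  qed
  then show thesis using that r(1) by blast
qed

text \<open>On a set of finite measure an L2 Cauchy sequence is L1 Cauchy and has an almost
  everywhere convergent subsequence; Fatou's lemma returns the convergence to L2.\<close>

lemma L2_complete:
  fixes X :: "nat \<Rightarrow> real^3 \<Rightarrow> 'b::euclidean_space"
  assumes X: "\<And>n. X n \<in> L2 \<Omega> V" and V: "subspace V"
    and cauchy: "\<And>e. 0 < e \<Longrightarrow> \<exists>N. \<forall>m\<ge>N. \<forall>n\<ge>N. L2_norm \<Omega> (\<lambda>x. X m x - X n x) < e"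
  obtains f where "f \<in> L2 \<Omega> V" "(\<lambda>n. L2_norm \<Omega> (\<lambda>x. X n x - f x)) \<longlonglongrightarrow> 0"
proof -
  have [measurable]: "X n \<in> borel_measurable M" for n by (rule L2_measurable[OF X])
  have diff: "(\<lambda>x. X m x - X n x) \<in> L2 \<Omega> UNIV" for m n
    by (rule L2_diff[OF X X]) simp
  have "\<exists>N. \<forall>i\<ge>N. \<forall>j\<ge>N. (LINT x|M. norm (X i x - X j x)) < e" if e: "0 < e" for e
  proof -
    \<comment> \<open>The summand 1 keeps the divisor positive.\<close>
    let ?c = "sqrt (measure lebesgue \<Omega>) + 1"
    have c: "0 < ?c" by (simp add: add_nonneg_pos)
    obtain N where N: "\<forall>m\<ge>N. \<forall>n\<ge>N. L2_norm \<Omega> (\<lambda>x. X m x - X n x) < e / ?c"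
      using cauchy[of "e / ?c"] e c by auto
    have "(LINT x|M. norm (X i x - X j x)) < e" if "i \<ge> N" "j \<ge> N" for i j
    proof -
      have "(LINT x|M. norm (X i x - X j x)) \<le> ?c * L2_norm \<Omega> (\<lambda>x. X i x - X j x)"
        using L2_integrable(2)[OF diff, of i j] L2_norm_nonneg[of "\<lambda>x. X i x - X j x"]
        unfolding distrib_right by linarith
      also have "\<dots> < e" using N that c by (simp add: pos_less_divide_eq mult.commute)
      finally show ?thesis .
    qed
    then show ?thesis by blast
  qed
  from cauchy_L1_AE_cauchy_subseq[OF L2_integrable(1)[OF X] this]
  obtain r where r: "strict_mono r" "AE x in M. Cauchy (\<lambda>i. X (r i) x)" by blast
  \<comment> \<open>Membership in \<open>L2 \<Omega> V\<close> constrains the values at every point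
    of the domain; the default 0 keeps \<open>f x\<close> in the subspace \<open>V\<close> where the
    subsequence fails to converge.\<close>
  define f where "f x = lim (\<lambda>i. if Cauchy (\<lambda>i. X (r i) x) then X (r i) x else 0)" for x
  have "(\<lambda>x. lim (\<lambda>i. if Cauchy (\<lambda>i. X (r i) x) then X (r i) x else 0)) \<in> borel_measurable M"
    by measurable
  then have f_meas [measurable]: "f \<in> borel_measurable M" unfolding f_def by (simp add: fun_eq_iff)
  have lim: "(\<lambda>i. X (r i) x) \<longlonglongrightarrow> f x" if "Cauchy (\<lambda>i. X (r i) x)" for x
    using that by (simp add: f_def Cauchy_convergent_iff convergent_LIMSEQ_iff)
  have fV: "f x \<in> V" if "x \<in> \<Omega>" for x
  proof (cases "Cauchy (\<lambda>i. X (r i) x)")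
    case True
    have "closed V" using V by (rule closed_subspace)
    then show ?thesis
      using closed_sequentially[OF _ _ lim[OF True]] L2_in[OF X that] by blast
  next
    case False
    then show ?thesis using V by (simp add: f_def subspace_0)
  qed
  have tail: "\<exists>N. \<forall>n\<ge>N. (\<integral>\<^sup>+x. ennreal ((norm (X n x - f x))\<^sup>2) \<partial>M) \<le> ennreal (e\<^sup>2)" if e: "0 < e" for e
  proof -
    obtain N where N: "\<forall>m\<ge>N. \<forall>n\<ge>N. L2_norm \<Omega> (\<lambda>x. X m x - X n x) < e"
      using cauchy[OF e] by blast
    have "(\<integral>\<^sup>+x. ennreal ((norm (X n x - f x))\<^sup>2) \<partial>M) \<le> ennreal (e\<^sup>2)" if "n \<ge> N" for n
    proof -
      \<comment> \<open>The distance to \<open>f\<close> is the limit of the distances to the later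
        members of the subsequence, so Fatou's lemma inherits their Cauchy bound.\<close>
      have "AE x in M. ennreal ((norm (X n x - f x))\<^sup>2) = liminf (\<lambda>i. ennreal ((norm (X n x - X (r i) x))\<^sup>2))"
        using r(2)
      proof eventually_elim
        case (elim x)
        have "(\<lambda>i. ennreal ((norm (X n x - X (r i) x))\<^sup>2)) \<longlonglongrightarrow> ennreal ((norm (X n x - f x))\<^sup>2)"
          by (intro tendsto_ennrealI tendsto_power tendsto_norm tendsto_diff tendsto_const lim elim)
        then show ?case using lim_imp_Liminf by force
      qed
      then have "(\<integral>\<^sup>+x. ennreal ((norm (X n x - f x))\<^sup>2) \<partial>M)
          = (\<integral>\<^sup>+x. liminf (\<lambda>i. ennreal ((norm (X n x - X (r i) x))\<^sup>2)) \<partial>M)"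
        by (rule nn_integral_cong_AE)
      also have "\<dots> \<le> liminf (\<lambda>i. \<integral>\<^sup>+x. ennreal ((norm (X n x - X (r i) x))\<^sup>2) \<partial>M)"
        by (rule nn_integral_liminf) simp
      also have "\<dots> \<le> ennreal (e\<^sup>2)"
      proof (rule Liminf_le)
        have "(\<integral>\<^sup>+x. ennreal ((norm (X n x - X (r i) x))\<^sup>2) \<partial>M) \<le> ennreal (e\<^sup>2)" if "i \<ge> N" for i
        proof -
          have "r i \<ge> N" using r(1) that seq_suble order_trans by blast
          then have "L2_norm \<Omega> (\<lambda>x. X n x - X (r i) x) \<le> e" using N \<open>n \<ge> N\<close> less_imp_le by blast
          then show ?thesis
            unfolding nn_integral_L2[OF diff] by (intro ennreal_leI power_mono) auto
        qed
        then show "\<forall>\<^sub>F i in sequentially. (\<integral>\<^sup>+x. ennreal ((norm (X n x - X (r i) x))\<^sup>2) \<partial>M) \<le> ennreal (e\<^sup>2)"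
          by (auto simp: eventually_sequentially)
      qed simp
      finally show ?thesis .
    qed
    then show ?thesis by blast
  qed
  \<comment> \<open>One index at finite distance suffices to place \<open>f\<close> in L2, as
    \<open>f\<close> is \<open>X n\<close> minus their difference.\<close>
  obtain n where n: "(\<integral>\<^sup>+x. ennreal ((norm (X n x - f x))\<^sup>2) \<partial>M) \<le> ennreal (1\<^sup>2)"
    using tail[of 1] by auto
  then have "integrable M (\<lambda>x. (norm (X n x - f x))\<^sup>2)"
    by (intro integrableI_nonneg) (auto simp: le_less_trans)
  then have "(\<lambda>x. X n x - f x) \<in> L2 \<Omega> UNIV" by (simp add: L2_def)
  from L2_diff[OF X[of n] this, of UNIV] have "f \<in> L2 \<Omega> UNIV" by simp
  then have f: "f \<in> L2 \<Omega> V" using fV by (simp add: L2_def)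
  have "(\<lambda>n. L2_norm \<Omega> (\<lambda>x. X n x - f x)) \<longlonglongrightarrow> 0"
  proof (rule LIMSEQ_I)
    fix e :: real assume "0 < e"
    then obtain N where N: "\<forall>n\<ge>N. (\<integral>\<^sup>+x. ennreal ((norm (X n x - f x))\<^sup>2) \<partial>M) \<le> ennreal ((e/2)\<^sup>2)"
      using tail[of "e/2"] by auto
    have "norm (L2_norm \<Omega> (\<lambda>x. X n x - f x) - 0) < e" if "n \<ge> N" for n
    proof -
      have "ennreal ((L2_norm \<Omega> (\<lambda>x. X n x - f x))\<^sup>2) \<le> ennreal ((e/2)\<^sup>2)"
        using N that nn_integral_L2[OF L2_diff[OF X f, of UNIV]] by simp
      then have "(L2_norm \<Omega> (\<lambda>x. X n x - f x))\<^sup>2 \<le> (e/2)\<^sup>2" by simp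
      then have "L2_norm \<Omega> (\<lambda>x. X n x - f x) \<le> e/2"
        by (rule power2_le_imp_le) (use \<open>0 < e\<close> in simp)
      then show ?thesis using \<open>0 < e\<close> by simp
    qed
    then show "\<exists>no. \<forall>n\<ge>no. norm (L2_norm \<Omega> (\<lambda>x. X n x - f x) - 0) < e" by blast
  qed
  then show thesis using that f by blast
qed

end

section \<open>Smooth functions and weak gradients\<close>

lemma Ck_const: "Ck k (\<lambda>_. c)"
proof (induction k arbitrary: c)
  case (Suc k)
  show ?case by (auto intro!: exI[of _ "\<lambda>_. 0"] Suc)
qed simp

lemma Ck_Suc_imp: "Ck (Suc k) f \<Longrightarrow> Ck k f"
proof (induction k arbitrary: f)
  case 0
  then obtain g where "\<forall>x. (f has_derivative (\<lambda>v. g x \<bullet> v)) (at x)" by auto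
  then have "\<forall>x\<in>UNIV. isCont f x" using has_derivative_continuous by blast
  then show ?case by (simp add: continuous_at_imp_continuous_on)
next
  case (Suc k)
  then show ?case by (metis Ck.simps(2))
qed

lemma Ck_add: "Ck k f \<Longrightarrow> Ck k g \<Longrightarrow> Ck k (\<lambda>x. f x + g x)"
proof (induction k arbitrary: f g)
  case 0
  then show ?case by (auto intro: continuous_on_add)
next
  case (Suc k)
  obtain f' g' where "\<forall>x. (f has_derivative (\<lambda>v. f' x \<bullet> v)) (at x)" "\<forall>j. Ck k (\<lambda>x. f' x $ j)"
    "\<forall>x. (g has_derivative (\<lambda>v. g' x \<bullet> v)) (at x)" "\<forall>j. Ck k (\<lambda>x. g' x $ j)"
    using Suc.prems by auto
  then have "\<forall>x. ((\<lambda>x. f x + g x) has_derivative (\<lambda>v. (f' x + g' x) \<bullet> v)) (at x)"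
    "\<forall>j. Ck k (\<lambda>x. (f' x + g' x) $ j)"
    using Suc.IH by (auto simp: inner_add_left intro!: has_derivative_add)
  then show ?case by (auto simp del: vector_add_component)
qed

lemma Ck_mult: "Ck k f \<Longrightarrow> Ck k g \<Longrightarrow> Ck k (\<lambda>x. f x * g x)"
proof (induction k arbitrary: f g)
  case 0
  then show ?case by (auto intro: continuous_on_mult)
next
  case (Suc k)
  obtain f' g' where d: "\<forall>x. (f has_derivative (\<lambda>v. f' x \<bullet> v)) (at x)" "\<forall>j. Ck k (\<lambda>x. f' x $ j)"
    "\<forall>x. (g has_derivative (\<lambda>v. g' x \<bullet> v)) (at x)" "\<forall>j. Ck k (\<lambda>x. g' x $ j)"
    using Suc.prems by auto
  let ?h = "\<lambda>x. f x *\<^sub>R g' x + g x *\<^sub>R f' x"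
  have "\<forall>x. ((\<lambda>x. f x * g x) has_derivative (\<lambda>v. ?h x \<bullet> v)) (at x)"
    using d by (auto intro!: derivative_eq_intros simp: inner_add_left)
  \<comment> \<open>The gradient of a product contains the undifferentiated factors, so their
    regularity is lowered by one order for the induction hypothesis.\<close>
  moreover have "Ck k f" "Ck k g" using Suc.prems Ck_Suc_imp by blast+
  then have "\<forall>j. Ck k (\<lambda>x. ?h x $ j)"
    using d Suc.IH by (auto intro!: Ck_add)
  ultimately show ?case by (auto simp del: vector_add_component)
qed

lemma Ck_prod: "finite A \<Longrightarrow> (\<And>i. i \<in> A \<Longrightarrow> Ck k (f i)) \<Longrightarrow> Ck k (\<lambda>x. \<Prod>i\<in>A. f i x)"
  by (induction A rule: finite_induct) (auto simp: Ck_const intro: Ck_mult)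

lemma smoothE:
  assumes "smooth f"
  obtains g where "\<And>x. (f has_derivative (\<lambda>v. g x \<bullet> v)) (at x)" "\<And>j. continuous_on UNIV (\<lambda>x. g x $ j)"
proof -
  have "Ck (Suc 0) f" using assms by (simp add: smooth_def)
  then show thesis using that by auto
qed

lemma smooth_continuous: "smooth f \<Longrightarrow> continuous_on UNIV f"
  unfolding smooth_def by (drule spec[of _ 0]) simp

lemma smooth_add: "smooth f \<Longrightarrow> smooth g \<Longrightarrow> smooth (\<lambda>x. f x + g x)"
  by (simp add: smooth_def Ck_add)

lemma smooth_mult: "smooth f \<Longrightarrow> smooth g \<Longrightarrow> smooth (\<lambda>x. f x * g x)"
  by (simp add: smooth_def Ck_mult)

lemma smooth_const: "smooth (\<lambda>_. c)"
  by (simp add: smooth_def Ck_const)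

definition partial :: "(real^3 \<Rightarrow> real) \<Rightarrow> 3 \<Rightarrow> real^3 \<Rightarrow> real"
  where "partial f j x = frechet_derivative f (at x) (axis j 1)"

lemma partial_eq:
  assumes "(f has_derivative (\<lambda>v. g \<bullet> v)) (at x)"
  shows "partial f j x = g $ j"
  using frechet_derivative_at[OF assms] by (metis partial_def inner_axis inner_real_def mult.right_neutral)

lemma smooth_partial:
  assumes "smooth f"
  shows "continuous_on UNIV (partial f j)"
    and "((\<lambda>t. f (x + t *\<^sub>R axis j 1)) has_real_derivative partial f j (x + t *\<^sub>R axis j 1)) (at t)"
proof -
  obtain g where g: "\<And>x. (f has_derivative (\<lambda>v. g x \<bullet> v)) (at x)" "\<And>j. continuous_on UNIV (\<lambda>x. g x $ j)"
    using smoothE[OF assms] by metis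
  have eq: "partial f j = (\<lambda>x. g x $ j)" using partial_eq[OF g(1)] by auto
  show "continuous_on UNIV (partial f j)" unfolding eq by (rule g)
  have "((\<lambda>t. f (x + t *\<^sub>R axis j 1)) has_derivative (\<lambda>s. g (x + t *\<^sub>R axis j 1) \<bullet> (s *\<^sub>R axis j 1))) (at t)"
    by (rule has_derivative_compose[of "\<lambda>t. x + t *\<^sub>R axis j 1", OF _ g(1)])
      (auto intro!: derivative_eq_intros)
  then show "((\<lambda>t. f (x + t *\<^sub>R axis j 1)) has_real_derivative partial f j (x + t *\<^sub>R axis j 1)) (at t)"
    unfolding eq has_field_derivative_def by (simp add: inner_axis mult_commute_abs)
qed

lemma partial_mult:
  assumes "smooth f" "smooth g"
  shows "partial (\<lambda>x. f x * g x) j x = f x * partial g j x + partial f j x * g x"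
proof -
  obtain f' where f': "\<And>x. (f has_derivative (\<lambda>v. f' x \<bullet> v)) (at x)" using smoothE[OF assms(1)] by metis
  obtain g' where g': "\<And>x. (g has_derivative (\<lambda>v. g' x \<bullet> v)) (at x)" using smoothE[OF assms(2)] by metis
  have "((\<lambda>x. f x * g x) has_derivative (\<lambda>v. (f x *\<^sub>R g' x + g x *\<^sub>R f' x) \<bullet> v)) (at x)"
    using f' g' by (auto intro!: derivative_eq_intros simp: inner_add_left)
  from partial_eq[OF this] show ?thesis
    using partial_eq[OF f'[of x]] partial_eq[OF g'[of x]] by simp
qed

lemma partial_eq_0:
  assumes "smooth f" "open U" "x \<in> U" "\<And>y. y \<in> U \<Longrightarrow> f y = 0"
  shows "partial f j x = 0"
proof -
  obtain g where g: "\<And>x. (f has_derivative (\<lambda>v. g x \<bullet> v)) (at x)" using smoothE[OF assms(1)] by metis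
  have "((\<lambda>_. 0) has_derivative (\<lambda>v. g x \<bullet> v)) (at x)"
    using g[of x] has_derivative_transform_within_open[OF g[of x] assms(2,3)] assms(4) by simp
  then have "(\<lambda>v. g x \<bullet> v) = (\<lambda>_. 0)" using has_derivative_const has_derivative_unique by blast
  then have "g x \<bullet> axis j 1 = 0" by meson
  then show ?thesis using partial_eq[OF g[of x]] by (simp add: inner_axis)
qed

text \<open>By translation invariance the difference quotients have integral 0.\<close>

lemma integral_partial_eq_0:
  assumes f: "smooth f" and S: "compact S" "\<And>x. x \<notin> S \<Longrightarrow> f x = 0"
  shows "integrable lborel (partial f j)" "(LINT x|lborel. partial f j x) = 0"
proof -
  let ?e = "axis j (1::real) :: real^3"
  note cont = smooth_continuous[OF f] smooth_partial(1)[OF f, of j]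
  have [measurable]: "f \<in> borel_measurable borel" "partial f j \<in> borel_measurable borel"
    using cont by (auto intro: borel_measurable_continuous_onI)
  have zero: "partial f j x = 0" if "x \<notin> S" for x
    using partial_eq_0[OF f, of "- S" x] that S compact_imp_closed by auto
  have "compact (partial f j ` S)"
    using compact_continuous_image[OF continuous_on_subset[OF cont(2)] S(1)] by simp
  then obtain K0 where K0: "\<forall>y\<in>partial f j ` S. norm y \<le> K0"
    using compact_imp_bounded bounded_iff by blast
  define K where "K = max K0 0"
  have K: "\<bar>partial f j x\<bar> \<le> K" "0 \<le> K" for x
    using K0 zero[of x] by (cases "x \<in> S"; force simp: K_def)+
  obtain R where R: "\<And>x. x \<in> S \<Longrightarrow> norm x \<le> R" using compact_imp_bounded[OF S(1)] bounded_iff by blast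
  \<comment> \<open>Steps are at most 1, so a shifted point in \<open>S\<close> forces the original
    point into the ball of radius \<open>R + 1\<close>; there all difference quotients have their
    support.\<close>
  define B where "B = cball (0::real^3) (R + 1)"
  have B [measurable]: "B \<in> sets borel" by (simp add: B_def)
  have bint: "integrable lborel (\<lambda>x. K * indicator B x)"
    using emeasure_lborel_cball_finite[of "0::real^3" "R + 1"] by (simp add: B_def)
  let ?h = "\<lambda>n. inverse (real (Suc n))"
  let ?d = "\<lambda>n x. (f (x + ?h n *\<^sub>R ?e) - f x) / ?h n"
  have h: "0 < ?h n" "?h n \<le> 1" for n by (auto simp: field_simps)
  \<comment> \<open>By the mean value theorem the quotient is a partial derivative at an
    intermediate point: bounded by \<open>K\<close>, and zero unless that point lies in
    \<open>S\<close>.\<close>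
  have bound: "\<bar>?d n x\<bar> \<le> K * indicator B x" for n x
  proof -
    have "\<exists>z. 0 < z \<and> z < ?h n \<and> f (x + ?h n *\<^sub>R ?e) - f (x + 0 *\<^sub>R ?e)
        = (?h n - 0) * partial f j (x + z *\<^sub>R ?e)"
      by (rule MVT2[OF h(1)]) (use smooth_partial(2)[OF f] in blast)
    then obtain z where z: "0 < z" "z < ?h n" "?d n x = partial f j (x + z *\<^sub>R ?e)"
      using h(1)[of n] by auto
    show ?thesis
    proof (cases "x + z *\<^sub>R ?e \<in> S")
      case True
      have "norm x \<le> norm (x + z *\<^sub>R ?e) + norm (z *\<^sub>R ?e)" by (metis add_diff_cancel norm_triangle_ineq4)
      also have "\<dots> \<le> R + 1" using R[OF True] z h(2)[of n] by simp
      finally show ?thesis using z(3) K by (simp add: B_def)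
    next
      case False
      then show ?thesis using z(3) zero K by simp
    qed
  qed
  have lim: "(\<lambda>n. ?d n x) \<longlonglongrightarrow> partial f j x" for x
  proof -
    have "((\<lambda>t. f (x + t *\<^sub>R ?e)) has_real_derivative partial f j x) (at 0)"
      using smooth_partial(2)[OF f, of x j 0] by simp
    then have "((\<lambda>t. (f (x + t *\<^sub>R ?e) - f x) / t) \<longlongrightarrow> partial f j x) (at 0)"
      by (simp add: DERIV_def)
    moreover have "filterlim ?h (at 0) sequentially"
      using LIMSEQ_inverse_real_of_nat by (simp add: filterlim_at)
    ultimately show ?thesis by (rule filterlim_compose)
  qed
  have "compact (f ` S)" using compact_continuous_image[OF continuous_on_subset[OF cont(1)] S(1)] by simp
  then obtain L where L: "\<forall>y\<in>f ` S. norm y \<le> L" using compact_imp_bounded bounded_iff by blast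
  have "integrable lborel f"
  proof (rule Bochner_Integration.integrable_bound)
    show "integrable lborel (\<lambda>x. \<bar>L\<bar> * indicator B x)"
      using emeasure_lborel_cball_finite[of "0::real^3" "R + 1"] by (simp add: B_def)
    have "norm (f x) \<le> norm (\<bar>L\<bar> * indicator B x)" for x
      using L S(2)[of x] R[of x] by (cases "x \<in> S") (force simp: B_def)+
    then show "AE x in lborel. norm (f x) \<le> norm (\<bar>L\<bar> * indicator B x)" by simp
  qed simp
  moreover have "integrable lborel (\<lambda>x. f (x + ?h n *\<^sub>R ?e))"
    "(LINT x|lborel. f (x + ?h n *\<^sub>R ?e)) = (LINT x|lborel. f x)" for n
    using calculation integrable_distr_eq[of "(+) (?h n *\<^sub>R ?e)" lborel borel f]
      integral_distr[of "(+) (?h n *\<^sub>R ?e)" lborel borel f]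
    by (simp_all add: lborel_distr_plus add.commute)
  ultimately have "(LINT x|lborel. ?d n x) = 0" for n by simp
  moreover have dom: "AE x in lborel. (\<lambda>n. ?d n x) \<longlonglongrightarrow> partial f j x"
    "\<And>n. AE x in lborel. norm (?d n x) \<le> K * indicator B x"
    using lim bound by auto
  moreover have meas: "partial f j \<in> borel_measurable lborel" "\<And>n. ?d n \<in> borel_measurable lborel"
    by measurable
  ultimately show "(LINT x|lborel. partial f j x) = 0"
    using integral_dominated_convergence[OF meas bint dom] LIMSEQ_unique[OF _ tendsto_const] by simp
  show "integrable lborel (partial f j)"
    using integrable_dominated_convergence[OF meas bint dom] .
qed

section \<open>Smooth bump functions on boxes\<close>

text \<open>The functions \<open>p (1 / t) exp (- c / t)\<close>, extended by 0, are closed under differentiation.\<close>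

definition flat :: "real \<Rightarrow> real poly \<Rightarrow> real \<Rightarrow> real"
  where "flat c p t = (if 0 < t then poly p (1 / t) * exp (- c / t) else 0)"

text \<open>Half of the exponential is spent on the factor \<open>s\<close> in front of the
  remaining polynomial and half on that polynomial; hence the induction over all rates
  \<open>c\<close>.\<close>

lemma poly_times_exp_tendsto_0:
  fixes c :: real
  assumes "0 < c"
  shows "((\<lambda>s. poly p s * exp (- c * s)) \<longlongrightarrow> 0) at_top"
  using assms
proof (induction p arbitrary: c)
  case 0
  then show ?case by simp
next
  case (pCons a p)
  have e: "((\<lambda>s. s ^ k * exp (- d * s)) \<longlongrightarrow> 0) at_top" if "0 < d" for d :: real and k
  proof -
    have "filterlim (\<lambda>s. d * s) at_top at_top"
      by (rule filterlim_tendsto_pos_mult_at_top[OF tendsto_const that filterlim_ident])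
    from filterlim_compose[OF tendsto_power_div_exp_0 this]
    have "((\<lambda>s. (d * s) ^ k / exp (d * s) / d ^ k) \<longlongrightarrow> 0 / d ^ k) at_top"
      by (intro tendsto_divide) (use that in auto)
    moreover have "(d * s) ^ k / exp (d * s) / d ^ k = s ^ k * exp (- d * s)" for s
      using that by (simp add: power_mult_distrib exp_minus divide_simps)
    ultimately show ?thesis by simp
  qed
  have "0 < c / 2" using pCons.prems by simp
  have "((\<lambda>s. a * (s ^ 0 * exp (- c * s)) + (s ^ 1 * exp (- (c/2) * s)) * (poly p s * exp (- (c/2) * s)))
      \<longlongrightarrow> a * 0 + 0 * 0) at_top"
    by (intro tendsto_add tendsto_mult tendsto_const e pCons.IH) (use pCons.prems in auto)
  moreover have "exp (- (c/2) * s) * exp (- (c/2) * s) = exp (- c * s)" for s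
    by (simp add: mult_exp_exp)
  then have "a * (s ^ 0 * exp (- c * s)) + (s ^ 1 * exp (- (c/2) * s)) * (poly p s * exp (- (c/2) * s))
      = poly (pCons a p) s * exp (- c * s)" for s
  proof -
    have "a * (s ^ 0 * (x * x)) + (s ^ 1 * x) * (y * x) = (a + s * y) * (x * x)" for x y
      by (simp add: algebra_simps)
    from this[of "exp (- (c/2) * s)" "poly p s"] show ?thesis
      unfolding \<open>\<And>s. exp (- (c/2) * s) * exp (- (c/2) * s) = exp (- c * s)\<close> poly_pCons .
  qed
  ultimately show ?case by simp
qed

text \<open>With s = 1/t the derivative of s is minus its square; this is the factor
  \<open>[:0, 0, 1:]\<close>, and its sign turns the derivative of
  \<open>poly p s * exp (- c * s)\<close> into \<open>smult c p - pderiv p\<close>.\<close>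

lemma flat_has_derivative:
  assumes c: "0 < c"
  shows "(flat c p has_real_derivative flat c ([:0, 0, 1:] * (smult c p - pderiv p)) t) (at t)"
proof -
  let ?q = "[:0, 0, 1:] * (smult c p - pderiv p)"
  consider "0 < t" | "t < 0" | "t = 0" by linarith
  then show ?thesis
  proof cases
    case 1
    have "((\<lambda>t. poly p (1 / t) * exp (- c / t)) has_real_derivative
        poly (pderiv p) (1 / t) * (- 1 / t\<^sup>2) * exp (- c / t) + poly p (1 / t) * (exp (- c / t) * (c / t\<^sup>2))) (at t)"
      by (rule derivative_eq_intros DERIV_chain2[OF poly_DERIV] refl
          | use 1 in \<open>simp add: power2_eq_square field_simps\<close>)+
    also have "poly (pderiv p) (1 / t) * (- 1 / t\<^sup>2) * exp (- c / t) + poly p (1 / t) * (exp (- c / t) * (c / t\<^sup>2))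
        = flat c ?q t"
      using 1 by (simp add: flat_def power2_eq_square field_simps)
    finally show ?thesis
      by (rule has_field_derivative_transform_within_open[of _ _ _ "{0<..}"]) (use 1 in \<open>auto simp: flat_def\<close>)
  next
    case 2
    have "((\<lambda>_. 0) has_real_derivative flat c ?q t) (at t)" using 2 by (simp add: flat_def)
    then show ?thesis
      by (rule has_field_derivative_transform_within_open[of _ _ _ "{..<0}"]) (use 2 in \<open>auto simp: flat_def\<close>)
  next
    case 3
    have r: "((\<lambda>h. flat c p h / h) \<longlongrightarrow> 0) (at_right 0)"
    proof -
      \<comment> \<open>Dividing by \<open>h\<close> raises the polynomial by one degree in
        \<open>1 / h\<close>, so the difference quotient at 0 is again of the form that the
        exponential dominates.\<close>
      have "((\<lambda>h. poly ([:0, 1:] * p) (inverse h) * exp (- c * inverse h)) \<longlongrightarrow> 0) (at_right 0)"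
        by (rule filterlim_compose[OF poly_times_exp_tendsto_0[OF c] filterlim_inverse_at_top_right])
      then show ?thesis
        by (rule Lim_transform_eventually)
          (auto simp: eventually_at_filter flat_def inverse_eq_divide field_simps)
    qed
    have l: "((\<lambda>h. flat c p h / h) \<longlongrightarrow> 0) (at_left 0)"
      by (rule Lim_transform_eventually[OF tendsto_const]) (auto simp: eventually_at_filter flat_def)
    show ?thesis
      using 3 filterlim_split_at_real[OF l r] by (simp add: DERIV_def flat_def)
  qed
qed

lemma Ck_flat:
  assumes c: "0 < c"
  shows "Ck k (\<lambda>x. flat c p (s * x $ i + a))"
proof (induction k arbitrary: p)
  case 0
  have "continuous_on UNIV (flat c p)"
    using flat_has_derivative[OF c] by (intro continuous_at_imp_continuous_on) (auto intro: DERIV_isCont)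
  then have "continuous_on UNIV (flat c p \<circ> (\<lambda>x::real^3. s * x $ i + a))"
    by (intro continuous_on_compose continuous_intros) (auto intro: continuous_on_subset)
  then show ?case by (simp add: o_def)
next
  case (Suc k)
  define q where "q = [:0, 0, 1:] * (smult c p - pderiv p)"
  let ?g = "\<lambda>x::real^3. (s * flat c q (s * x $ i + a)) *\<^sub>R axis i (1::real)"
  have "((\<lambda>x. flat c p (s * x $ i + a)) has_derivative (\<lambda>v. ?g x \<bullet> v)) (at x)" for x :: "real^3"
  proof -
    have "((\<lambda>x::real^3. s * x $ i + a) has_derivative (\<lambda>v. s * v $ i)) (at x)"
      by (auto intro!: derivative_eq_intros bounded_linear.has_derivative[OF bounded_linear_vec_nth])
    from has_derivative_compose[OF this flat_has_derivative[OF c, of p, unfolded has_field_derivative_def, folded q_def]]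
    show ?thesis by (simp add: inner_axis' algebra_simps)
  qed
  moreover have "Ck k (\<lambda>x. ?g x $ j)" for j
  proof -
    \<comment> \<open>All components stay in the family of \<open>flat\<close> functions: the inner
      derivative \<open>s\<close> is absorbed by the polynomial, and components other than
      \<open>i\<close> use the polynomial 0.\<close>
    have "(\<lambda>x. ?g x $ j) = (\<lambda>x. flat c (if i = j then smult s q else 0) (s * x $ i + a))"
      by (auto simp: fun_eq_iff axis_def flat_def)
    then show ?thesis using Suc.IH by simp
  qed
  ultimately show ?case unfolding Ck.simps by (intro exI[of _ ?g] conjI allI)
qed

text \<open>A product of one-sided functions, positive exactly on the open box. As \<open>c\<close>
  tends to 0 it tends to the indicator of the box and stays below 1. The factors 1 and - 1 and the
  added constants match the affine argument in \<open>Ck_flat\<close>.\<close>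

definition bump :: "real \<Rightarrow> real^3 \<Rightarrow> real^3 \<Rightarrow> real^3 \<Rightarrow> real"
  where "bump c a b x = (\<Prod>i\<in>UNIV. flat c 1 (1 * x $ i + - a $ i) * flat c 1 (- 1 * x $ i + b $ i))"

lemma bump_test_function:
  assumes "0 < c" "cbox a b \<subseteq> \<Omega>"
  shows "bump c a b \<in> test_functions \<Omega>"
proof -
  have "smooth (bump c a b)"
    unfolding smooth_def bump_def using assms(1) by (intro allI Ck_prod Ck_mult Ck_flat) auto
  moreover have "{x. bump c a b x \<noteq> 0} \<subseteq> cbox a b"
  proof safe
    fix x assume "bump c a b x \<noteq> 0"
    then have "flat c 1 (1 * x $ i + - a $ i) \<noteq> 0 \<and> flat c 1 (- 1 * x $ i + b $ i) \<noteq> 0" for i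
      by (auto simp: bump_def)
    then have "0 < 1 * x $ i + - a $ i \<and> 0 < - 1 * x $ i + b $ i" for i
      unfolding flat_def by meson
    then show "x \<in> cbox a b" unfolding mem_box_cart by (smt (verit))
  qed
  then have sub: "closure {x. bump c a b x \<noteq> 0} \<subseteq> cbox a b"
    by (rule closure_minimal[OF _ closed_cbox])
  moreover have "compact (closure {x. bump c a b x \<noteq> 0})"
    using sub by (metis bounded_cbox bounded_subset closed_closure compact_eq_bounded_closed)
  ultimately show ?thesis using assms(2) by (auto simp: test_functions_def)
qed

lemma bump_bounds:
  assumes "0 < c"
  shows "\<bar>bump c a b x\<bar> \<le> 1"
proof -
  have f: "0 \<le> flat c 1 t" "flat c 1 t \<le> 1" for t using assms by (auto simp: flat_def)
  have "0 \<le> bump c a b x" unfolding bump_def by (intro prod_nonneg mult_nonneg_nonneg f ballI)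
  moreover have "bump c a b x \<le> 1"
    unfolding bump_def using f by (intro prod_le_1) (auto intro: mult_le_one)
  ultimately show ?thesis by simp
qed

lemma bump_tendsto_indicator:
  "(\<lambda>n. bump (inverse (real (Suc n))) a b x) \<longlonglongrightarrow> indicator (box a b) x"
proof -
  have f: "(\<lambda>n. flat (inverse (real (Suc n))) 1 t) \<longlonglongrightarrow> (if 0 < t then 1 else 0)" for t
  proof -
    have "(\<lambda>n. exp (- inverse (real (Suc n)) / t)) \<longlonglongrightarrow> exp (- 0 / t)" if "0 < t"
      using that by (intro tendsto_exp tendsto_divide tendsto_minus LIMSEQ_inverse_real_of_nat tendsto_const) auto
    then show ?thesis by (simp add: flat_def)
  qed
  have "(\<lambda>n. bump (inverse (real (Suc n))) a b x) \<longlonglongrightarrow>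
      (\<Prod>i\<in>UNIV. (if 0 < 1 * x $ i + - a $ i then 1 else 0) * (if 0 < - 1 * x $ i + b $ i then 1 else 0))"
    unfolding bump_def by (intro tendsto_prod tendsto_mult f)
  also have "(\<Prod>i\<in>UNIV. (if 0 < 1 * x $ i + - a $ i then 1 else 0) * (if 0 < - 1 * x $ i + b $ i then 1 else 0))
      = (indicator (box a b) x :: real)"
    by (auto simp: indicator_def mem_box_cart prod_zero_iff intro!: prod.neutral)
  finally show ?thesis .
qed

section \<open>Weak gradients: closedness, uniqueness and the case of smooth functions\<close>

context bounded_domain
begin

lemma continuous_measurable:
  fixes f :: "real^3 \<Rightarrow> 'b::euclidean_space"
  assumes "continuous_on UNIV f"
  shows "f \<in> borel_measurable M"
  by (intro measurable_restrict_space1 measurable_completion)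
    (use assms in \<open>simp add: borel_measurable_continuous_onI\<close>)

lemma continuous_bounded:
  fixes f :: "real^3 \<Rightarrow> 'b::euclidean_space"
  assumes "continuous_on UNIV f"
  obtains K where "0 \<le> K" "\<And>x. x \<in> \<Omega> \<Longrightarrow> norm (f x) \<le> K"
proof -
  have "compact (f ` closure \<Omega>)"
    using bounded_domain by (intro compact_continuous_image continuous_on_subset[OF assms]) auto
  then obtain K where K: "\<forall>y\<in>f ` closure \<Omega>. norm y \<le> K"
    using compact_imp_bounded bounded_iff by blast
  show thesis
    by (rule that[of "max K 0"]) (use K closure_subset in force)+
qed

lemma continuous_L2:
  fixes f :: "real^3 \<Rightarrow> 'b::euclidean_space"
  assumes "continuous_on UNIV f"
  shows "f \<in> L2 \<Omega> UNIV"
proof -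
  obtain K where "\<And>x. x \<in> \<Omega> \<Longrightarrow> norm (f x) \<le> K" using continuous_bounded[OF assms] by metis
  then show ?thesis
    by (intro L2_bound[OF continuous_measurable[OF assms] L2_const[of "1::real" UNIV], of K]) auto
qed

lemma weighted_integrable:
  fixes f :: "real^3 \<Rightarrow> 'b::euclidean_space" and w :: "real^3 \<Rightarrow> real"
  assumes "continuous_on UNIV w" "f \<in> L2 \<Omega> V"
  shows "integrable M (\<lambda>x. w x *\<^sub>R f x)"
proof -
  have [measurable]: "f \<in> borel_measurable M" "w \<in> borel_measurable M"
    using L2_measurable[OF assms(2)] continuous_measurable[OF assms(1)] by auto
  have "integrable M (\<lambda>x. norm (w x *\<^sub>R f x))"
    using L2_product(1)[OF continuous_L2[OF assms(1)] assms(2)] by simp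
  then show ?thesis by (subst (asm) integrable_norm_iff) simp_all
qed

lemma weighted_tendsto:
  fixes f :: "real^3 \<Rightarrow> 'b::euclidean_space" and w :: "real^3 \<Rightarrow> real"
  assumes w: "continuous_on UNIV w" and X: "\<And>n. X n \<in> L2 \<Omega> V" and f: "f \<in> L2 \<Omega> W"
    and lim: "(\<lambda>n. L2_norm \<Omega> (\<lambda>x. X n x - f x)) \<longlonglongrightarrow> 0"
  shows "(\<lambda>n. LINT x|M. w x *\<^sub>R X n x) \<longlonglongrightarrow> (LINT x|M. w x *\<^sub>R f x)"
proof -
  have "(\<lambda>n. (LINT x|M. w x *\<^sub>R X n x) - (LINT x|M. w x *\<^sub>R f x)) \<longlonglongrightarrow> 0"
  proof (rule Lim_null_comparison)
    show "(\<lambda>n. L2_norm \<Omega> w * L2_norm \<Omega> (\<lambda>x. X n x - f x)) \<longlonglongrightarrow> 0"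
      using tendsto_mult[OF tendsto_const lim] by simp
    have "norm ((LINT x|M. w x *\<^sub>R X n x) - (LINT x|M. w x *\<^sub>R f x))
        \<le> L2_norm \<Omega> w * L2_norm \<Omega> (\<lambda>x. X n x - f x)" for n
    proof -
      have d: "(\<lambda>x. X n x - f x) \<in> L2 \<Omega> UNIV" by (rule L2_diff[OF X f]) simp
      have "(LINT x|M. w x *\<^sub>R X n x) - (LINT x|M. w x *\<^sub>R f x) = (LINT x|M. w x *\<^sub>R (X n x - f x))"
        using weighted_integrable[OF w X] weighted_integrable[OF w f] by (simp add: scaleR_diff_right)
      also have "norm \<dots> \<le> (LINT x|M. norm (w x *\<^sub>R (X n x - f x)))"
        by (rule integral_norm_bound)
      also have "\<dots> \<le> L2_norm \<Omega> w * L2_norm \<Omega> (\<lambda>x. X n x - f x)"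
        using L2_product(2)[OF continuous_L2[OF w] d] by simp
      finally show ?thesis .
    qed
    then show "\<forall>\<^sub>F n in sequentially. norm ((LINT x|M. w x *\<^sub>R X n x) - (LINT x|M. w x *\<^sub>R f x))
        \<le> L2_norm \<Omega> w * L2_norm \<Omega> (\<lambda>x. X n x - f x)" by simp
  qed
  then show ?thesis by (simp add: LIM_zero_iff)
qed

lemma test_function_smooth: "\<psi> \<in> test_functions \<Omega> \<Longrightarrow> smooth \<psi>"
  by (simp add: test_functions_def)

lemma test_function_continuous:
  assumes "\<psi> \<in> test_functions \<Omega>"
  shows "continuous_on UNIV \<psi>" "continuous_on UNIV (partial \<psi> j)"
  using smooth_continuous smooth_partial(1) test_function_smooth[OF assms] by blast+

lemma has_weak_gradient_iff:
  "has_weak_gradient \<Omega> f g \<longleftrightarrow> (\<forall>\<psi>\<in>test_functions \<Omega>. \<forall>j.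
    (LINT x|M. partial \<psi> j x *\<^sub>R f x) = - (LINT x|M. \<psi> x *\<^sub>R (g x $ j)))"
  by (simp add: has_weak_gradient_def partial_def)

lemma L2_nth:
  fixes g :: "real^3 \<Rightarrow> 'b::euclidean_space^3"
  shows "g \<in> L2 \<Omega> V \<Longrightarrow> (\<lambda>x. g x $ j) \<in> L2 \<Omega> UNIV"
  by (rule L2_linear[OF _ bounded_linear_vec_nth])

lemma has_weak_gradient_linear:
  fixes f f' :: "real^3 \<Rightarrow> 'b::euclidean_space"
  assumes "f \<in> L2 \<Omega> V" "g \<in> L2 \<Omega> UNIV" "f' \<in> L2 \<Omega> V'" "g' \<in> L2 \<Omega> UNIV"
    "has_weak_gradient \<Omega> f g" "has_weak_gradient \<Omega> f' g'"
  shows "has_weak_gradient \<Omega> (\<lambda>x. a *\<^sub>R f x + b *\<^sub>R f' x) (\<lambda>x. a *\<^sub>R g x + b *\<^sub>R g' x)"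
  unfolding has_weak_gradient_iff
proof (intro ballI allI)
  fix \<psi> j assume \<psi>: "\<psi> \<in> test_functions \<Omega>"
  note c = test_function_continuous[OF \<psi>]
  have i: "integrable M (\<lambda>x. partial \<psi> j x *\<^sub>R f x)" "integrable M (\<lambda>x. partial \<psi> j x *\<^sub>R f' x)"
    "integrable M (\<lambda>x. \<psi> x *\<^sub>R (g x $ j))" "integrable M (\<lambda>x. \<psi> x *\<^sub>R (g' x $ j))"
    using weighted_integrable[OF c(2) assms(1)] weighted_integrable[OF c(2) assms(3)]
      weighted_integrable[OF c(1) L2_nth[OF assms(2)]] weighted_integrable[OF c(1) L2_nth[OF assms(4)]] by auto
  have "(LINT x|M. partial \<psi> j x *\<^sub>R (a *\<^sub>R f x + b *\<^sub>R f' x))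
      = (LINT x|M. a *\<^sub>R (partial \<psi> j x *\<^sub>R f x) + b *\<^sub>R (partial \<psi> j x *\<^sub>R f' x))"
    by (simp add: scaleR_add_right mult.commute)
  also have "\<dots> = a *\<^sub>R (LINT x|M. partial \<psi> j x *\<^sub>R f x) + b *\<^sub>R (LINT x|M. partial \<psi> j x *\<^sub>R f' x)"
    using i by (simp del: scaleR_scaleR)
  also have "\<dots> = - (a *\<^sub>R (LINT x|M. \<psi> x *\<^sub>R (g x $ j)) + b *\<^sub>R (LINT x|M. \<psi> x *\<^sub>R (g' x $ j)))"
    using assms(5,6) \<psi> by (simp add: has_weak_gradient_iff)
  also have "\<dots> = - (LINT x|M. a *\<^sub>R (\<psi> x *\<^sub>R (g x $ j)) + b *\<^sub>R (\<psi> x *\<^sub>R (g' x $ j)))"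
    using i by (simp del: scaleR_scaleR)
  also have "\<dots> = - (LINT x|M. \<psi> x *\<^sub>R ((a *\<^sub>R g x + b *\<^sub>R g' x) $ j))"
    by (simp add: scaleR_add_right mult.commute)
  finally show "(LINT x|M. partial \<psi> j x *\<^sub>R (a *\<^sub>R f x + b *\<^sub>R f' x))
    = - (LINT x|M. \<psi> x *\<^sub>R ((a *\<^sub>R g x + b *\<^sub>R g' x) $ j))" .
qed

text \<open>Both sides of the defining identity integrate against a fixed continuous weight and are
  therefore continuous in L2. This closedness is what makes \<open>H1\<close> complete.\<close>

lemma has_weak_gradient_limit:
  fixes f :: "real^3 \<Rightarrow> 'b::euclidean_space"
  assumes "\<And>n. F n \<in> L2 \<Omega> V" "\<And>n. G n \<in> L2 \<Omega> UNIV" "f \<in> L2 \<Omega> V'" "g \<in> L2 \<Omega> UNIV"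
    "(\<lambda>n. L2_norm \<Omega> (\<lambda>x. F n x - f x)) \<longlonglongrightarrow> 0" "(\<lambda>n. L2_norm \<Omega> (\<lambda>x. G n x - g x)) \<longlonglongrightarrow> 0"
    "\<And>n. has_weak_gradient \<Omega> (F n) (G n)"
  shows "has_weak_gradient \<Omega> f g"
  unfolding has_weak_gradient_iff
proof (intro ballI allI)
  fix \<psi> j assume \<psi>: "\<psi> \<in> test_functions \<Omega>"
  have G: "(\<lambda>x. G n x $ j) \<in> L2 \<Omega> UNIV" for n by (rule L2_nth[OF assms(2)])
  have g: "(\<lambda>x. g x $ j) \<in> L2 \<Omega> UNIV" by (rule L2_nth[OF assms(4)])
  have "(\<lambda>n. L2_norm \<Omega> (\<lambda>x. G n x $ j - g x $ j)) \<longlonglongrightarrow> 0"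
  proof (rule tendsto_sandwich[OF _ _ tendsto_const assms(6)])
    have "L2_norm \<Omega> (\<lambda>x. G n x $ j - g x $ j) \<le> L2_norm \<Omega> (\<lambda>x. G n x - g x)" for n
      by (rule L2_norm_mono[OF L2_diff[OF G g, of UNIV] L2_diff[OF assms(2,4), of UNIV]])
        (auto simp flip: vector_minus_component intro: Finite_Cartesian_Product.norm_nth_le)
    then show "\<forall>\<^sub>F n in sequentially. L2_norm \<Omega> (\<lambda>x. G n x $ j - g x $ j) \<le> L2_norm \<Omega> (\<lambda>x. G n x - g x)"
      by simp
  qed simp
  note 1 = weighted_tendsto[OF test_function_continuous(1)[OF \<psi>] G g this]
  note 2 = weighted_tendsto[OF test_function_continuous(2)[OF \<psi>] assms(1,3,5), of j]
  have "(\<lambda>n. LINT x|M. partial \<psi> j x *\<^sub>R F n x) \<longlonglongrightarrow> - (LINT x|M. \<psi> x *\<^sub>R (g x $ j))"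
    using tendsto_minus[OF 1] assms(7) \<psi> by (simp add: has_weak_gradient_iff)
  then show "(LINT x|M. partial \<psi> j x *\<^sub>R f x) = - (LINT x|M. \<psi> x *\<^sub>R (g x $ j))"
    using 2 LIMSEQ_unique by blast
qed

text \<open>Bump functions on the box converge to its indicator, with \<open>norm (G x)\<close> as a
  majorant; open and closed box have the same integral.\<close>

lemma integral_over_box_eq_0:
  fixes G :: "real^3 \<Rightarrow> 'b::euclidean_space"
  assumes G: "integrable M G" and zero: "\<And>\<psi>. \<psi> \<in> test_functions \<Omega> \<Longrightarrow> (LINT x|M. \<psi> x *\<^sub>R G x) = 0"
    and sub: "cbox a b \<subseteq> \<Omega>"
  shows "integral (cbox a b) G = 0"
proof -
  have [measurable]: "G \<in> borel_measurable M" using G by simp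
  let ?b = "\<lambda>n. bump (inverse (real (Suc n))) a b"
  have b: "?b n \<in> test_functions \<Omega>" for n by (rule bump_test_function[OF _ sub]) simp
  have [measurable]: "?b n \<in> borel_measurable M" for n
    by (rule continuous_measurable[OF test_function_continuous(1)[OF b]])
  have [measurable]: "box a b \<in> sets M"
    using sub box_subset_cbox by (subst sets_restrict_space_iff) (auto intro!: borel_open simp: subset_trans)
  have meas: "(\<lambda>x. indicator (box a b) x *\<^sub>R G x) \<in> borel_measurable M"
    "\<And>n. (\<lambda>x. ?b n x *\<^sub>R G x) \<in> borel_measurable M" by measurable
  have "(\<lambda>n. LINT x|M. ?b n x *\<^sub>R G x) \<longlonglongrightarrow> (LINT x|M. indicator (box a b) x *\<^sub>R G x)"
  proof (rule integral_dominated_convergence[OF meas integrable_norm[OF G]])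
    show "AE x in M. (\<lambda>n. ?b n x *\<^sub>R G x) \<longlonglongrightarrow> indicator (box a b) x *\<^sub>R G x"
      by (intro AE_I2 tendsto_scaleR bump_tendsto_indicator tendsto_const)
    show "AE x in M. norm (?b n x *\<^sub>R G x) \<le> norm (G x)" for n
      using bump_bounds[of "inverse (real (Suc n))" a b]
      by (intro AE_I2) (auto intro: mult_left_le_one_le)
  qed
  then have "(LINT x|M. indicator (box a b) x *\<^sub>R G x) = 0"
    using zero[OF b] LIMSEQ_unique[OF _ tendsto_const] by simp
  moreover have "integrable M (\<lambda>x. indicator (box a b) x *\<^sub>R G x)"
    by (rule Bochner_Integration.integrable_bound[OF G]) (auto simp: indicator_def)
  then have "(LINT x|M. indicator (box a b) x *\<^sub>R G x) = integral \<Omega> (\<lambda>x. indicator (box a b) x *\<^sub>R G x)"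
    by (rule lebesgue_integral_eq_integral) simp
  moreover have "(\<lambda>x. indicator (box a b) x *\<^sub>R G x) = (\<lambda>x. if x \<in> box a b then G x else 0)" by auto
  moreover have "box a b \<inter> \<Omega> = box a b" using sub box_subset_cbox by blast
  ultimately show ?thesis
    using Henstock_Kurzweil_Integration.integral_restrict_Int[of \<Omega> "box a b" G] integral_open_interval[of a b G]
    by simp
qed

text \<open>By Lebesgue differentiation, at almost every point the averages over shrinking cubes
  with corner \<open>x\<close> tend to the value there; inside the open domain these averages all
  vanish.\<close>

lemma fundamental_lemma:
  fixes G :: "real^3 \<Rightarrow> 'b::euclidean_space"
  assumes G: "integrable M G" and zero: "\<And>\<psi>. \<psi> \<in> test_functions \<Omega> \<Longrightarrow> (LINT x|M. \<psi> x *\<^sub>R G x) = 0"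
  shows "AE x in M. G x = 0"
proof -
  \<comment> \<open>Extension by 0 gives a function integrable on every cube, including those that
    leave the domain, as the differentiation theorem asks.\<close>
  define f where "f x = (if x \<in> \<Omega> then G x else 0)" for x
  have f_eq: "f = (\<lambda>x. indicator \<Omega> x *\<^sub>R G x)" by (auto simp: f_def)
  have "integrable lebesgue f"
    using G unfolding f_eq by (subst (asm) integrable_restrict_space) auto
  then have "f absolutely_integrable_on UNIV" by (simp add: set_integrable_def)
  then have "f absolutely_integrable_on cbox a b" for a b
    by (rule absolutely_integrable_on_subcbox) auto
  then have "f integrable_on cbox a b" for a b
    using set_lebesgue_integral_eq_integral(1) by blast
  from integrable_ccontinuous_explicit[OF this] obtain N where N: "negligible N"
    "\<And>x e. \<lbrakk>x \<notin> N; 0 < e\<rbrakk> \<Longrightarrow> \<exists>d>0. \<forall>h. 0 < h \<and> h < d \<longrightarrow>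
      norm (integral (cbox x (x + h *\<^sub>R One)) f /\<^sub>R h ^ DIM(real^3) - f x) < e" by blast
  have G0: "G x = 0" if x: "x \<in> \<Omega>" "x \<notin> N" for x
  proof -
    obtain r where r: "0 < r" "ball x r \<subseteq> \<Omega>" using open_domain x(1) openE by blast
    \<comment> \<open>The cube of side \<open>h\<close> at corner \<open>x\<close> reaches no
      farther than \<open>h\<close> times the norm of \<open>One\<close>, so this bound on
      \<open>h\<close> keeps it inside the ball; the added 1 leaves room for strictness.\<close>
    have small: "integral (cbox x (x + h *\<^sub>R One)) f = 0" if h: "0 < h" "h < r / (norm (One::real^3) + 1)" for h
    proof -
      have "cbox x (x + h *\<^sub>R One) \<subseteq> ball x r"
      proof
        fix y assume y: "y \<in> cbox x (x + h *\<^sub>R One)"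
        have "norm (y - x) \<le> norm (h *\<^sub>R (One::real^3))"
        proof (rule norm_le_componentwise)
          fix i :: "real^3" assume "i \<in> Basis"
          then show "\<bar>(y - x) \<bullet> i\<bar> \<le> \<bar>(h *\<^sub>R One) \<bullet> i\<bar>"
            using y h(1) by (auto simp: mem_box inner_diff_left inner_add_left)
        qed
        also have "\<dots> \<le> h * (norm (One::real^3) + 1)" using h(1) by simp
        also have "\<dots> < r" using h(2) by (simp add: pos_less_divide_eq add_nonneg_pos)
        finally show "y \<in> ball x r" by (simp add: dist_norm norm_minus_commute)
      qed
      then have sub: "cbox x (x + h *\<^sub>R One) \<subseteq> \<Omega>" using r(2) by blast
      then have "integral (cbox x (x + h *\<^sub>R One)) f = integral (cbox x (x + h *\<^sub>R One)) G"
        by (intro Henstock_Kurzweil_Integration.integral_cong) (auto simp: f_def)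
      then show ?thesis using integral_over_box_eq_0[OF G zero sub] by simp
    qed
    have "norm (f x) < e" if e: "0 < e" for e
    proof -
      obtain d where d: "0 < d" "\<forall>h. 0 < h \<and> h < d \<longrightarrow>
          norm (integral (cbox x (x + h *\<^sub>R One)) f /\<^sub>R h ^ DIM(real^3) - f x) < e"
        using N(2)[OF x(2) e] by blast
      have "0 < min d (r / (norm (One::real^3) + 1))" using d r by (simp add: add_nonneg_pos)
      then obtain h where "0 < h" "h < min d (r / (norm (One::real^3) + 1))" using dense by blast
      then show ?thesis using d(2) small[of h] by force
    qed
    then have "f x = 0" by (metis less_irrefl zero_less_norm_iff)
    then show ?thesis using x by (simp add: f_def)
  qed
  have "N \<in> null_sets lebesgue" using N(1) negligible_iff_null_sets by blast
  then have "AE x in lebesgue. x \<in> \<Omega> \<longrightarrow> G x = 0"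
    by (rule AE_I') (use G0 in blast)
  then show ?thesis by (subst AE_restrict_space_iff) auto
qed

text \<open>The fundamental lemma is applied to each component of the difference. It ties the chosen
  \<open>weak_gradient\<close> to any gradient found by other means, almost everywhere.\<close>

lemma has_weak_gradient_unique:
  fixes f :: "real^3 \<Rightarrow> 'b::euclidean_space"
  assumes "g \<in> L2 \<Omega> UNIV" "g' \<in> L2 \<Omega> UNIV" "has_weak_gradient \<Omega> f g" "has_weak_gradient \<Omega> f g'"
  shows "AE x in M. g x = g' x"
proof -
  have "AE x in M. g x $ j - g' x $ j = 0" for j
  proof (rule fundamental_lemma)
    have L: "(\<lambda>x. g x $ j) \<in> L2 \<Omega> UNIV" "(\<lambda>x. g' x $ j) \<in> L2 \<Omega> UNIV"
      using L2_nth assms(1,2) by blast+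
    then show "integrable M (\<lambda>x. g x $ j - g' x $ j)"
      by (intro Bochner_Integration.integrable_diff L2_integrable(1)[OF L(1)] L2_integrable(1)[OF L(2)])
    fix \<psi> assume \<psi>: "\<psi> \<in> test_functions \<Omega>"
    have "(LINT x|M. \<psi> x *\<^sub>R (g x $ j)) = (LINT x|M. \<psi> x *\<^sub>R (g' x $ j))"
      using assms(3)[unfolded has_weak_gradient_iff, rule_format, OF \<psi>, of j]
        assms(4)[unfolded has_weak_gradient_iff, rule_format, OF \<psi>, of j]
      by (simp only: neg_equal_iff_equal)
    then show "(LINT x|M. \<psi> x *\<^sub>R (g x $ j - g' x $ j)) = 0"
      using weighted_integrable[OF test_function_continuous(1)[OF \<psi>] L(1)]
        weighted_integrable[OF test_function_continuous(1)[OF \<psi>] L(2)]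
      by (simp add: scaleR_diff_right)
  qed
  then have "AE x in M. \<forall>j\<in>UNIV. g x $ j - g' x $ j = 0" by (subst AE_finite_all) auto
  then show ?thesis by eventually_elim (simp add: vec_eq_iff)
qed

lemma H1_L2: "f \<in> H1 \<Omega> V \<Longrightarrow> f \<in> L2 \<Omega> V"
  by (simp add: H1_def)

lemma weak_gradient:
  assumes "f \<in> H1 \<Omega> V"
  shows "weak_gradient \<Omega> f \<in> L2 \<Omega> UNIV" "has_weak_gradient \<Omega> f (weak_gradient \<Omega> f)"
proof -
  have "\<exists>g. g \<in> L2 \<Omega> UNIV \<and> has_weak_gradient \<Omega> f g" using assms by (auto simp: H1_def)
  then show "weak_gradient \<Omega> f \<in> L2 \<Omega> UNIV" "has_weak_gradient \<Omega> f (weak_gradient \<Omega> f)"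
    using someI_ex unfolding weak_gradient_def by (metis (mono_tags, lifting))+
qed

lemma H1I:
  assumes "f \<in> L2 \<Omega> V" "g \<in> L2 \<Omega> UNIV" "has_weak_gradient \<Omega> f g"
  shows "f \<in> H1 \<Omega> V" "AE x in M. weak_gradient \<Omega> f x = g x"
proof -
  show f: "f \<in> H1 \<Omega> V" using assms by (auto simp: H1_def)
  show "AE x in M. weak_gradient \<Omega> f x = g x"
    by (rule has_weak_gradient_unique[OF weak_gradient(1)[OF f] assms(2) weak_gradient(2)[OF f] assms(3)])
qed

lemma H1_linear:
  assumes "f \<in> H1 \<Omega> V" "g \<in> H1 \<Omega> W" "\<And>u v. u \<in> V \<Longrightarrow> v \<in> W \<Longrightarrow> a *\<^sub>R u + b *\<^sub>R v \<in> X"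
  shows "(\<lambda>x. a *\<^sub>R f x + b *\<^sub>R g x) \<in> H1 \<Omega> X"
    "AE x in M. weak_gradient \<Omega> (\<lambda>x. a *\<^sub>R f x + b *\<^sub>R g x) x
      = a *\<^sub>R weak_gradient \<Omega> f x + b *\<^sub>R weak_gradient \<Omega> g x"
proof -
  have 1: "(\<lambda>x. a *\<^sub>R f x + b *\<^sub>R g x) \<in> L2 \<Omega> X"
  proof -
    have "(\<lambda>x. a *\<^sub>R f x + b *\<^sub>R g x) \<in> L2 \<Omega> UNIV"
      by (rule L2_add[OF L2_scaleR[OF H1_L2[OF assms(1)], of _ UNIV] L2_scaleR[OF H1_L2[OF assms(2)], of _ UNIV]]) auto
    then show ?thesis
      using assms(3) L2_in[OF H1_L2[OF assms(1)]] L2_in[OF H1_L2[OF assms(2)]] by (simp add: L2_def)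
  qed
  have 2: "(\<lambda>x. a *\<^sub>R weak_gradient \<Omega> f x + b *\<^sub>R weak_gradient \<Omega> g x) \<in> L2 \<Omega> UNIV"
    by (rule L2_add[OF L2_scaleR[OF weak_gradient(1)[OF assms(1)], of _ UNIV]
          L2_scaleR[OF weak_gradient(1)[OF assms(2)], of _ UNIV]]) auto
  note 3 = has_weak_gradient_linear[OF H1_L2[OF assms(1)] weak_gradient(1)[OF assms(1)]
    H1_L2[OF assms(2)] weak_gradient(1)[OF assms(2)] weak_gradient(2)[OF assms(1)] weak_gradient(2)[OF assms(2)]]
  show "(\<lambda>x. a *\<^sub>R f x + b *\<^sub>R g x) \<in> H1 \<Omega> X"
    "AE x in M. weak_gradient \<Omega> (\<lambda>x. a *\<^sub>R f x + b *\<^sub>R g x) x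
      = a *\<^sub>R weak_gradient \<Omega> f x + b *\<^sub>R weak_gradient \<Omega> g x"
    using H1I[OF 1 2 3] .
qed

text \<open>The classical gradient is a weak one: \<open>\<psi>\<close> times a component of
  \<open>w\<close> has compact support, and its partial derivatives integrate to 0. The smooth
  functions in the definition of a trace thereby belong to \<open>H1\<close>.\<close>

lemma smooth_H1:
  fixes w :: "real^3 \<Rightarrow> real^3"
  assumes w: "\<And>i. smooth (\<lambda>x. w x $ i)"
  shows "w \<in> H1 \<Omega> UNIV"
proof (rule H1I(1))
  define g :: "real^3 \<Rightarrow> real^3^3" where "g x = (\<chi> j. \<chi> i. partial (\<lambda>x. w x $ i) j x)" for x
  have cw: "continuous_on UNIV w"
    using continuous_on_vec_lambda[of UNIV "\<lambda>i x. w x $ i"] smooth_continuous[OF w] by simp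
  have cg: "continuous_on UNIV g"
    unfolding g_def by (intro continuous_on_vec_lambda smooth_partial(1)[OF w])
  show "w \<in> L2 \<Omega> UNIV" "g \<in> L2 \<Omega> UNIV" using continuous_L2 cw cg by auto
  show "has_weak_gradient \<Omega> w g"
    unfolding has_weak_gradient_iff
  proof (intro ballI allI)
    fix \<psi> j assume \<psi>: "\<psi> \<in> test_functions \<Omega>"
    note c = test_function_continuous[OF \<psi>]
    have int: "integrable M (\<lambda>x. partial \<psi> j x *\<^sub>R w x)" "integrable M (\<lambda>x. \<psi> x *\<^sub>R (g x $ j))"
      using weighted_integrable[OF c(2) continuous_L2[OF cw]]
        weighted_integrable[OF c(1) L2_nth[OF continuous_L2[OF cg]]] by auto
    let ?S = "closure {x. \<psi> x \<noteq> 0}"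
    have S: "compact ?S" "?S \<subseteq> \<Omega>" "\<And>x. x \<notin> ?S \<Longrightarrow> \<psi> x = 0"
      using \<psi> closure_subset[of "{x. \<psi> x \<noteq> 0}"] by (auto simp only: test_functions_def)
    have "(LINT x|M. partial \<psi> j x *\<^sub>R w x + \<psi> x *\<^sub>R (g x $ j)) $ i = 0" for i
    proof -
      let ?f = "\<lambda>x. \<psi> x * w x $ i"
      have vanish: "\<psi> x * w x $ i = 0" if "x \<notin> ?S" for x
        unfolding S(3)[OF that] by (rule mult_zero_left)
      have f: "smooth ?f" by (rule smooth_mult[OF test_function_smooth[OF \<psi>] w])
      have "(LINT x|M. partial \<psi> j x *\<^sub>R w x + \<psi> x *\<^sub>R (g x $ j)) $ i
          = (LINT x|M. (partial \<psi> j x *\<^sub>R w x + \<psi> x *\<^sub>R (g x $ j)) $ i)"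
        by (rule integral_bounded_linear[OF bounded_linear_vec_nth, symmetric])
          (intro Bochner_Integration.integrable_add int)
      also have "\<dots> = (LINT x|M. partial ?f j x)"
        unfolding partial_mult[OF test_function_smooth[OF \<psi>] w] by (simp add: g_def add.commute)
      also have "\<dots> = (LINT x|lebesgue. indicator \<Omega> x *\<^sub>R partial ?f j x)"
        by (rule integral_restrict_space) simp
      \<comment> \<open>The derivative vanishes off the support of \<open>\<psi>\<close>, so the
        integral over the domain is one over the whole space, where translation invariance is
        available.\<close>
      also have "(\<lambda>x. indicator \<Omega> x *\<^sub>R partial ?f j x) = partial ?f j"
      proof -
        have zero: "partial ?f j x = 0" if "x \<notin> \<Omega>" for x
        proof (rule partial_eq_0[OF f])
          show "open (- ?S)" by (rule open_Compl[OF closed_closure])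
          show "x \<in> - ?S" using that S(2) by (meson ComplI subsetD)
          show "\<psi> y * w y $ i = 0" if "y \<in> - ?S" for y
            by (rule vanish[OF that[unfolded Compl_iff]])
        qed
        then have "indicator \<Omega> x *\<^sub>R partial ?f j x = partial ?f j x" for x
          using zero[of x] by (cases "x \<in> \<Omega>") simp_all
        then show ?thesis by (rule ext)
      qed
      also have "integral\<^sup>L lebesgue (partial ?f j) = integral\<^sup>L lborel (partial ?f j)"
        using borel_measurable_continuous_onI[OF smooth_partial(1)[OF f, of j]]
        by (intro integral_completion) simp
      also have "\<dots> = 0"
        by (rule integral_partial_eq_0(2)[OF f S(1) vanish])
      finally show ?thesis .
    qed
    then have "(LINT x|M. partial \<psi> j x *\<^sub>R w x + \<psi> x *\<^sub>R (g x $ j)) = 0"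
      by (simp add: vec_eq_iff)
    then show "(LINT x|M. partial \<psi> j x *\<^sub>R w x) = - (LINT x|M. \<psi> x *\<^sub>R (g x $ j))"
      unfolding Bochner_Integration.integral_add[OF int] by (rule eq_neg_iff_add_eq_0[THEN iffD2])
  qed
qed

end

section \<open>Sobolev spaces and the state space\<close>

lemma subspace_sym_mat: "subspace sym_mat"
  unfolding subspace_def sym_mat_def by (auto simp: transpose_def vec_eq_iff)

lemma subspace_dev_mat: "subspace dev_mat"
  using subspace_sym_mat unfolding subspace_def dev_mat_def
  by (auto simp: trace_def sum.distrib simp flip: sum_distrib_left)

lemma dev_mat_sub_sym_mat: "dev_mat \<subseteq> sym_mat"
  by (auto simp: dev_mat_def)

lemma fun_linear: "a *\<^sub>R f + b *\<^sub>R g = (\<lambda>x. a *\<^sub>R f x + b *\<^sub>R g x)"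
  by (auto simp: scaleR_fun_def)

lemma fun_diff: "f - g = (\<lambda>x. f x - g x)"
  by auto

lemma diff_linear: "(f::'a::real_vector) - g = 1 *\<^sub>R f + (-1) *\<^sub>R g"
  by simp

context bounded_domain
begin

text \<open>A function is bundled with its gradient so that the \<open>H1\<close> norm becomes the
  L2 norm of one function and all L2 facts apply.\<close>

definition jet :: "(real^3 \<Rightarrow> 'b::euclidean_space) \<Rightarrow> real^3 \<Rightarrow> 'b \<times> ('b^3)"
  where "jet f x = (f x, weak_gradient \<Omega> f x)"

lemma jet_L2: "f \<in> H1 \<Omega> V \<Longrightarrow> jet f \<in> L2 \<Omega> UNIV"
  unfolding jet_def by (rule L2_Pair[OF H1_L2 weak_gradient(1)])

lemma L2_norm_Pair:
  assumes "f \<in> L2 \<Omega> V" "g \<in> L2 \<Omega> W"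
  shows "L2_norm \<Omega> (\<lambda>x. (f x, g x)) = sqrt ((L2_norm \<Omega> f)\<^sup>2 + (L2_norm \<Omega> g)\<^sup>2)"
  using L2_square_integrable[OF assms(1)] L2_square_integrable[OF assms(2)]
  by (simp add: L2_norm_power2) (simp add: L2_norm_def norm_Pair)

lemma H1_norm_eq:
  assumes "f \<in> H1 \<Omega> V"
  shows "H1_norm \<Omega> f = L2_norm \<Omega> (jet f)"
  unfolding jet_def H1_norm_def
  using L2_norm_Pair[OF H1_L2[OF assms] weak_gradient(1)[OF assms]] by simp

lemma H1_norm_nonneg [simp]: "0 \<le> H1_norm \<Omega> f"
  by (simp add: H1_norm_def)

lemma H1_fun_linear:
  assumes "f \<in> H1 \<Omega> V" "g \<in> H1 \<Omega> V" "subspace V"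
  shows "a *\<^sub>R f + b *\<^sub>R g \<in> H1 \<Omega> V"
    "AE x in M. weak_gradient \<Omega> (a *\<^sub>R f + b *\<^sub>R g) x = a *\<^sub>R weak_gradient \<Omega> f x + b *\<^sub>R weak_gradient \<Omega> g x"
    "AE x in M. jet (a *\<^sub>R f + b *\<^sub>R g) x = a *\<^sub>R jet f x + b *\<^sub>R jet g x"
proof -
  show 1: "a *\<^sub>R f + b *\<^sub>R g \<in> H1 \<Omega> V"
    "AE x in M. weak_gradient \<Omega> (a *\<^sub>R f + b *\<^sub>R g) x = a *\<^sub>R weak_gradient \<Omega> f x + b *\<^sub>R weak_gradient \<Omega> g x"
    unfolding fun_linear using assms(3)
    by (auto intro!: H1_linear[OF assms(1,2)] simp: subspace_def)
  from 1(2) show "AE x in M. jet (a *\<^sub>R f + b *\<^sub>R g) x = a *\<^sub>R jet f x + b *\<^sub>R jet g x"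
    by eventually_elim (simp add: jet_def scaleR_fun_def)
qed

lemma H1_zero: "subspace V \<Longrightarrow> 0 \<in> H1 \<Omega> V"
proof -
  assume "subspace V"
  then have "(\<lambda>_. 0) \<in> L2 \<Omega> V" by (simp add: L2_const subspace_0)
  moreover have "(\<lambda>_. 0) \<in> L2 \<Omega> UNIV" by (simp add: L2_const)
  moreover have "has_weak_gradient \<Omega> (\<lambda>_. 0) (\<lambda>_. 0)" by (simp add: has_weak_gradient_def)
  ultimately have "(\<lambda>_. 0) \<in> H1 \<Omega> V" by (rule H1I(1))
  then show ?thesis by (simp only: zero_fun_def)
qed

lemma H1_norm_linear:
  assumes "f \<in> H1 \<Omega> V" "g \<in> H1 \<Omega> V" "subspace V"
  shows "H1_norm \<Omega> (a *\<^sub>R f + b *\<^sub>R g) = L2_norm \<Omega> (\<lambda>x. a *\<^sub>R jet f x + b *\<^sub>R jet g x)"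
    "H1_norm \<Omega> (a *\<^sub>R f + b *\<^sub>R g) \<le> \<bar>a\<bar> * H1_norm \<Omega> f + \<bar>b\<bar> * H1_norm \<Omega> g"
proof -
  note L = L2_measurable[OF jet_L2[OF assms(1)]] L2_measurable[OF jet_L2[OF assms(2)]]
    L2_measurable[OF jet_L2[OF H1_fun_linear(1)[OF assms]]]
  show 1: "H1_norm \<Omega> (a *\<^sub>R f + b *\<^sub>R g) = L2_norm \<Omega> (\<lambda>x. a *\<^sub>R jet f x + b *\<^sub>R jet g x)"
    unfolding H1_norm_eq[OF H1_fun_linear(1)[OF assms]]
  proof (rule L2_norm_cong)
    show "AE x in M. norm (jet (a *\<^sub>R f + b *\<^sub>R g) x) = norm (a *\<^sub>R jet f x + b *\<^sub>R jet g x)"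
      using H1_fun_linear(3)[OF assms, of a b] by eventually_elim simp
  qed (use L in simp_all)
  have "L2_norm \<Omega> (\<lambda>x. a *\<^sub>R jet f x + b *\<^sub>R jet g x) \<le> L2_norm \<Omega> (\<lambda>x. a *\<^sub>R jet f x) + L2_norm \<Omega> (\<lambda>x. b *\<^sub>R jet g x)"
    by (rule L2_norm_triangle[OF L2_scaleR[OF jet_L2[OF assms(1)], of _ UNIV] L2_scaleR[OF jet_L2[OF assms(2)], of _ UNIV]]) auto
  then show "H1_norm \<Omega> (a *\<^sub>R f + b *\<^sub>R g) \<le> \<bar>a\<bar> * H1_norm \<Omega> f + \<bar>b\<bar> * H1_norm \<Omega> g"
    unfolding 1 L2_norm_scaleR H1_norm_eq[OF assms(1)] H1_norm_eq[OF assms(2)] .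
qed

lemma H1_diff: "f \<in> H1 \<Omega> V \<Longrightarrow> g \<in> H1 \<Omega> V \<Longrightarrow> subspace V \<Longrightarrow> f - g \<in> H1 \<Omega> V"
  unfolding diff_linear by (rule H1_fun_linear(1))

lemma H1_norm_triangle:
  assumes "f \<in> H1 \<Omega> V" "g \<in> H1 \<Omega> V" "h \<in> H1 \<Omega> V" "subspace V"
  shows "H1_norm \<Omega> (f - h) \<le> H1_norm \<Omega> (f - g) + H1_norm \<Omega> (g - h)"
  using H1_norm_linear(2)[OF H1_diff[OF assms(1,2,4)] H1_diff[OF assms(2,3,4)] assms(4), of 1 1] by simp

text \<open>Functions and gradients are separately Cauchy in L2, and the limit of the gradients is a
  weak gradient of the limit. The chosen gradient agrees with it almost everywhere, which is enough
  for the norm.\<close>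

lemma H1_complete:
  assumes X: "\<And>n. X n \<in> H1 \<Omega> V" and V: "subspace V"
    and cauchy: "\<And>e. 0 < e \<Longrightarrow> \<exists>N. \<forall>m\<ge>N. \<forall>n\<ge>N. H1_norm \<Omega> (X m - X n) < e"
  obtains f where "f \<in> H1 \<Omega> V" "(\<lambda>n. H1_norm \<Omega> (X n - f)) \<longlonglongrightarrow> 0"
proof -
  let ?G = "\<lambda>n. weak_gradient \<Omega> (X n)"
  have eq: "H1_norm \<Omega> (X m - X n) = sqrt ((L2_norm \<Omega> (\<lambda>x. X m x - X n x))\<^sup>2 + (L2_norm \<Omega> (\<lambda>x. ?G m x - ?G n x))\<^sup>2)" for m n
  proof -
    have "L2_norm \<Omega> (weak_gradient \<Omega> (X m - X n)) = L2_norm \<Omega> (\<lambda>x. ?G m x - ?G n x)"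
    proof (rule L2_norm_cong)
      have "AE x in M. weak_gradient \<Omega> (X m - X n) x = ?G m x - ?G n x"
        using H1_fun_linear(2)[OF X X V, of 1 m "-1" n] by simp
      then show "AE x in M. norm (weak_gradient \<Omega> (X m - X n) x) = norm (?G m x - ?G n x)"
        by eventually_elim simp
    qed (use L2_measurable[OF weak_gradient(1)[OF X]] L2_measurable[OF weak_gradient(1)[OF H1_diff[OF X X V]]] in auto)
    then show ?thesis by (simp add: H1_norm_def fun_diff)
  qed
  have le: "L2_norm \<Omega> (\<lambda>x. X m x - X n x) \<le> H1_norm \<Omega> (X m - X n)"
    "L2_norm \<Omega> (\<lambda>x. ?G m x - ?G n x) \<le> H1_norm \<Omega> (X m - X n)" for m n
    unfolding eq by (auto intro: real_le_rsqrt)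
  have "\<exists>N. \<forall>m\<ge>N. \<forall>n\<ge>N. L2_norm \<Omega> (\<lambda>x. X m x - X n x) < e" if e: "0 < e" for e
    using cauchy[OF e] le(1) by (meson le_less_trans)
  from L2_complete[OF H1_L2[OF X] V this] obtain f
    where f: "f \<in> L2 \<Omega> V" "(\<lambda>n. L2_norm \<Omega> (\<lambda>x. X n x - f x)) \<longlonglongrightarrow> 0" by blast
  have "\<exists>N. \<forall>m\<ge>N. \<forall>n\<ge>N. L2_norm \<Omega> (\<lambda>x. ?G m x - ?G n x) < e" if e: "0 < e" for e
    using cauchy[OF e] le(2) by (meson le_less_trans)
  from L2_complete[OF weak_gradient(1)[OF X] subspace_UNIV this] obtain g
    where g: "g \<in> L2 \<Omega> UNIV" "(\<lambda>n. L2_norm \<Omega> (\<lambda>x. ?G n x - g x)) \<longlonglongrightarrow> 0" by blast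
  note hw = has_weak_gradient_limit[OF H1_L2[OF X] weak_gradient(1)[OF X] f(1) g(1) f(2) g(2) weak_gradient(2)[OF X]]
  have fH: "f \<in> H1 \<Omega> V" and ae: "AE x in M. weak_gradient \<Omega> f x = g x"
    using H1I[OF f(1) g(1) hw] by auto
  have "H1_norm \<Omega> (X n - f) = sqrt ((L2_norm \<Omega> (\<lambda>x. X n x - f x))\<^sup>2 + (L2_norm \<Omega> (\<lambda>x. ?G n x - g x))\<^sup>2)" for n
  proof -
    have "L2_norm \<Omega> (weak_gradient \<Omega> (X n - f)) = L2_norm \<Omega> (\<lambda>x. ?G n x - g x)"
    proof (rule L2_norm_cong)
      have "AE x in M. weak_gradient \<Omega> (X n - f) x = ?G n x - weak_gradient \<Omega> f x"
        using H1_fun_linear(2)[OF X fH V, of 1 n "-1"] by simp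
      with ae show "AE x in M. norm (weak_gradient \<Omega> (X n - f) x) = norm (?G n x - g x)"
        by eventually_elim simp
    qed (use L2_measurable[OF weak_gradient(1)[OF X]] L2_measurable[OF g(1)]
        L2_measurable[OF weak_gradient(1)[OF H1_diff[OF X fH V]]] in auto)
    then show ?thesis by (simp add: H1_norm_def fun_diff)
  qed
  then have "(\<lambda>n. H1_norm \<Omega> (X n - f)) \<longlonglongrightarrow> sqrt (0\<^sup>2 + 0\<^sup>2)"
    by (simp only:) (intro tendsto_real_sqrt tendsto_add tendsto_power f g)
  then show thesis using that fH by simp
qed

lemma Z_L2: "z \<in> Z_space \<Omega> \<nu> \<Longrightarrow> z \<in> L2 \<Omega> dev_mat"
  by (auto simp: Z_space_def H1_L2 split: if_splits)

text \<open>Without regularization the gradient slot holds 0, so that one type of jets and one norm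
  formula serve both kinds of spaces.\<close>

definition Z_jet :: "real \<Rightarrow> (real^3 \<Rightarrow> real^3^3) \<Rightarrow> real^3 \<Rightarrow> (real^3^3) \<times> (real^3^3^3)"
  where "Z_jet \<nu> z x = (z x, if \<nu> > 0 then weak_gradient \<Omega> z x else 0)"

lemma Z_jet_L2: "z \<in> Z_space \<Omega> \<nu> \<Longrightarrow> Z_jet \<nu> z \<in> L2 \<Omega> UNIV"
  unfolding Z_jet_def
  by (cases "\<nu> > 0") (auto simp: Z_space_def intro!: L2_Pair L2_const[of _ UNIV] intro: H1_L2 weak_gradient(1))

lemma Z_norm_eq: "z \<in> Z_space \<Omega> \<nu> \<Longrightarrow> Z_norm \<Omega> \<nu> z = L2_norm \<Omega> (Z_jet \<nu> z)"
  by (cases "\<nu> > 0") (auto simp: Z_space_def Z_norm_def Z_jet_def[abs_def] H1_norm_eq jet_def[abs_def] L2_norm_def norm_Pair)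

lemma Z_linear:
  assumes "f \<in> Z_space \<Omega> \<nu>" "g \<in> Z_space \<Omega> \<nu>"
  shows "a *\<^sub>R f + b *\<^sub>R g \<in> Z_space \<Omega> \<nu>"
    "AE x in M. Z_jet \<nu> (a *\<^sub>R f + b *\<^sub>R g) x = a *\<^sub>R Z_jet \<nu> f x + b *\<^sub>R Z_jet \<nu> g x"
proof -
  have sub: "u \<in> dev_mat \<Longrightarrow> v \<in> dev_mat \<Longrightarrow> a *\<^sub>R u + b *\<^sub>R v \<in> dev_mat" for u v
    using subspace_dev_mat by (simp add: subspace_def)
  have 1: "a *\<^sub>R f + b *\<^sub>R g \<in> L2 \<Omega> dev_mat"
  proof -
    have "(\<lambda>x. a *\<^sub>R f x + b *\<^sub>R g x) \<in> L2 \<Omega> UNIV"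
      by (rule L2_add[OF L2_scaleR[OF Z_L2[OF assms(1)], of _ UNIV] L2_scaleR[OF Z_L2[OF assms(2)], of _ UNIV]]) auto
    then show ?thesis
      using sub L2_in[OF Z_L2[OF assms(1)]] L2_in[OF Z_L2[OF assms(2)]] by (simp add: L2_def scaleR_fun_def plus_fun_def)
  qed
  show "a *\<^sub>R f + b *\<^sub>R g \<in> Z_space \<Omega> \<nu>"
    using 1 assms H1_fun_linear(1)[OF _ _ subspace_dev_mat] by (auto simp: Z_space_def split: if_splits)
  show "AE x in M. Z_jet \<nu> (a *\<^sub>R f + b *\<^sub>R g) x = a *\<^sub>R Z_jet \<nu> f x + b *\<^sub>R Z_jet \<nu> g x"
  proof (cases "\<nu> > 0")
    case True
    then have "f \<in> H1 \<Omega> dev_mat" "g \<in> H1 \<Omega> dev_mat" using assms by (auto simp: Z_space_def)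
    from H1_fun_linear(2)[OF this subspace_dev_mat, of a b] show ?thesis
      by eventually_elim (simp add: Z_jet_def scaleR_fun_def)
  qed (simp add: Z_jet_def scaleR_fun_def)
qed

lemma Z_complete:
  assumes X: "\<And>n. X n \<in> Z_space \<Omega> \<nu>"
    and cauchy: "\<And>e. 0 < e \<Longrightarrow> \<exists>N. \<forall>m\<ge>N. \<forall>n\<ge>N. Z_norm \<Omega> \<nu> (X m - X n) < e"
  obtains f where "f \<in> Z_space \<Omega> \<nu>" "(\<lambda>n. Z_norm \<Omega> \<nu> (X n - f)) \<longlonglongrightarrow> 0"
proof (cases "\<nu> > 0")
  case True
  then have eq: "Z_space \<Omega> \<nu> = H1 \<Omega> dev_mat" "Z_norm \<Omega> \<nu> = H1_norm \<Omega>"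
    by (auto simp: Z_space_def Z_norm_def)
  show ?thesis
    by (rule H1_complete[OF X[unfolded eq] subspace_dev_mat cauchy[unfolded eq]])
      (use that eq in auto)
next
  case False
  then have eq: "Z_space \<Omega> \<nu> = L2 \<Omega> dev_mat" "Z_norm \<Omega> \<nu> = L2_norm \<Omega>"
    by (auto simp: Z_space_def Z_norm_def)
  show ?thesis
    by (rule L2_complete[OF X[unfolded eq] subspace_dev_mat cauchy[unfolded eq fun_diff]])
      (use that[unfolded eq fun_diff] in auto)
qed

definition Y_jet :: "real \<Rightarrow> state \<Rightarrow> real^3 \<Rightarrow> ((real^3) \<times> (real^3^3)) \<times> ((real^3^3) \<times> (real^3^3^3))"
  where "Y_jet \<nu> y x = (jet (fst y) x, Z_jet \<nu> (snd y) x)"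

lemma Y_space_iff: "y \<in> Y_space \<Omega> \<nu> \<longleftrightarrow> fst y \<in> H1 \<Omega> UNIV \<and> snd y \<in> Z_space \<Omega> \<nu>"
  by (cases y) (simp add: Y_space_def)

lemma Y_jet_L2: "y \<in> Y_space \<Omega> \<nu> \<Longrightarrow> Y_jet \<nu> y \<in> L2 \<Omega> UNIV"
  unfolding Y_jet_def Y_space_iff by (auto intro: L2_Pair jet_L2 Z_jet_L2)

lemma Y_norm_eq: "y \<in> Y_space \<Omega> \<nu> \<Longrightarrow> Y_norm \<Omega> \<nu> y = L2_norm \<Omega> (Y_jet \<nu> y)"
proof -
  assume "y \<in> Y_space \<Omega> \<nu>"
  then have y: "fst y \<in> H1 \<Omega> UNIV" "snd y \<in> Z_space \<Omega> \<nu>" by (auto simp: Y_space_iff)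
  show ?thesis
    using L2_norm_Pair[OF jet_L2[OF y(1)] Z_jet_L2[OF y(2)]]
    by (simp add: Y_jet_def[abs_def] Y_norm_def H1_norm_eq[OF y(1)] Z_norm_eq[OF y(2)])
qed

lemma Z_norm_nonneg [simp]: "0 \<le> Z_norm \<Omega> \<nu> z"
  by (simp add: Z_norm_def)

lemma Y_norm_nonneg [simp]: "0 \<le> Y_norm \<Omega> \<nu> y"
  by (simp add: Y_norm_def)

lemma Y_linear:
  assumes "y \<in> Y_space \<Omega> \<nu>" "y' \<in> Y_space \<Omega> \<nu>"
  shows "a *\<^sub>R y + b *\<^sub>R y' \<in> Y_space \<Omega> \<nu>"
    "AE x in M. Y_jet \<nu> (a *\<^sub>R y + b *\<^sub>R y') x = a *\<^sub>R Y_jet \<nu> y x + b *\<^sub>R Y_jet \<nu> y' x"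
proof -
  have y: "fst y \<in> H1 \<Omega> UNIV" "snd y \<in> Z_space \<Omega> \<nu>" "fst y' \<in> H1 \<Omega> UNIV" "snd y' \<in> Z_space \<Omega> \<nu>"
    using assms by (auto simp: Y_space_iff)
  show "a *\<^sub>R y + b *\<^sub>R y' \<in> Y_space \<Omega> \<nu>"
    using y by (auto simp: Y_space_iff intro: H1_fun_linear(1) Z_linear(1))
  from H1_fun_linear(3)[OF y(1,3) subspace_UNIV, of a b] Z_linear(2)[OF y(2,4), of a b]
  show "AE x in M. Y_jet \<nu> (a *\<^sub>R y + b *\<^sub>R y') x = a *\<^sub>R Y_jet \<nu> y x + b *\<^sub>R Y_jet \<nu> y' x"
    by eventually_elim (simp add: Y_jet_def)
qed

lemma Y_space_subspace: "subspace (Y_space \<Omega> \<nu>)"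
proof -
  have "(0::state) \<in> Y_space \<Omega> \<nu>"
    using H1_zero[OF subspace_UNIV] H1_zero[OF subspace_dev_mat] H1_L2[OF H1_zero[OF subspace_dev_mat]]
    by (simp add: Y_space_iff Z_space_def)
  then show ?thesis
    using Y_linear(1)[of _ \<nu> _ 1 1] Y_linear(1)[of _ \<nu> _ _ 0] by (auto simp: subspace_def)
qed

lemma Y_norm_linear:
  assumes "y \<in> Y_space \<Omega> \<nu>" "y' \<in> Y_space \<Omega> \<nu>"
  shows "Y_norm \<Omega> \<nu> (a *\<^sub>R y + b *\<^sub>R y') = L2_norm \<Omega> (\<lambda>x. a *\<^sub>R Y_jet \<nu> y x + b *\<^sub>R Y_jet \<nu> y' x)"
  unfolding Y_norm_eq[OF Y_linear(1)[OF assms]]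
proof (rule L2_norm_cong)
  show "AE x in M. norm (Y_jet \<nu> (a *\<^sub>R y + b *\<^sub>R y') x) = norm (a *\<^sub>R Y_jet \<nu> y x + b *\<^sub>R Y_jet \<nu> y' x)"
    using Y_linear(2)[OF assms, of a b] by eventually_elim simp
qed (use L2_measurable[OF Y_jet_L2[OF assms(1)]] L2_measurable[OF Y_jet_L2[OF assms(2)]]
    L2_measurable[OF Y_jet_L2[OF Y_linear(1)[OF assms]]] in simp_all)

lemma Y_norm_diff:
  assumes "y \<in> Y_space \<Omega> \<nu>" "y' \<in> Y_space \<Omega> \<nu>"
  shows "Y_norm \<Omega> \<nu> (y - y') = L2_norm \<Omega> (\<lambda>x. Y_jet \<nu> y x - Y_jet \<nu> y' x)"
  using Y_norm_linear[OF assms, of 1 "-1"] by simp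

lemma Y_norm_scaleR:
  assumes "y \<in> Y_space \<Omega> \<nu>"
  shows "Y_norm \<Omega> \<nu> (a *\<^sub>R y) = \<bar>a\<bar> * Y_norm \<Omega> \<nu> y"
  using Y_norm_linear[OF assms assms, of a 0] by (simp add: L2_norm_scaleR Y_norm_eq[OF assms])

lemma Y_norm_components: "H1_norm \<Omega> (fst y) \<le> Y_norm \<Omega> \<nu> y" "Z_norm \<Omega> \<nu> (snd y) \<le> Y_norm \<Omega> \<nu> y"
  unfolding Y_norm_def by (auto intro: real_le_rsqrt)

lemma Y_complete:
  assumes X: "\<And>n. X n \<in> Y_space \<Omega> \<nu>"
    and cauchy: "\<And>e. 0 < e \<Longrightarrow> \<exists>N. \<forall>m\<ge>N. \<forall>n\<ge>N. Y_norm \<Omega> \<nu> (X m - X n) < e"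
  obtains y where "y \<in> Y_space \<Omega> \<nu>" "(\<lambda>n. Y_norm \<Omega> \<nu> (X n - y)) \<longlonglongrightarrow> 0"
proof -
  have X1: "fst (X n) \<in> H1 \<Omega> UNIV" "snd (X n) \<in> Z_space \<Omega> \<nu>" for n
    using X[of n] by (auto simp: Y_space_iff)
  have "\<exists>N. \<forall>m\<ge>N. \<forall>n\<ge>N. H1_norm \<Omega> (fst (X m) - fst (X n)) < e" if e: "0 < e" for e
    using cauchy[OF e] order_le_less_trans[OF Y_norm_components(1)] unfolding fst_diff[symmetric] by blast
  from H1_complete[OF X1(1) subspace_UNIV this] obtain u
    where u: "u \<in> H1 \<Omega> UNIV" "(\<lambda>n. H1_norm \<Omega> (fst (X n) - u)) \<longlonglongrightarrow> 0" by blast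
  have "\<exists>N. \<forall>m\<ge>N. \<forall>n\<ge>N. Z_norm \<Omega> \<nu> (snd (X m) - snd (X n)) < e" if e: "0 < e" for e
    using cauchy[OF e] order_le_less_trans[OF Y_norm_components(2)] unfolding snd_diff[symmetric] by blast
  from Z_complete[OF X1(2) this] obtain z
    where z: "z \<in> Z_space \<Omega> \<nu>" "(\<lambda>n. Z_norm \<Omega> \<nu> (snd (X n) - z)) \<longlonglongrightarrow> 0" by blast
  have "(\<lambda>n. Y_norm \<Omega> \<nu> (X n - (u, z))) \<longlonglongrightarrow> sqrt (0\<^sup>2 + 0\<^sup>2)"
    unfolding Y_norm_def fst_diff snd_diff fst_conv snd_conv
    by (intro tendsto_real_sqrt tendsto_add tendsto_power u z)
  then show thesis using that[of "(u, z)"] u z by (simp add: Y_space_iff)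
qed

end

section \<open>Traces and admissible states\<close>

lemma sets_surface_measure [simp, measurable_cong]: "sets surface_measure = sets borel"
proof -
  have "sets surface_measure = sigma_sets UNIV (sets (borel :: (real^3) measure))"
    unfolding surface_measure_def by (rule sets_measure_of) simp
  also have "\<dots> = sets borel" using sets.sigma_sets_eq[of "borel :: (real^3) measure"] by simp
  finally show ?thesis .
qed

lemma tendsto_0_bound:
  fixes f g :: "nat \<Rightarrow> 'a::{linorder_topology, zero}"
  assumes "\<And>n. 0 \<le> f n" "\<And>n. f n \<le> g n" "g \<longlonglongrightarrow> 0"
  shows "f \<longlonglongrightarrow> 0"
  by (rule tendsto_sandwich[OF _ _ tendsto_const assms(3)]) (use assms in auto)

context bounded_domain
begin

abbreviation zero_trace :: "(real^3) set \<Rightarrow> (real^3 \<Rightarrow> real^3) \<Rightarrow> bool"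
  where "zero_trace \<Gamma> u \<equiv> has_trace \<Omega> \<Gamma> u (\<lambda>_. 0)"

lemma smooth_vec_linear:
  assumes "\<And>i. smooth (\<lambda>x. (w x :: real^3) $ i)" "\<And>i. smooth (\<lambda>x. (w' x :: real^3) $ i)"
  shows "smooth (\<lambda>x. (a *\<^sub>R w x + b *\<^sub>R w' x) $ i)"
  unfolding vector_add_component vector_scaleR_component real_scaleR_def
  by (intro smooth_add smooth_mult smooth_const assms)

text \<open>The square of a sum is at most twice the sum of the squares. Staying in
  \<open>ennreal\<close> covers boundary integrals that are infinite.\<close>

lemma boundary_integral_linear:
  fixes w w' :: "real^3 \<Rightarrow> real^3"
  assumes \<Gamma>: "\<Gamma> \<in> sets borel" and w: "\<And>i. smooth (\<lambda>x. w x $ i)" "\<And>i. smooth (\<lambda>x. w' x $ i)"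
  shows "(\<integral>\<^sup>+x\<in>\<Gamma>. ennreal ((norm (a *\<^sub>R w x + b *\<^sub>R w' x))\<^sup>2) \<partial>surface_measure)
    \<le> ennreal (2 * a\<^sup>2) * (\<integral>\<^sup>+x\<in>\<Gamma>. ennreal ((norm (w x))\<^sup>2) \<partial>surface_measure)
      + ennreal (2 * b\<^sup>2) * (\<integral>\<^sup>+x\<in>\<Gamma>. ennreal ((norm (w' x))\<^sup>2) \<partial>surface_measure)"
proof -
  have "continuous_on UNIV v" if "\<And>i. smooth (\<lambda>x. v x $ i)" for v :: "real^3 \<Rightarrow> real^3"
    using continuous_on_vec_lambda[of UNIV "\<lambda>i x. v x $ i"] smooth_continuous[OF that] by simp
  then have [measurable]: "w \<in> borel_measurable borel" "w' \<in> borel_measurable borel"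
    using w by (auto intro: borel_measurable_continuous_onI)
  note [measurable] = \<Gamma>
  have "(norm (a *\<^sub>R u + b *\<^sub>R v))\<^sup>2 \<le> 2 * a\<^sup>2 * (norm u)\<^sup>2 + 2 * b\<^sup>2 * (norm v)\<^sup>2" for u v :: "real^3"
  proof -
    have "(norm (a *\<^sub>R u + b *\<^sub>R v))\<^sup>2 \<le> (\<bar>a\<bar> * norm u + \<bar>b\<bar> * norm v)\<^sup>2"
      using norm_triangle_ineq[of "a *\<^sub>R u" "b *\<^sub>R v"] by (intro power_mono) auto
    also have "\<dots> \<le> 2 * (\<bar>a\<bar> * norm u)\<^sup>2 + 2 * (\<bar>b\<bar> * norm v)\<^sup>2"
      using sum_squares_bound[of "\<bar>a\<bar> * norm u" "\<bar>b\<bar> * norm v"] by (simp add: power2_sum)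
    finally show ?thesis by (simp add: power_mult_distrib)
  qed
  then have "(\<integral>\<^sup>+x\<in>\<Gamma>. ennreal ((norm (a *\<^sub>R w x + b *\<^sub>R w' x))\<^sup>2) \<partial>surface_measure)
    \<le> (\<integral>\<^sup>+x\<in>\<Gamma>. ennreal (2 * a\<^sup>2 * (norm (w x))\<^sup>2 + 2 * b\<^sup>2 * (norm (w' x))\<^sup>2) \<partial>surface_measure)"
    by (intro nn_integral_mono mult_right_mono ennreal_leI) auto
  also have "\<dots> = (\<integral>\<^sup>+x. ennreal (2 * a\<^sup>2) * (ennreal ((norm (w x))\<^sup>2) * indicator \<Gamma> x)
      + ennreal (2 * b\<^sup>2) * (ennreal ((norm (w' x))\<^sup>2) * indicator \<Gamma> x) \<partial>surface_measure)"
    by (intro nn_integral_cong) (simp add: ennreal_mult distrib_right mult.assoc)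
  also have "\<dots> = ennreal (2 * a\<^sup>2) * (\<integral>\<^sup>+x\<in>\<Gamma>. ennreal ((norm (w x))\<^sup>2) \<partial>surface_measure)
      + ennreal (2 * b\<^sup>2) * (\<integral>\<^sup>+x\<in>\<Gamma>. ennreal ((norm (w' x))\<^sup>2) \<partial>surface_measure)"
    by (simp add: nn_integral_add nn_integral_cmult)
  finally show ?thesis .
qed

lemma zero_traceE:
  assumes "zero_trace \<Gamma> u"
  obtains w where "\<And>n i. smooth (\<lambda>x. w n x $ i)" "(\<lambda>n. H1_norm \<Omega> (w n - u)) \<longlonglongrightarrow> 0"
    "(\<lambda>n. \<integral>\<^sup>+x\<in>\<Gamma>. ennreal ((norm (w n x))\<^sup>2) \<partial>surface_measure) \<longlonglongrightarrow> 0"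
  using assms that unfolding has_trace_def diff_zero by blast

lemma zero_traceI:
  assumes "\<And>n i. smooth (\<lambda>x. w n x $ i)" "(\<lambda>n. H1_norm \<Omega> (w n - u)) \<longlonglongrightarrow> 0"
    "(\<lambda>n. \<integral>\<^sup>+x\<in>\<Gamma>. ennreal ((norm (w n x))\<^sup>2) \<partial>surface_measure) \<longlonglongrightarrow> 0"
  shows "zero_trace \<Gamma> u"
  using assms unfolding has_trace_def diff_zero by (blast intro: borel_measurable_const)

lemma zero_trace_linear:
  assumes \<Gamma>: "\<Gamma> \<in> sets borel" and H: "u \<in> H1 \<Omega> UNIV" "v \<in> H1 \<Omega> UNIV"
    and tr: "zero_trace \<Gamma> u" "zero_trace \<Gamma> v"
  shows "zero_trace \<Gamma> (a *\<^sub>R u + b *\<^sub>R v)"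
proof -
  obtain w where w: "\<And>n i. smooth (\<lambda>x. w n x $ i)" "(\<lambda>n. H1_norm \<Omega> (w n - u)) \<longlonglongrightarrow> 0"
    "(\<lambda>n. \<integral>\<^sup>+x\<in>\<Gamma>. ennreal ((norm (w n x))\<^sup>2) \<partial>surface_measure) \<longlonglongrightarrow> 0"
    using zero_traceE[OF tr(1)] by blast
  obtain w' where w': "\<And>n i. smooth (\<lambda>x. w' n x $ i)" "(\<lambda>n. H1_norm \<Omega> (w' n - v)) \<longlonglongrightarrow> 0"
    "(\<lambda>n. \<integral>\<^sup>+x\<in>\<Gamma>. ennreal ((norm (w' n x))\<^sup>2) \<partial>surface_measure) \<longlonglongrightarrow> 0"
    using zero_traceE[OF tr(2)] by blast
  have wH: "w n - u \<in> H1 \<Omega> UNIV" "w' n - v \<in> H1 \<Omega> UNIV" for n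
    using w(1) w'(1) H smooth_H1 H1_diff[OF _ _ subspace_UNIV] by blast+
  show ?thesis
  proof (rule zero_traceI)
    show "smooth (\<lambda>x. (\<lambda>n x. a *\<^sub>R w n x + b *\<^sub>R w' n x) n x $ i)" for n i
      using smooth_vec_linear[OF w(1) w'(1)] by simp
    have eq: "(\<lambda>x. a *\<^sub>R w n x + b *\<^sub>R w' n x) - (a *\<^sub>R u + b *\<^sub>R v) = a *\<^sub>R (w n - u) + b *\<^sub>R (w' n - v)" for n
      by (auto simp: scaleR_fun_def algebra_simps)
    have l: "(\<lambda>n. \<bar>a\<bar> * H1_norm \<Omega> (w n - u) + \<bar>b\<bar> * H1_norm \<Omega> (w' n - v)) \<longlonglongrightarrow> 0"
      using tendsto_add[OF tendsto_mult[OF tendsto_const w(2)] tendsto_mult[OF tendsto_const w'(2)]] by simp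
    show "(\<lambda>n. H1_norm \<Omega> ((\<lambda>x. a *\<^sub>R w n x + b *\<^sub>R w' n x) - (a *\<^sub>R u + b *\<^sub>R v))) \<longlonglongrightarrow> 0"
      unfolding eq by (rule tendsto_0_bound[OF _ H1_norm_linear(2)[OF wH subspace_UNIV] l]) simp
    let ?I = "\<lambda>w. \<integral>\<^sup>+x\<in>\<Gamma>. ennreal ((norm (w x))\<^sup>2) \<partial>surface_measure"
    have "(\<lambda>n. ennreal (2 * a\<^sup>2) * ?I (w n) + ennreal (2 * b\<^sup>2) * ?I (w' n))
        \<longlonglongrightarrow> ennreal (2 * a\<^sup>2) * 0 + ennreal (2 * b\<^sup>2) * 0"
      by (rule tendsto_add[OF ennreal_tendsto_cmult[OF _ w(3)] ennreal_tendsto_cmult[OF _ w'(3)]]) simp_all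
    then have l': "(\<lambda>n. ennreal (2 * a\<^sup>2) * ?I (w n) + ennreal (2 * b\<^sup>2) * ?I (w' n)) \<longlonglongrightarrow> 0"
      by simp
    show "(\<lambda>n. ?I (\<lambda>x. a *\<^sub>R w n x + b *\<^sub>R w' n x)) \<longlonglongrightarrow> 0"
      by (rule tendsto_0_bound[OF _ boundary_integral_linear[OF \<Gamma> w(1) w'(1)] l']) simp
  qed
qed

lemma zero_trace_zero: "zero_trace \<Gamma> 0"
proof (rule zero_traceI[of "\<lambda>_. 0"])
  \<comment> \<open>Taking both coefficients 0 gives the norm of 0; the chosen weak gradient of the
    zero function is known to vanish only almost everywhere, so unfolding does not decide
    this.\<close>
  have "H1_norm \<Omega> (0::real^3 \<Rightarrow> real^3) \<le> 0"
    using H1_norm_linear(2)[OF H1_zero[OF subspace_UNIV] H1_zero[OF subspace_UNIV] subspace_UNIV, of 0 0] by simp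
  then have "H1_norm \<Omega> (0::real^3 \<Rightarrow> real^3) = 0" by (simp add: antisym)
  then show "(\<lambda>n. H1_norm \<Omega> (0 - (0::real^3 \<Rightarrow> real^3))) \<longlonglongrightarrow> 0" by simp
qed (simp_all add: smooth_const)

text \<open>A diagonal choice among the approximating smooth functions.\<close>

lemma zero_trace_closed:
  assumes X: "\<And>n. X n \<in> H1 \<Omega> UNIV" "\<And>n. zero_trace \<Gamma> (X n)" and u: "u \<in> H1 \<Omega> UNIV"
    and lim: "(\<lambda>n. H1_norm \<Omega> (X n - u)) \<longlonglongrightarrow> 0"
  shows "zero_trace \<Gamma> u"
proof -
  let ?I = "\<lambda>w. \<integral>\<^sup>+x\<in>\<Gamma>. ennreal ((norm (w x))\<^sup>2) \<partial>surface_measure"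
  let ?e = "\<lambda>n. 1 / real (Suc n)"
  have *: "\<exists>w. (\<forall>i. smooth (\<lambda>x. w x $ i)) \<and> H1_norm \<Omega> (w - X n) < ?e n \<and> ?I w < ennreal (?e n)" for n
  proof -
    obtain w where w: "\<And>n i. smooth (\<lambda>x. w n x $ i)" "(\<lambda>m. H1_norm \<Omega> (w m - X n)) \<longlonglongrightarrow> 0"
      "(\<lambda>m. ?I (w m)) \<longlonglongrightarrow> 0"
      using zero_traceE[OF X(2)[of n]] by blast
    have "\<forall>\<^sub>F m in sequentially. H1_norm \<Omega> (w m - X n) < ?e n \<and> ?I (w m) < ennreal (?e n)"
      by (intro eventually_conj order_tendstoD(2)[OF w(2)] order_tendstoD(2)[OF w(3)]) auto
    then obtain m where "H1_norm \<Omega> (w m - X n) < ?e n \<and> ?I (w m) < ennreal (?e n)"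
      by (auto simp: eventually_sequentially)
    then show ?thesis using w(1) by blast
  qed
  have "\<forall>n. \<exists>w. (\<forall>i. smooth (\<lambda>x. w x $ i)) \<and> H1_norm \<Omega> (w - X n) < ?e n \<and> ?I w < ennreal (?e n)"
    using * by blast
  from choice[OF this] obtain w where w: "\<And>n i. smooth (\<lambda>x. w n x $ i)"
    "\<And>n. H1_norm \<Omega> (w n - X n) < ?e n" "\<And>n. ?I (w n) < ennreal (?e n)" by blast
  have e0: "?e \<longlonglongrightarrow> 0" by (rule LIMSEQ_Suc[OF lim_const_over_n])
  show ?thesis
  proof (rule zero_traceI[OF w(1)])
    have wH: "w n \<in> H1 \<Omega> UNIV" for n by (rule smooth_H1[OF w(1)])
    have b: "H1_norm \<Omega> (w n - u) \<le> ?e n + H1_norm \<Omega> (X n - u)" for n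
      using H1_norm_triangle[OF wH X(1) u subspace_UNIV, of n n] w(2)[of n] by linarith
    have l: "(\<lambda>n. ?e n + H1_norm \<Omega> (X n - u)) \<longlonglongrightarrow> 0" using tendsto_add[OF e0 lim] by simp
    show "(\<lambda>n. H1_norm \<Omega> (w n - u)) \<longlonglongrightarrow> 0"
      by (rule tendsto_0_bound[OF _ b l]) simp
    have "(\<lambda>n. ennreal (?e n)) \<longlonglongrightarrow> ennreal 0" by (intro tendsto_ennrealI e0)
    then have l': "(\<lambda>n. ennreal (?e n)) \<longlonglongrightarrow> 0" by (simp only: ennreal_0)
    show "(\<lambda>n. ?I (w n)) \<longlonglongrightarrow> 0"
      by (rule tendsto_0_bound[OF _ less_imp_le[OF w(3)] l']) simp
  qed
qed

end

section \<open>Admissible states and discrete recovery\<close>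

locale discretization = bounded_domain +
  fixes \<Gamma> :: "(real^3) set" and Uh :: "real \<Rightarrow> (real^3 \<Rightarrow> real^3) set"
    and Zh :: "real \<Rightarrow> real \<Rightarrow> (real^3 \<Rightarrow> real^3^3) set" and uDir :: "real^3 \<Rightarrow> real^3"
  assumes boundary_part: "\<Gamma> \<in> sets borel" and spaces: "approximation_spaces \<Omega> \<Gamma> Uh Zh"
    and uDir: "uDir \<in> H1 \<Omega> UNIV"
begin

abbreviation Yh :: "real \<Rightarrow> real \<Rightarrow> state set"
  where "Yh \<equiv> Y_approx Uh Zh"

text \<open>The linear space parallel to the affine set of admissible states, for discrete and
  continuous problems alike; on it the boundary term of Korn's inequality vanishes.\<close>

definition directions :: "real \<Rightarrow> real \<Rightarrow> state set"
  where "directions \<nu> h = {y \<in> Y_space \<Omega> \<nu>. zero_trace \<Gamma> (fst y) \<and> (h = 0 \<or> y \<in> Yh \<nu> h)}"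

abbreviation adm :: "real \<Rightarrow> real \<Rightarrow> state set"
  where "adm \<equiv> admissible \<Omega> \<Gamma> Uh Zh uDir"

lemma Yh_subspace: "0 \<le> \<nu> \<Longrightarrow> 0 < h \<Longrightarrow> subspace (Yh \<nu> h)"
  and Yh_closed: "0 \<le> \<nu> \<Longrightarrow> 0 < h \<Longrightarrow> seminorm_closed (Y_space \<Omega> \<nu>) (Y_norm \<Omega> \<nu>) (Yh \<nu> h)"
  using spaces[unfolded approximation_spaces_def, THEN conjunct1] by simp_all

lemma Yh_mono: "0 \<le> \<nu> \<Longrightarrow> 0 < h \<Longrightarrow> h \<le> h' \<Longrightarrow> Yh \<nu> h' \<subseteq> Yh \<nu> h"
  using spaces[unfolded approximation_spaces_def, THEN conjunct2, THEN conjunct1] by simp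

lemma Yh_positive: "0 < \<nu> \<Longrightarrow> 0 < h \<Longrightarrow> Yh \<nu> h = Yh 1 h"
  using spaces[unfolded approximation_spaces_def, THEN conjunct2, THEN conjunct2, THEN conjunct2, THEN conjunct1]
  by blast

lemma Yh_zero: "0 < h \<Longrightarrow> Yh 0 h = Yh 1 h"
  and Yh_sub: "0 < h \<Longrightarrow> Yh 1 h \<subseteq> Y_space \<Omega> 1"
  and Yh_dense: "0 \<le> \<nu> \<Longrightarrow> seminorm_dense (Y_dir \<Omega> \<Gamma> \<nu> 0) (Y_norm \<Omega> \<nu>) (\<Union>h\<in>{0<..}. Yh \<nu> h \<inter> Y_dir \<Omega> \<Gamma> \<nu> 0)"
  using spaces[unfolded approximation_spaces_def, THEN conjunct2, THEN conjunct2, THEN conjunct2, THEN conjunct2]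
  by blast+

lemma Yh_eq:
  assumes "0 \<le> \<nu>" "0 \<le> \<nu>'" "0 < h"
  shows "Yh \<nu> h = Yh \<nu>' h"
proof -
  have "Yh \<nu> h = Yh 1 h" if "0 \<le> \<nu>" for \<nu>
    using Yh_zero[OF assms(3)] Yh_positive[OF _ assms(3), of \<nu>] that by (cases "\<nu> = 0") auto
  then show ?thesis using assms by metis
qed

lemma Y_space_mono: "\<nu> = \<nu>' \<or> \<nu>' = 0 \<or> (\<nu> > 0 \<and> \<nu>' > 0) \<Longrightarrow> Y_space \<Omega> \<nu> \<subseteq> Y_space \<Omega> \<nu>'"
  by (auto simp: Y_space_def Z_space_def H1_L2)

lemma Y_space_1_sub: "0 \<le> \<nu> \<Longrightarrow> Y_space \<Omega> 1 \<subseteq> Y_space \<Omega> \<nu>"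
  by (rule Y_space_mono) auto

lemma Y_dir_eq: "Y_dir \<Omega> \<Gamma> \<nu> 0 = directions \<nu> 0"
  by (auto simp: Y_dir_def directions_def equal_on_boundary_def)

lemma directions_eq: "directions \<nu> h = (if h = 0 then directions \<nu> 0 else Yh \<nu> h \<inter> directions \<nu> 0)"
  by (auto simp: directions_def)

text \<open>Both branches of \<open>admissible\<close> become a translate of
  \<open>directions\<close>, so convexity, closedness and completeness follow from the linear
  space.\<close>

lemma adm_iff: "y \<in> adm \<nu> h \<longleftrightarrow> y - (uDir, 0) \<in> directions \<nu> h"
proof -
  have D: "(uDir, 0) \<in> Y_space \<Omega> \<nu>"
    using uDir Y_space_subspace[of \<nu>, THEN subspace_0] by (simp add: Y_space_iff)
  have "y \<in> Y_space \<Omega> \<nu> \<longleftrightarrow> y - (uDir, 0) \<in> Y_space \<Omega> \<nu>"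
    using subspace_diff[OF Y_space_subspace _ D] subspace_add[OF Y_space_subspace _ D] by (metis diff_add_cancel)
  then have "y \<in> Y_dir \<Omega> \<Gamma> \<nu> uDir \<longleftrightarrow> y - (uDir, 0) \<in> directions \<nu> 0"
    by (simp add: Y_dir_def equal_on_boundary_def directions_def)
  moreover have "y \<in> (\<lambda>y. y + (uDir, 0)) ` A \<longleftrightarrow> y - (uDir, 0) \<in> A" for A
    by (metis (no_types, lifting) add_diff_cancel diff_add_cancel image_iff)
  ultimately show ?thesis
    unfolding admissible_def Y_dir_eq directions_eq[of \<nu> h] by simp
qed

lemma directions_subspace:
  assumes "0 \<le> \<nu>" "0 \<le> h"
  shows "subspace (directions \<nu> h)"
proof -
  have lin: "a *\<^sub>R y + b *\<^sub>R y' \<in> directions \<nu> h" if "y \<in> directions \<nu> h" "y' \<in> directions \<nu> h" for a b y y'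
  proof -
    have y: "y \<in> Y_space \<Omega> \<nu>" "y' \<in> Y_space \<Omega> \<nu>" "zero_trace \<Gamma> (fst y)" "zero_trace \<Gamma> (fst y')"
      using that by (auto simp: directions_def)
    have "zero_trace \<Gamma> (fst (a *\<^sub>R y + b *\<^sub>R y'))"
      using y zero_trace_linear[OF boundary_part] by (simp add: Y_space_iff)
    moreover have "h = 0 \<or> a *\<^sub>R y + b *\<^sub>R y' \<in> Yh \<nu> h"
    proof (cases "h = 0")
      case False
      then show ?thesis
        using that assms Yh_subspace[of \<nu> h] by (auto simp: directions_def subspace_add subspace_scale)
    qed simp
    ultimately show ?thesis using Y_linear(1)[OF y(1,2)] by (simp add: directions_def)
  qed
  have "0 \<in> directions \<nu> h"
  proof -
    have "h = 0 \<or> 0 \<in> Yh \<nu> h"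
      using assms Yh_subspace[of \<nu> h, THEN subspace_0] by (cases "h = 0") auto
    then show ?thesis
      using subspace_0[OF Y_space_subspace, of \<nu>] zero_trace_zero by (simp add: directions_def)
  qed
  then show ?thesis using lin[of _ _ 1 1] lin[of _ _ _ 0] by (auto simp: subspace_def)
qed

lemma directions_closed:
  assumes "0 \<le> \<nu>" "0 \<le> h" "\<And>n. X n \<in> directions \<nu> h" "y \<in> Y_space \<Omega> \<nu>" "(\<lambda>n. Y_norm \<Omega> \<nu> (X n - y)) \<longlonglongrightarrow> 0"
  shows "y \<in> directions \<nu> h"
proof -
  have X: "X n \<in> Y_space \<Omega> \<nu>" "zero_trace \<Gamma> (fst (X n))" for n using assms(3) by (auto simp: directions_def)
  have "zero_trace \<Gamma> (fst y)"
  proof (rule zero_trace_closed)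
    show "(\<lambda>n. H1_norm \<Omega> (fst (X n) - fst y)) \<longlonglongrightarrow> 0"
      using Y_norm_components(1)[of "X _ - y" \<nu>]
      by (intro tendsto_0_bound[OF _ _ assms(5)]) auto
  qed (use X assms(4) in \<open>auto simp: Y_space_iff\<close>)
  moreover have "h = 0 \<or> y \<in> Yh \<nu> h"
  proof (cases "h = 0")
    case False
    then have "seminorm_closed (Y_space \<Omega> \<nu>) (Y_norm \<Omega> \<nu>) (Yh \<nu> h)" "\<forall>n. X n \<in> Yh \<nu> h"
      using Yh_closed[of \<nu> h] assms(1-3) by (auto simp: directions_def)
    then show ?thesis using assms(4,5) unfolding seminorm_closed_def by blast
  qed simp
  ultimately show ?thesis using assms(4) by (simp add: directions_def)
qed

lemma adm_diff:
  assumes "0 \<le> \<nu>" "0 \<le> h" "y \<in> adm \<nu> h" "y' \<in> adm \<nu> h"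
  shows "y - y' \<in> directions \<nu> h"
  using subspace_diff[OF directions_subspace[OF assms(1,2)], of "y - (uDir, 0)" "y' - (uDir, 0)"] assms(3,4)
  by (simp add: adm_iff)

lemma adm_sub: "y \<in> adm \<nu> h \<Longrightarrow> y \<in> Y_space \<Omega> \<nu>"
proof -
  assume "y \<in> adm \<nu> h"
  then have "y - (uDir, 0) \<in> Y_space \<Omega> \<nu>" by (simp add: adm_iff directions_def)
  moreover have "(uDir, 0) \<in> Y_space \<Omega> \<nu>"
    using uDir Y_space_subspace[of \<nu>, THEN subspace_0] by (simp add: Y_space_iff)
  ultimately show ?thesis using subspace_add[OF Y_space_subspace] by fastforce
qed

lemma adm_uDir: "0 \<le> \<nu> \<Longrightarrow> 0 \<le> h \<Longrightarrow> (uDir, 0) \<in> adm \<nu> h"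
  using subspace_0[OF directions_subspace] by (simp add: adm_iff)

lemma adm_mid:
  assumes "0 \<le> \<nu>" "0 \<le> h" "y \<in> adm \<nu> h" "y' \<in> adm \<nu> h"
  shows "(1/2) *\<^sub>R (y + y') \<in> adm \<nu> h"
proof -
  note S = directions_subspace[OF assms(1,2)]
  have "(1/2) *\<^sub>R (y + y') - (uDir, 0) = (1/2) *\<^sub>R ((y - (uDir, 0)) + (y' - (uDir, 0)))"
  proof -
    have "(y - (uDir, 0)) + (y' - (uDir, 0)) = (y + y') - ((uDir, 0) + (uDir, 0))" by simp
    then show ?thesis by (simp only: scaleR_diff_right scaleR_half_double)
  qed
  then show ?thesis
    using assms(3,4) S by (simp only: adm_iff subspace_scale subspace_add)
qed

lemma adm_complete:
  assumes "0 \<le> \<nu>" "0 \<le> h" "\<And>n. X n \<in> adm \<nu> h"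
    and cauchy: "\<And>e. 0 < e \<Longrightarrow> \<exists>M. \<forall>m\<ge>M. \<forall>n\<ge>M. Y_norm \<Omega> \<nu> (X m - X n) < e"
  shows "\<exists>x\<in>adm \<nu> h. (\<lambda>n. Y_norm \<Omega> \<nu> (X n - x)) \<longlonglongrightarrow> 0"
proof -
  let ?X = "\<lambda>n. X n - (uDir, 0)"
  have X: "?X n \<in> directions \<nu> h" for n using assms(3) by (simp add: adm_iff)
  then have "?X n \<in> Y_space \<Omega> \<nu>" for n by (simp add: directions_def)
  moreover have "\<exists>M. \<forall>m\<ge>M. \<forall>n\<ge>M. Y_norm \<Omega> \<nu> (?X m - ?X n) < e" if "0 < e" for e
    using cauchy[OF that] by simp
  ultimately obtain y where y: "y \<in> Y_space \<Omega> \<nu>" "(\<lambda>n. Y_norm \<Omega> \<nu> (?X n - y)) \<longlonglongrightarrow> 0"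
    by (rule Y_complete) auto
  have "y \<in> directions \<nu> h" using directions_closed[OF assms(1,2) X y] .
  then have "y + (uDir, 0) \<in> adm \<nu> h" by (simp add: adm_iff)
  moreover have "(\<lambda>n. Y_norm \<Omega> \<nu> (X n - (y + (uDir, 0)))) \<longlonglongrightarrow> 0"
    using y(2) by (simp add: algebra_simps)
  ultimately show ?thesis by blast
qed

text \<open>Letting \<nu> or h drop to 0 only removes requirements: the gradient of \<open>z\<close>
  or the membership in a discrete space. Since each parameter is constant or tends to 0,
  approximating states are admissible for the limit problem.\<close>

lemma directions_mono:
  assumes "0 \<le> \<nu>'" "0 \<le> \<nu>" "0 \<le> h'" "0 \<le> h" "\<nu>' = \<nu> \<or> \<nu> = 0" "h' = h \<or> h = 0"
  shows "directions \<nu>' h' \<subseteq> directions \<nu> h"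
proof
  fix y assume y: "y \<in> directions \<nu>' h'"
  then have "y \<in> Y_space \<Omega> \<nu>" using assms(5) Y_space_mono[of \<nu>' \<nu>] by (auto simp: directions_def)
  moreover have "h = 0 \<or> y \<in> Yh \<nu> h"
    using y assms Yh_eq[of \<nu> \<nu>' h] by (cases "h = 0") (auto simp: directions_def)
  ultimately show "y \<in> directions \<nu> h" using y by (simp add: directions_def)
qed

lemma adm_mono:
  assumes "0 \<le> \<nu>'" "0 \<le> \<nu>" "0 \<le> h'" "0 \<le> h" "\<nu>' = \<nu> \<or> \<nu> = 0" "h' = h \<or> h = 0" "y \<in> adm \<nu>' h'"
  shows "y \<in> adm \<nu> h"
  using subsetD[OF directions_mono[OF assms(1-6)]] assms(7) by (simp only: adm_iff)

text \<open>For positive h the discrete spaces are the same for all \<nu> and lie in the space with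
  gradients. A discrete state is therefore a competitor for every \<nu>.\<close>

lemma adm_positive_step:
  assumes "0 \<le> \<nu>" "0 < h" "y \<in> adm \<nu> h"
  shows "y - (uDir, 0) \<in> Y_space \<Omega> 1" "y \<in> Y_space \<Omega> 1" "0 \<le> \<nu>' \<Longrightarrow> y \<in> adm \<nu>' h"
proof -
  have d: "y - (uDir, 0) \<in> Yh 1 h" "zero_trace \<Gamma> (fst (y - (uDir, 0)))"
    using assms Yh_eq[of \<nu> 1 h] by (auto simp: adm_iff directions_def)
  then show 1: "y - (uDir, 0) \<in> Y_space \<Omega> 1" using Yh_sub assms(2) by blast
  have "(uDir, 0) \<in> Y_space \<Omega> 1"
    using uDir Y_space_subspace[of 1, THEN subspace_0] by (simp add: Y_space_iff)
  from subspace_add[OF Y_space_subspace 1 this] show "y \<in> Y_space \<Omega> 1" by simp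
  assume \<nu>': "0 \<le> \<nu>'"
  then have "y - (uDir, 0) \<in> directions \<nu>' h"
    unfolding directions_def using Y_space_1_sub[of \<nu>'] 1 d Yh_eq[OF \<nu>' _ assms(2), of 1] by auto
  then show "y \<in> adm \<nu>' h" by (simp add: adm_iff)
qed

text \<open>Displacement and plastic strain are approximated by different means. Density in the zero
  trace space keeps the boundary values of the first, the operator \<open>r\<close> keeps the
  pointwise bound on the second.\<close>

lemma recovery:
  assumes ops: "approximation_operators \<Omega> c\<^sub>3 Uh Zh q r" and "0 \<le> \<nu>" and y: "y \<in> adm \<nu> 0" and "0 < \<delta>"
  obtains h' v where "0 < h'" "v \<in> Y_space \<Omega> 1" "Y_norm \<Omega> \<nu> (v - y) < \<delta>"
    "\<forall>\<nu>' h. 0 \<le> \<nu>' \<longrightarrow> 0 \<le> h \<longrightarrow> h \<le> h' \<longrightarrow> v \<in> adm \<nu>' h"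
    "(AE x in M. norm (snd y x) \<le> c\<^sub>3) \<longrightarrow> (AE x in M. norm (snd v x) \<le> c\<^sub>3)"
proof -
  let ?z = "snd y"
  have yY: "y \<in> Y_space \<Omega> \<nu>" by (rule adm_sub[OF y])
  have z: "?z \<in> Z_space \<Omega> \<nu>" using yY by (simp add: Y_space_iff)
  have d: "y - (uDir, 0) \<in> directions \<nu> 0" using y by (simp add: adm_iff)
  \<comment> \<open>The second component is set to 0 because only the displacement of the
    approximant \<open>a\<close> will be kept.\<close>
  have "(fst y - uDir, 0) \<in> Y_dir \<Omega> \<Gamma> \<nu> 0"
    using d subspace_0[OF Y_space_subspace, of \<nu>] unfolding Y_dir_eq by (auto simp: directions_def Y_space_iff)
  then have "\<exists>a\<in>(\<Union>h\<in>{0<..}. Yh \<nu> h \<inter> Y_dir \<Omega> \<Gamma> \<nu> 0). Y_norm \<Omega> \<nu> (a - (fst y - uDir, 0)) < \<delta> / 2"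
    using Yh_dense[OF \<open>0 \<le> \<nu>\<close>] half_gt_zero[OF \<open>0 < \<delta>\<close>] unfolding seminorm_dense_def by blast
  then obtain a h1 where a: "0 < h1" "a \<in> Yh \<nu> h1" "a \<in> directions \<nu> 0"
    "Y_norm \<Omega> \<nu> (a - (fst y - uDir, 0)) < \<delta> / 2"
    unfolding Y_dir_eq by auto
  have "((\<lambda>h. Z_norm \<Omega> \<nu> (r \<nu> h ?z - ?z)) \<longlongrightarrow> 0) (at_right 0)"
    using ops[unfolded approximation_operators_def, THEN conjunct2, THEN conjunct2, THEN conjunct2,
        THEN conjunct1] z \<open>0 \<le> \<nu>\<close> by blast
  then have "\<forall>\<^sub>F h in at_right 0. Z_norm \<Omega> \<nu> (r \<nu> h ?z - ?z) < \<delta> / 2"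
    using \<open>0 < \<delta>\<close> by (intro order_tendstoD(2)) auto
  \<comment> \<open>Below \<open>h1\<close> the nested spaces contain \<open>a\<close>, so that one
    \<open>h'\<close> serves both components.\<close>
  moreover have "\<forall>\<^sub>F h in at_right 0. h \<in> {0<..<h1}" using a(1) by (rule eventually_at_right_real)
  ultimately have "\<forall>\<^sub>F h in at_right 0. Z_norm \<Omega> \<nu> (r \<nu> h ?z - ?z) < \<delta> / 2 \<and> 0 < h \<and> h < h1"
    by eventually_elim auto
  then obtain h' where h': "Z_norm \<Omega> \<nu> (r \<nu> h' ?z - ?z) < \<delta> / 2" "0 < h'" "h' < h1"
    using eventually_happens'[OF trivial_limit_at_right_real] by blast
  let ?rz = "r \<nu> h' ?z"
  have rz: "?rz \<in> Zh \<nu> h'"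
    "(AE x in M. norm (?z x) \<le> c\<^sub>3) \<Longrightarrow> AE x in M. norm (?rz x) \<le> c\<^sub>3"
    using ops[unfolded approximation_operators_def, THEN conjunct2, THEN conjunct1]
      ops[unfolded approximation_operators_def, THEN conjunct2, THEN conjunct2, THEN conjunct2,
        THEN conjunct2, THEN conjunct2, THEN conjunct1] z \<open>0 \<le> \<nu>\<close> h'(2) by blast+
  have "a \<in> Yh \<nu> h'" using Yh_mono[of \<nu> h' h1] a(2) h' \<open>0 \<le> \<nu>\<close> by auto
  then have fa: "(fst a, ?rz) \<in> Yh \<nu> h'" using rz(1) by (auto simp: Y_approx_def)
  let ?v = "(fst a + uDir, ?rz)"
  \<comment> \<open>Nestedness covers all smaller positive \<open>h\<close>, independence of the
    discrete spaces from \<nu> covers every \<open>\<nu>'\<close>, and \<open>h = 0\<close> asks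
    only for the space and the trace.\<close>
  have v_adm: "?v \<in> adm \<nu>' h" if "0 \<le> \<nu>'" "0 \<le> h" "h \<le> h'" for \<nu>' h
  proof -
    have Y1: "(fst a, ?rz) \<in> Y_space \<Omega> 1"
      using fa Yh_eq[of \<nu> 1 h'] Yh_sub[of h'] h'(2) \<open>0 \<le> \<nu>\<close> by auto
    have "h = 0 \<or> (fst a, ?rz) \<in> Yh \<nu>' h"
    proof (rule disjCI)
      assume n: "(fst a, ?rz) \<notin> Yh \<nu>' h"
      have "(fst a, ?rz) \<in> Yh \<nu>' h" if "0 < h"
        using fa Yh_mono[OF \<open>0 \<le> \<nu>\<close> that \<open>h \<le> h'\<close>] Yh_eq[OF \<open>0 \<le> \<nu>\<close> \<open>0 \<le> \<nu>'\<close> that] by blast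
      then show "h = 0" using n \<open>0 \<le> h\<close> by force
    qed
    then have "(fst a, ?rz) \<in> directions \<nu>' h"
      using Y1 Y_space_1_sub[OF that(1)] a(3) by (auto simp: directions_def)
    then show ?thesis by (simp add: adm_iff)
  qed
  have "Y_norm \<Omega> \<nu> (?v - y) \<le> H1_norm \<Omega> (fst (?v - y)) + Z_norm \<Omega> \<nu> (snd (?v - y))"
    unfolding Y_norm_def by (rule sqrt_sum_squares_le_sum) auto
  also have "fst (?v - y) = fst (a - (fst y - uDir, 0))" by simp
  also have "H1_norm \<Omega> \<dots> + Z_norm \<Omega> \<nu> (snd (?v - y)) < \<delta>"
    using Y_norm_components(1)[of "a - (fst y - uDir, 0)" \<nu>] a(4) h'(1) by simp
  finally have "Y_norm \<Omega> \<nu> (?v - y) < \<delta>" .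
  moreover have "?v \<in> Y_space \<Omega> 1" using adm_sub[OF v_adm[of 1 0]] h'(2) by simp
  ultimately show thesis using that[OF h'(2)] v_adm rz(2) by simp
qed

end

section \<open>The energy densities\<close>

text \<open>A finite sublinear function on a finite dimensional space is bounded by its values on an
  orthonormal basis and its negatives; the negatives count because homogeneity is only positive.
  Subadditivity turns this growth bound into a Lipschitz bound.\<close>

lemma dissipation_density_lipschitz:
  assumes "dissipation_density D"
  obtains L where "0 \<le> L" "\<And>a b. a \<in> dev_mat \<Longrightarrow> b \<in> dev_mat \<Longrightarrow> \<bar>D a - D b\<bar> \<le> L * norm (a - b)"
proof -
  have nonneg: "\<And>a. a \<in> dev_mat \<Longrightarrow> 0 \<le> D a"
    and hom: "\<And>a r. a \<in> dev_mat \<Longrightarrow> 0 \<le> r \<Longrightarrow> D (r *\<^sub>R a) = r * D a"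
    and sub: "\<And>a b. a \<in> dev_mat \<Longrightarrow> b \<in> dev_mat \<Longrightarrow> D (a + b) \<le> D a + D b"
    using assms unfolding dissipation_density_def by blast+
  note S = subspace_dev_mat
  obtain B where B: "B \<subseteq> dev_mat" "pairwise orthogonal B" "\<And>x. x \<in> B \<Longrightarrow> norm x = 1"
    "independent B" "span B = dev_mat"
    using orthonormal_basis_subspace[OF S] by metis
  have fin: "finite B" using B(4) independent_imp_finite by blast
  define L where "L = (\<Sum>b\<in>B. max (D b) (D (- b)))"
  have D0: "D 0 = 0" using hom[of 0 0] S subspace_0 by fastforce
  have term_bound: "D (c *\<^sub>R b) \<le> \<bar>c\<bar> * max (D b) (D (- b))" if "b \<in> B" for b c
  proof (cases "0 \<le> c")
    case True
    have "D (c *\<^sub>R b) = c * D b" using hom[of b c] that B(1) True by blast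
    then show ?thesis using True by (simp add: mult_left_mono)
  next
    case False
    have "- b \<in> dev_mat" using that B(1) S subspace_neg by blast
    then have "D (c *\<^sub>R b) = \<bar>c\<bar> * D (- b)" using hom[of "- b" "- c"] False by simp
    then show ?thesis by (simp add: mult_left_mono)
  qed
  have sums: "D (\<Sum>b\<in>F. c b *\<^sub>R b) \<le> (\<Sum>b\<in>F. \<bar>c b\<bar> * max (D b) (D (- b)))" if "finite F" "F \<subseteq> B" for F c
    using that
  proof (induction F rule: finite_induct)
    case empty
    then show ?case using D0 by simp
  next
    case (insert x F)
    have "c x *\<^sub>R x \<in> dev_mat" "(\<Sum>b\<in>F. c b *\<^sub>R b) \<in> dev_mat"
      using insert.prems B(1) S by (auto intro!: subspace_scale subspace_sum)
    from sub[OF this] show ?case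
      using insert term_bound[of x "c x"] by force
  qed
  have bound: "D a \<le> L * norm a" if "a \<in> dev_mat" for a
  proof -
    have "D a = D (\<Sum>b\<in>B. (a \<bullet> b) *\<^sub>R b)"
      using orthonormal_basis_expand[OF B(2,3) _ fin, of a] that B(5) by simp
    also have "\<dots> \<le> (\<Sum>b\<in>B. \<bar>a \<bullet> b\<bar> * max (D b) (D (- b)))" by (rule sums[OF fin]) simp
    also have "\<dots> \<le> (\<Sum>b\<in>B. norm a * max (D b) (D (- b)))"
    proof (intro sum_mono mult_right_mono)
      fix b assume "b \<in> B"
      show "\<bar>a \<bullet> b\<bar> \<le> norm a" using Cauchy_Schwarz_ineq2[of a b] B(3)[OF \<open>b \<in> B\<close>] by simp
      show "0 \<le> max (D b) (D (- b))" using nonneg[of b] B(1) \<open>b \<in> B\<close> by (auto simp: le_max_iff_disj)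
    qed
    finally show ?thesis by (simp add: L_def sum_distrib_left mult.commute)
  qed
  have "0 \<le> L"
    unfolding L_def using nonneg B(1) by (intro sum_nonneg) (auto simp: le_max_iff_disj)
  moreover have "D a - D b \<le> L * norm (a - b)" if "a \<in> dev_mat" "b \<in> dev_mat" for a b
    using sub[of "a - b" b] bound[of "a - b"] that S subspace_diff by fastforce
  then have "\<bar>D a - D b\<bar> \<le> L * norm (a - b)" if "a \<in> dev_mat" "b \<in> dev_mat" for a b
    using that by (smt (verit) norm_minus_commute)
  ultimately show thesis using that by blast
qed

section \<open>Coercivity of the elasticity tensor\<close>

definition sym_part :: "real^3^3 \<Rightarrow> real^3^3"
  where "sym_part a = (1 / 2) *\<^sub>R (a + transpose a)"

lemma linear_sym_part: "linear sym_part"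
  by (rule linearI) (auto simp: sym_part_def vec_eq_iff transpose_def algebra_simps)

lemma sym_part_in: "sym_part a \<in> sym_mat"
  by (simp add: sym_mat_def sym_part_def vec_eq_iff transpose_def add.commute)

lemma sym_part_id: "a \<in> sym_mat \<Longrightarrow> sym_part a = a"
  by (simp add: sym_mat_def sym_part_def flip: scaleR_2)

text \<open>The constant is the minimum of the quadratic form on the compact unit sphere of the
  symmetric matrices. Composition with \<open>sym_part\<close> extends \<open>C\<close>, which is
  controlled only on those, to a linear map on all matrices.\<close>

lemma elasticity_tensor_coercive:
  assumes "elasticity_tensor C"
  obtains \<kappa> where "linear (\<lambda>a. C (sym_part a))" "0 < \<kappa>"
    "\<And>a. a \<in> sym_mat \<Longrightarrow> \<kappa> * (norm a)\<^sup>2 \<le> C a \<bullet> a"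
proof -
  have add: "\<And>a b. a \<in> sym_mat \<Longrightarrow> b \<in> sym_mat \<Longrightarrow> C (a + b) = C a + C b"
    and scale: "\<And>r a. a \<in> sym_mat \<Longrightarrow> C (r *\<^sub>R a) = r *\<^sub>R C a"
    and pos: "\<And>a. a \<in> sym_mat \<Longrightarrow> a \<noteq> 0 \<Longrightarrow> 0 < C a \<bullet> a"
    using assms[unfolded elasticity_tensor_def, THEN conjunct2, THEN conjunct1]
      assms[unfolded elasticity_tensor_def, THEN conjunct2, THEN conjunct2, THEN conjunct1]
      assms[unfolded elasticity_tensor_def, THEN conjunct2, THEN conjunct2, THEN conjunct2,
        THEN conjunct2, THEN conjunct1] by simp_all
  define T where "T a = C (sym_part a)" for a
  have T: "linear T"
    by (rule linearI) (simp_all add: T_def linear_add[OF linear_sym_part] linear_scale[OF linear_sym_part]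
        add scale sym_part_in)
  have TC: "T a = C a" if "a \<in> sym_mat" for a using that by (simp add: T_def sym_part_id)
  let ?S = "sym_mat \<inter> sphere 0 1"
  have comp: "compact ?S"
    by (intro closed_Int_compact closed_subspace subspace_sym_mat compact_sphere)
  have ne: "?S \<noteq> {}"
  proof -
    have "mat 1 \<in> sym_mat" by (simp add: sym_mat_def)
    moreover have "(mat 1 :: real^3^3) \<noteq> 0" by (simp add: vec_eq_iff mat_def)
    ultimately have "(1 / norm (mat 1 :: real^3^3)) *\<^sub>R mat 1 \<in> ?S"
      using subspace_scale[OF subspace_sym_mat] by simp
    then show ?thesis by blast
  qed
  have "continuous_on ?S (\<lambda>a. T a \<bullet> a)"
    by (intro continuous_intros linear_continuous_on linear_conv_bounded_linear[THEN iffD1] T)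
  from continuous_attains_inf[OF comp ne this] obtain m where m: "m \<in> ?S" "\<And>a. a \<in> ?S \<Longrightarrow> T m \<bullet> m \<le> T a \<bullet> a"
    by blast
  have "m \<noteq> 0" using m(1) by auto
  then have "0 < T m \<bullet> m" using pos[of m] m(1) TC[of m] by simp
  moreover have "(T m \<bullet> m) * (norm a)\<^sup>2 \<le> C a \<bullet> a" if a: "a \<in> sym_mat" for a
  proof (cases "a = 0")
    case True
    then show ?thesis using TC[OF a] linear_0[OF T] by simp
  next
    case False
    let ?b = "(1 / norm a) *\<^sub>R a"
    have "?b \<in> ?S" using a False subspace_scale[OF subspace_sym_mat] by simp
    from m(2)[OF this] have "T m \<bullet> m \<le> (T a \<bullet> a) / (norm a)\<^sup>2"
      by (simp add: linear_scale[OF T] power2_eq_square)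
    then show ?thesis using False TC[OF a] by (simp add: field_simps)
  qed
  ultimately show thesis using that[OF T[unfolded T_def[abs_def]]] by blast
qed

lemma ennreal_two_mult: "0 \<le> x \<Longrightarrow> 2 * ennreal x = ennreal (2 * x)"
  by (simp add: ennreal_mult)

section \<open>The hardening density without its quadratic term\<close>

locale penalty =
  fixes c\<^sub>1 c\<^sub>3 :: real and \<phi> :: "real \<Rightarrow> real"
  assumes c1: "0 < c\<^sub>1" and c3: "0 < c\<^sub>3" and phi: "penalty_function \<phi> c\<^sub>3"
begin

lemma phi_convex: "convex_on UNIV \<phi>"
  and phi_mono: "mono \<phi>"
  and phi_zero: "\<phi> r = 0 \<longleftrightarrow> r \<le> c\<^sub>3"
  and phi_differentiable: "\<phi> differentiable at r"
  and phi_deriv_bounded: "bounded (range (deriv \<phi>))"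
  using phi unfolding penalty_function_def by blast+

lemma phi_nonneg: "0 \<le> \<phi> r"
proof (cases "r \<le> c\<^sub>3")
  case False
  then have "\<phi> c\<^sub>3 \<le> \<phi> r" using phi_mono by (simp add: monoD)
  then show ?thesis using phi_zero[of c\<^sub>3] by simp
next
  case True
  then have "\<phi> r = 0" using phi_zero by blast
  then show ?thesis by simp
qed

lemma phi_continuous: "continuous_on UNIV \<phi>"
  using phi_differentiable differentiable_imp_continuous_within
  by (metis continuous_at_imp_continuous_on)

lemma phi_measurable [measurable]: "\<phi> \<in> borel_measurable borel"
  by (rule borel_measurable_continuous_onI[OF phi_continuous])

lemma phi_lipschitz: obtains K where "0 \<le> K" "\<And>s t. \<bar>\<phi> s - \<phi> t\<bar> \<le> K * \<bar>s - t\<bar>"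
proof -
  obtain K where K: "\<And>r. norm (deriv \<phi> r) \<le> K"
    using phi_deriv_bounded unfolding bounded_iff by blast
  have "norm (\<phi> s - \<phi> t) \<le> K * norm (s - t)" for s t
  proof (rule field_differentiable_bound[of UNIV])
    show "(\<phi> has_field_derivative deriv \<phi> z) (at z within UNIV)" for z
      using phi_differentiable[of z] by (simp add: DERIV_deriv_iff_real_differentiable)
  qed (use K in auto)
  moreover have "0 \<le> K" using K[of 0] norm_ge_zero order_trans by blast
  ultimately show thesis using that by auto
qed

text \<open>The term \<open>sqrt (\<rho>\<^sup>2 + \<bar>a\<bar>\<^sup>2)\<close> of the hardening density is written as the norm of a pair, which
  makes its convexity and its monotonicity in \<open>\<rho>\<close> instances of the triangle inequality.\<close>

definition pen :: "real \<Rightarrow> real^3^3 \<Rightarrow> ennreal"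
  where "pen \<rho> a = (if \<rho> = 0 then ennreal (c\<^sub>1 * norm a) + (if norm a \<le> c\<^sub>3 then 0 else \<infinity>)
    else ennreal (c\<^sub>1 * (norm (\<rho>, a) - \<rho>) + \<phi> (norm a) / \<rho>))"

lemma norm_pair_ge: "\<rho> \<le> norm (\<rho>, a::'a::real_normed_vector)"
  using norm_fst_le[of \<rho> a] by simp

text \<open>The term with \<open>c\<^sub>2\<close> is split off, as it belongs to the quadratic form
  that carries the uniform convexity. What remains in \<open>pen\<close> is convex and carries the
  whole dependence on \<open>\<rho>\<close>.\<close>

lemma hardening_eq:
  assumes "0 \<le> \<rho>" "0 \<le> c\<^sub>2"
  shows "hardening c\<^sub>1 c\<^sub>2 c\<^sub>3 \<phi> \<rho> a = pen \<rho> a + ennreal (c\<^sub>2 * (norm a)\<^sup>2)"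
proof (cases "\<rho> = 0")
  case True
  then show ?thesis using assms c1 by (simp add: hardening_def pen_def ennreal_plus add_ac)
next
  case False
  have "0 \<le> c\<^sub>1 * (norm (\<rho>, a) - \<rho>)" using c1 norm_pair_ge[of \<rho> a] by simp
  moreover have "0 \<le> \<phi> (norm a) / \<rho>" using phi_nonneg assms by simp
  ultimately show ?thesis
    using False assms by (simp add: hardening_def pen_def norm_Pair add_ac flip: ennreal_plus)
qed

lemma pen_positive: "0 < \<rho> \<Longrightarrow> pen \<rho> a = ennreal (c\<^sub>1 * (norm (\<rho>, a) - \<rho>) + \<phi> (norm a) / \<rho>)"
  by (simp add: pen_def)

lemma pen_positive_nonneg: "0 < \<rho> \<Longrightarrow> 0 \<le> c\<^sub>1 * (norm (\<rho>, a::real^3^3) - \<rho>) + \<phi> (norm a) / \<rho>"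
  using c1 norm_pair_ge[of \<rho> a] phi_nonneg[of "norm a"] by simp

lemma pen_zero: "0 \<le> \<rho> \<Longrightarrow> pen \<rho> 0 = 0"
  using c3 phi_zero[of 0] by (simp add: pen_def norm_Pair)

lemma pen_measurable [measurable]: "pen \<rho> \<in> borel_measurable borel"
  unfolding pen_def norm_Pair by measurable

text \<open>For \<open>\<rho> = 0\<close> the norm and the ball are convex. Otherwise the pair norm
  obeys the triangle inequality, and \<open>\<phi>\<close>, convex and nondecreasing, preserves the
  convexity of the norm. The factor 2 on the left avoids division in \<open>ennreal\<close>.\<close>

lemma pen_convex:
  assumes "0 \<le> \<rho>"
  shows "2 * pen \<rho> ((1/2) *\<^sub>R (a + b)) \<le> pen \<rho> a + pen \<rho> b"
proof (cases "\<rho> = 0")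
  case True
  let ?m = "(1/2) *\<^sub>R (a + b)"
  have n: "norm ?m \<le> (norm a + norm b) / 2" using norm_triangle_ineq[of a b] by simp
  show ?thesis
  proof (cases "norm a \<le> c\<^sub>3 \<and> norm b \<le> c\<^sub>3")
    case cc: True
    have "norm ?m \<le> c\<^sub>3" by (rule order_trans[OF n]) (use cc in simp)
    then have "pen \<rho> ?m = ennreal (c\<^sub>1 * norm ?m)" using True by (simp add: pen_def)
    then have "2 * pen \<rho> ?m = ennreal (2 * (c\<^sub>1 * norm ?m))"
      using c1 by (simp only: ennreal_two_mult mult_nonneg_nonneg less_imp_le norm_ge_zero)
    also have "\<dots> \<le> ennreal (c\<^sub>1 * norm a + c\<^sub>1 * norm b)"
      using mult_left_mono[OF n, of c\<^sub>1] c1 by (intro ennreal_leI) (simp add: algebra_simps)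
    finally show ?thesis using True cc c1 by (simp add: pen_def)
  qed (use True in \<open>auto simp: pen_def\<close>)
next
  case False
  then have \<rho>: "0 < \<rho>" using assms by simp
  let ?m = "(1/2) *\<^sub>R (a + b)"
  have "2 * norm (\<rho>, ?m) = norm ((\<rho>, a) + (\<rho>, b))"
  proof -
    have "(\<rho>, ?m) = (1/2) *\<^sub>R ((\<rho>, a) + (\<rho>, b))" by simp
    then show ?thesis by (simp only: norm_scaleR)
  qed
  also have "\<dots> \<le> norm (\<rho>, a) + norm (\<rho>, b)" by (rule norm_triangle_ineq)
  finally have 1: "c\<^sub>1 * (2 * norm (\<rho>, ?m)) \<le> c\<^sub>1 * (norm (\<rho>, a) + norm (\<rho>, b))" using c1 by simp
  have "\<phi> (norm ?m) \<le> \<phi> ((1/2) * norm a + (1/2) * norm b)"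
    using norm_triangle_ineq[of a b] by (intro monoD[OF phi_mono]) simp
  also have "\<dots> \<le> (1/2) * \<phi> (norm a) + (1/2) * \<phi> (norm b)"
    using convex_onD[OF phi_convex, of "1/2" "norm a" "norm b"] by simp
  finally have 2: "2 * \<phi> (norm ?m) / \<rho> \<le> (\<phi> (norm a) + \<phi> (norm b)) / \<rho>"
    using \<rho> by (intro divide_right_mono) auto
  have "2 * pen \<rho> ?m = ennreal (2 * (c\<^sub>1 * (norm (\<rho>, ?m) - \<rho>) + \<phi> (norm ?m) / \<rho>))"
    unfolding pen_positive[OF \<rho>] by (rule ennreal_two_mult[OF pen_positive_nonneg[OF \<rho>]])
  also have "\<dots> \<le> ennreal ((c\<^sub>1 * (norm (\<rho>, a) - \<rho>) + \<phi> (norm a) / \<rho>) + (c\<^sub>1 * (norm (\<rho>, b) - \<rho>) + \<phi> (norm b) / \<rho>))"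
    using 1 2 by (intro ennreal_leI) (simp add: algebra_simps add_divide_distrib)
  also have "\<dots> = pen \<rho> a + pen \<rho> b"
    using pen_positive_nonneg[OF \<rho>] by (simp add: pen_positive[OF \<rho>])
  finally show ?thesis .
qed

text \<open>Moving from \<open>(\<sigma>, a)\<close> to \<open>(\<rho>, a)\<close> lengthens the
  vector by at most the difference of the parameters, and \<open>\<phi>\<close> is nonnegative, so
  division by the smaller parameter gives more. Against \<open>\<sigma> = 0\<close> the penalty
  vanishes inside the ball, and outside the right side is infinite.\<close>

lemma pen_antimono:
  assumes "0 \<le> \<sigma>" "\<sigma> \<le> \<rho>"
  shows "pen \<rho> a \<le> pen \<sigma> a"
proof -
  have "norm (\<rho>, a) \<le> norm (\<sigma>, a) + norm (\<rho> - \<sigma>, 0::real^3^3)"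
    using norm_triangle_ineq[of "(\<sigma>, a)" "(\<rho> - \<sigma>, 0)"] by simp
  then have n: "norm (\<rho>, a) - \<rho> \<le> norm (\<sigma>, a) - \<sigma>" using assms by (simp add: norm_Pair)
  consider "\<rho> = 0" | "\<rho> > 0" "\<sigma> = 0" | "\<rho> > 0" "\<sigma> > 0" using assms by linarith
  then show ?thesis
  proof cases
    case 1
    then show ?thesis using assms by simp
  next
    case 2
    show ?thesis
    proof (cases "norm a \<le> c\<^sub>3")
      case True
      then show ?thesis
        using n 2 c1 phi_zero[of "norm a"] by (auto simp: pen_def norm_Pair intro!: ennreal_leI)
    qed (use 2 in \<open>simp add: pen_def\<close>)
  next
    case 3
    have "\<phi> (norm a) / \<rho> \<le> \<phi> (norm a) / \<sigma>"
      using 3 assms phi_nonneg by (intro divide_left_mono) auto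
    then show ?thesis
      using n c1 by (simp add: pen_positive 3 ennreal_leI add_mono)
  qed
qed

lemma pen_tendsto_positive:
  assumes "0 < \<rho>" "X \<longlonglongrightarrow> a"
  shows "(\<lambda>n. pen \<rho> (X n)) \<longlonglongrightarrow> pen \<rho> a"
proof -
  have "isCont \<phi> (norm a)" using phi_continuous by (simp add: continuous_on_eq_continuous_at)
  then have "(\<lambda>n. \<phi> (norm (X n))) \<longlonglongrightarrow> \<phi> (norm a)"
    by (rule isCont_tendsto_compose) (intro tendsto_norm assms)
  then show ?thesis
    unfolding pen_positive[OF assms(1)]
    by (intro tendsto_ennrealI tendsto_add tendsto_mult tendsto_divide tendsto_diff tendsto_norm
        tendsto_Pair tendsto_const assms) (use assms in auto)
qed

text \<open>Inside the ball the penalty vanishes and there is convergence; outside,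
  \<open>\<phi> (norm a)\<close> is positive and its multiples by \<open>real (Suc n)\<close> exceed
  every bound.\<close>

lemma pen_zero_le_liminf: "pen 0 a \<le> liminf (\<lambda>n. pen (1 / real (Suc n)) a)"
proof (cases "norm a \<le> c\<^sub>3")
  case True
  have "(\<lambda>n. c\<^sub>1 * (norm (1 / real (Suc n), a) - 1 / real (Suc n))) \<longlonglongrightarrow> c\<^sub>1 * (norm (0::real, a) - 0)"
    by (intro tendsto_mult tendsto_const tendsto_diff tendsto_norm tendsto_Pair LIMSEQ_Suc[OF lim_const_over_n])
  then have "(\<lambda>n. pen (1 / real (Suc n)) a) \<longlonglongrightarrow> pen 0 a"
    using True phi_zero[of "norm a"] by (auto simp: pen_def norm_Pair intro!: tendsto_ennrealI)
  then show ?thesis using lim_imp_Liminf by force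
next
  case False
  then have p: "0 < \<phi> (norm a)" using phi_zero[of "norm a"] phi_nonneg[of "norm a"] by linarith
  have "\<forall>\<^sub>F n in sequentially. y < pen (1 / real (Suc n)) a" if y: "y < \<infinity>" for y
  proof -
    obtain b where b: "0 \<le> b" "y = ennreal b" using y by (cases y) auto
    obtain N where N: "b / \<phi> (norm a) < real N" using reals_Archimedean2 by blast
    have "y < pen (1 / real (Suc n)) a" if "n \<ge> N" for n
    proof -
      have "b / \<phi> (norm a) < real (Suc n)" using N that by linarith
      then have "b < \<phi> (norm a) * real (Suc n)" using p by (simp add: pos_divide_less_eq mult.commute)
      also have "\<dots> \<le> c\<^sub>1 * (norm (1 / real (Suc n), a) - 1 / real (Suc n)) + \<phi> (norm a) / (1 / real (Suc n))"
        using c1 norm_pair_ge[of "1 / real (Suc n)" a] by simp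
      finally show ?thesis using b by (simp add: pen_positive ennreal_lessI)
    qed
    then show ?thesis by (auto simp: eventually_sequentially)
  qed
  then show ?thesis using False by (simp add: pen_def le_Liminf_iff)
qed

text \<open>The density for \<open>\<rho> = 0\<close> is dominated by the limit of the continuous
  densities with positive parameter, each of which lies below it; such a supremum is lower
  semicontinuous.\<close>

lemma pen_lsc:
  assumes "0 \<le> \<rho>" "X \<longlonglongrightarrow> a"
  shows "pen \<rho> a \<le> liminf (\<lambda>n. pen \<rho> (X n))"
proof (cases "\<rho> = 0")
  case False
  then show ?thesis using pen_tendsto_positive[of \<rho> X a] assms lim_imp_Liminf by force
next
  case True
  have "pen (1 / real (Suc k)) a \<le> liminf (\<lambda>n. pen 0 (X n))" for k
  proof -
    have "pen (1 / real (Suc k)) a = liminf (\<lambda>n. pen (1 / real (Suc k)) (X n))"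
      using pen_tendsto_positive[OF _ assms(2)] lim_imp_Liminf
      by (metis sequentially_bot zero_less_divide_1_iff of_nat_0_less_iff zero_less_Suc)
    also have "\<dots> \<le> liminf (\<lambda>n. pen 0 (X n))"
      by (intro Liminf_mono always_eventually allI pen_antimono) auto
    finally show ?thesis .
  qed
  then have "liminf (\<lambda>n. pen (1 / real (Suc n)) a) \<le> liminf (\<lambda>n. pen 0 (X n))"
    by (intro Liminf_le) auto
  then show ?thesis using pen_zero_le_liminf True order_trans by blast
qed

text \<open>A one-sided Lipschitz bound, from the triangle inequality and the bounded derivative of
  \<open>\<phi>\<close>. For positive \<open>\<rho>\<close> the constant
  \<open>c\<^sub>1 + L / \<rho>\<close> blows up as \<open>\<rho>\<close> tends to 0, which does no
  harm: the bound serves at the fixed limit parameter.\<close>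

lemma pen_upper:
  assumes "0 \<le> \<rho>"
  obtains K where "0 \<le> K"
    "\<And>a b. (\<rho> = 0 \<Longrightarrow> norm b \<le> c\<^sub>3) \<Longrightarrow> pen \<rho> b \<le> pen \<rho> a + ennreal (K * norm (b - a))"
proof (cases "\<rho> = 0")
  case True
  have "pen 0 b \<le> pen 0 a + ennreal (c\<^sub>1 * norm (b - a))" if "norm b \<le> c\<^sub>3" for a b
  proof -
    have "c\<^sub>1 * norm b \<le> c\<^sub>1 * norm a + c\<^sub>1 * norm (b - a)"
      using norm_triangle_ineq[of a "b - a"] c1 by (simp flip: distrib_left)
    then have "ennreal (c\<^sub>1 * norm b) \<le> ennreal (c\<^sub>1 * norm a) + ennreal (c\<^sub>1 * norm (b - a))"
      using c1 by (simp flip: ennreal_plus)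
    then show ?thesis using that by (auto simp: pen_def)
  qed
  then show thesis using that[of c\<^sub>1] True c1 by simp
next
  case False
  then have \<rho>: "0 < \<rho>" using assms by simp
  obtain L where L: "0 \<le> L" "\<And>s t. \<bar>\<phi> s - \<phi> t\<bar> \<le> L * \<bar>s - t\<bar>" using phi_lipschitz by metis
  have "pen \<rho> b \<le> pen \<rho> a + ennreal ((c\<^sub>1 + L / \<rho>) * norm (b - a))" for a b
  proof -
    have "norm (\<rho>, b) \<le> norm (\<rho>, a) + norm (0::real, b - a)"
      using norm_triangle_ineq[of "(\<rho>, a)" "(0, b - a)"] by simp
    then have 1: "c\<^sub>1 * norm (\<rho>, b) \<le> c\<^sub>1 * norm (\<rho>, a) + c\<^sub>1 * norm (b - a)"
      using c1 by (simp add: norm_Pair flip: distrib_left)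
    have "\<phi> (norm b) - \<phi> (norm a) \<le> L * \<bar>norm b - norm a\<bar>" using L(2)[of "norm b" "norm a"] by simp
    also have "\<dots> \<le> L * norm (b - a)" using L(1) by (intro mult_left_mono norm_triangle_ineq3)
    finally have 2: "\<phi> (norm b) / \<rho> \<le> (\<phi> (norm a) + L * norm (b - a)) / \<rho>"
      using \<rho> by (intro divide_right_mono) auto
    have "0 \<le> (c\<^sub>1 + L / \<rho>) * norm (b - a)" using c1 L \<rho> by (intro mult_nonneg_nonneg) auto
    then show ?thesis
      using 1 2 pen_positive_nonneg[OF \<rho>, of a]
      by (simp add: pen_positive[OF \<rho>] algebra_simps add_divide_distrib flip: ennreal_plus)
  qed
  then show thesis using that[of "c\<^sub>1 + L / \<rho>"] \<rho> c1 L by simp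
qed

end

section \<open>The incremental energy\<close>

lemma inner_linear_diff_bound:
  fixes A B :: "'a::real_normed_vector \<Rightarrow> 'b::real_inner"
  assumes "bounded_linear A" "bounded_linear B"
  obtains K where "0 \<le> K"
    "\<And>x y. \<bar>A x \<bullet> B x - A y \<bullet> B y\<bar> \<le> K * norm (x - y) * (norm x + norm y)"
proof -
  interpret A: bounded_linear A by fact
  interpret B: bounded_linear B by fact
  obtain a where a: "0 \<le> a" "\<And>x. norm (A x) \<le> norm x * a" using A.nonneg_bounded by blast
  obtain b where b: "0 \<le> b" "\<And>x. norm (B x) \<le> norm x * b" using B.nonneg_bounded by blast
  have "\<bar>A x \<bullet> B x - A y \<bullet> B y\<bar> \<le> (a * b) * norm (x - y) * (norm x + norm y)" for x y
  proof -
    have ineq: "\<bar>A u \<bullet> B v\<bar> \<le> (a * b) * norm u * norm v" for u v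
    proof -
      have "\<bar>A u \<bullet> B v\<bar> \<le> norm (A u) * norm (B v)" by (rule Cauchy_Schwarz_ineq2)
      also have "\<dots> \<le> (norm u * a) * (norm v * b)" using a b by (intro mult_mono) auto
      finally show ?thesis by (simp add: algebra_simps)
    qed
    \<comment> \<open>The mixed product of \<open>A y\<close> and \<open>B x\<close> is inserted, so
      that each part contains the difference \<open>x - y\<close> once.\<close>
    have "A x \<bullet> B x - A y \<bullet> B y = A (x - y) \<bullet> B x + A y \<bullet> B (x - y)"
      by (simp add: A.diff B.diff inner_diff_left inner_diff_right)
    then show ?thesis using ineq[of "x - y" x] ineq[of y "x - y"] by (simp add: algebra_simps)
  qed
  then show thesis using that[of "a * b"] a b by simp
qed

text \<open>The mixed products for the sum and for the difference cancel, so the gain at the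
  midpoint is exact, also for different \<open>A\<close> and \<open>B\<close>.\<close>

lemma inner_linear_parallelogram:
  fixes A B :: "'a::real_vector \<Rightarrow> 'b::real_inner"
  assumes "linear A" "linear B"
  shows "A ((1/2) *\<^sub>R (x + y)) \<bullet> B ((1/2) *\<^sub>R (x + y))
    = 1/2 * (A x \<bullet> B x) + 1/2 * (A y \<bullet> B y) - 1/4 * (A (x - y) \<bullet> B (x - y))"
  by (simp add: linear_scale[OF assms(1)] linear_scale[OF assms(2)] linear_add[OF assms(1)]
      linear_add[OF assms(2)] linear_diff[OF assms(1)] linear_diff[OF assms(2)]
      inner_add_left inner_add_right inner_diff_left inner_diff_right field_simps)

type_synonym jet_vector = "((real^3) \<times> (real^3^3)) \<times> ((real^3^3) \<times> (real^3^3^3))"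

definition elastic_strain :: "jet_vector \<Rightarrow> real^3^3"
  where "elastic_strain j = sym_part (snd (fst j)) - fst (snd j)"

lemma linear_elastic_strain: "linear elastic_strain"
  by (rule linearI)
    (simp_all add: elastic_strain_def linear_add[OF linear_sym_part] linear_scale[OF linear_sym_part]
      scaleR_diff_right)

locale elastoplastic = discretization + penalty +
  fixes C :: "real^3^3 \<Rightarrow> real^3^3" and c\<^sub>0 c\<^sub>2 :: real and D :: "real^3^3 \<Rightarrow> real"
    and \<l> :: "(real^3 \<Rightarrow> real^3) \<Rightarrow> real" and zbar :: "real^3 \<Rightarrow> real^3^3"
  assumes elasticity: "elasticity_tensor C" and c0: "0 < c\<^sub>0" and korn: "korn_inequality \<Omega> \<Gamma> c\<^sub>0"
    and c2: "0 < c\<^sub>2" and D: "dissipation_density D"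
    and load: "\<l> \<in> dual_space (H1 \<Omega> UNIV) (H1_norm \<Omega>)" and zbar: "zbar \<in> L2 \<Omega> dev_mat"
begin

abbreviation energy :: "real \<Rightarrow> real \<Rightarrow> state \<Rightarrow> ereal"
  where "energy \<equiv> incremental_energy \<Omega> C c\<^sub>1 c\<^sub>2 c\<^sub>3 \<phi> D \<l> zbar"

text \<open>The quadratic part of the energy density as a form on jets, laid out as displacement,
  its gradient, plastic strain, its gradient. The inner \<open>sym_part\<close> makes it a form on
  all jets; on jets of states the elastic strain is already symmetric.\<close>

definition quad :: "real \<Rightarrow> jet_vector \<Rightarrow> real"
  where "quad \<nu> j = 1/2 * (C (sym_part (elastic_strain j)) \<bullet> elastic_strain j)
    + c\<^sub>2 * (fst (snd j) \<bullet> fst (snd j)) + \<nu>/2 * (snd (snd j) \<bullet> snd (snd j))"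

lemma linear_stress: "linear (\<lambda>j. C (sym_part (elastic_strain j)))"
proof -
  have "linear (\<lambda>a. C (sym_part a))" using elasticity_tensor_coercive[OF elasticity] by metis
  from linear_compose[OF linear_elastic_strain this] show ?thesis by (simp add: o_def)
qed

lemma linear_plastic: "linear (\<lambda>j::jet_vector. fst (snd j))"
  and linear_plastic_gradient: "linear (\<lambda>j::jet_vector. snd (snd j))"
  by (auto intro: linearI)

lemma quad_diff_bound:
  obtains K where "0 \<le> K" "\<And>x y. \<bar>quad \<nu> x - quad \<nu> y\<bar> \<le> K * norm (x - y) * (norm x + norm y)"
proof -
  note b = linear_conv_bounded_linear[THEN iffD1]
  obtain K1 where K1: "0 \<le> K1" "\<And>x y. \<bar>C (sym_part (elastic_strain x)) \<bullet> elastic_strain x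
      - C (sym_part (elastic_strain y)) \<bullet> elastic_strain y\<bar> \<le> K1 * norm (x - y) * (norm x + norm y)"
    using inner_linear_diff_bound[OF b[OF linear_stress] b[OF linear_elastic_strain]] by metis
  obtain K2 where K2: "0 \<le> K2" "\<And>x y :: jet_vector. \<bar>fst (snd x) \<bullet> fst (snd x) - fst (snd y) \<bullet> fst (snd y)\<bar>
      \<le> K2 * norm (x - y) * (norm x + norm y)"
    using inner_linear_diff_bound[OF b[OF linear_plastic] b[OF linear_plastic]] by metis
  obtain K3 where K3: "0 \<le> K3" "\<And>x y :: jet_vector. \<bar>snd (snd x) \<bullet> snd (snd x) - snd (snd y) \<bullet> snd (snd y)\<bar>
      \<le> K3 * norm (x - y) * (norm x + norm y)"
    using inner_linear_diff_bound[OF b[OF linear_plastic_gradient] b[OF linear_plastic_gradient]] by metis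
  let ?K = "1/2 * K1 + c\<^sub>2 * K2 + \<bar>\<nu>/2\<bar> * K3"
  have "\<bar>quad \<nu> x - quad \<nu> y\<bar> \<le> ?K * norm (x - y) * (norm x + norm y)" for x y
  proof -
    let ?n = "norm (x - y) * (norm x + norm y)"
    have "quad \<nu> x - quad \<nu> y = 1/2 * (C (sym_part (elastic_strain x)) \<bullet> elastic_strain x
        - C (sym_part (elastic_strain y)) \<bullet> elastic_strain y)
      + c\<^sub>2 * (fst (snd x) \<bullet> fst (snd x) - fst (snd y) \<bullet> fst (snd y))
      + \<nu>/2 * (snd (snd x) \<bullet> snd (snd x) - snd (snd y) \<bullet> snd (snd y))"
      unfolding quad_def by (simp add: algebra_simps)
    also have "\<bar>\<dots>\<bar> \<le> 1/2 * \<bar>C (sym_part (elastic_strain x)) \<bullet> elastic_strain x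
        - C (sym_part (elastic_strain y)) \<bullet> elastic_strain y\<bar>
      + c\<^sub>2 * \<bar>fst (snd x) \<bullet> fst (snd x) - fst (snd y) \<bullet> fst (snd y)\<bar>
      + \<bar>\<nu>/2\<bar> * \<bar>snd (snd x) \<bullet> snd (snd x) - snd (snd y) \<bullet> snd (snd y)\<bar>"
    proof -
      have "\<bar>1/2 * a + c\<^sub>2 * b + \<nu>/2 * c\<bar> \<le> 1/2 * \<bar>a\<bar> + c\<^sub>2 * \<bar>b\<bar> + \<bar>\<nu>/2\<bar> * \<bar>c\<bar>" for a b c :: real
        using abs_triangle_ineq[of "1/2 * a + c\<^sub>2 * b" "\<nu>/2 * c"] abs_triangle_ineq[of "1/2 * a" "c\<^sub>2 * b"] c2
        unfolding abs_mult by simp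
      then show ?thesis .
    qed
    also have "\<dots> \<le> 1/2 * (K1 * ?n) + c\<^sub>2 * (K2 * ?n) + \<bar>\<nu>/2\<bar> * (K3 * ?n)"
      using K1(2)[of x y] K2(2)[of x y] K3(2)[of x y] c2
      by (intro add_mono mult_left_mono) (auto simp: mult.assoc)
    finally show ?thesis by (simp add: algebra_simps add_divide_distrib)
  qed
  moreover have "0 \<le> ?K" using K1 K2 K3 c2 by simp
  ultimately show thesis using that by blast
qed

lemma quad_parallelogram:
  "quad \<nu> ((1/2) *\<^sub>R (x + y)) = 1/2 * quad \<nu> x + 1/2 * quad \<nu> y - 1/4 * quad \<nu> (x - y)"
proof -
  have combine: "1/2 * p + c\<^sub>2 * q + \<nu>/2 * r = 1/2 * (1/2 * p1 + c\<^sub>2 * q1 + \<nu>/2 * r1)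
      + 1/2 * (1/2 * p2 + c\<^sub>2 * q2 + \<nu>/2 * r2) - 1/4 * (1/2 * p3 + c\<^sub>2 * q3 + \<nu>/2 * r3)"
    if "p = 1/2 * p1 + 1/2 * p2 - 1/4 * p3" "q = 1/2 * q1 + 1/2 * q2 - 1/4 * q3"
      "r = 1/2 * r1 + 1/2 * r2 - 1/4 * r3" for p q r p1 q1 r1 p2 q2 r2 p3 q3 r3 :: real
    unfolding that by (simp add: algebra_simps)
  show ?thesis
    unfolding quad_def
    by (rule combine[OF inner_linear_parallelogram[OF linear_stress linear_elastic_strain]
          inner_linear_parallelogram[OF linear_plastic linear_plastic]
          inner_linear_parallelogram[OF linear_plastic_gradient linear_plastic_gradient]])
qed

lemma quad_measurable [measurable]: "quad \<nu> \<in> borel_measurable borel"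
  unfolding quad_def
  by (intro borel_measurable_continuous_onI continuous_intros linear_continuous_on
      linear_conv_bounded_linear[THEN iffD1] linear_stress linear_elastic_strain)

lemma quad_zero: "quad \<nu> 0 = 0"
  using linear_0[OF linear_stress] linear_0[OF linear_elastic_strain] by (simp add: quad_def)

lemma quad_integrable:
  assumes "f \<in> L2 \<Omega> V"
  shows "integrable M (\<lambda>x. quad \<nu> (f x))"
proof -
  obtain K where K: "0 \<le> K" "\<And>x y. \<bar>quad \<nu> x - quad \<nu> y\<bar> \<le> K * norm (x - y) * (norm x + norm y)"
    using quad_diff_bound by metis
  have [measurable]: "f \<in> borel_measurable M" by (rule L2_measurable[OF assms])
  show ?thesis
  proof (rule Bochner_Integration.integrable_bound)
    show "integrable M (\<lambda>x. K * (norm (f x))\<^sup>2)" using L2_square_integrable[OF assms] by simp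
    show "AE x in M. norm (quad \<nu> (f x)) \<le> norm (K * (norm (f x))\<^sup>2)"
      using K(2)[of "f _" 0] K(1) by (simp add: quad_zero power2_eq_square mult.assoc)
  qed simp
qed

text \<open>The pointwise bound by difference times size integrates by Cauchy-Schwarz; this makes
  the quadratic energy continuous in the norm of states.\<close>

lemma quad_integral_diff:
  obtains K where "0 \<le> K" "\<And>f g V W. f \<in> L2 \<Omega> V \<Longrightarrow> g \<in> L2 \<Omega> W \<Longrightarrow>
    \<bar>(LINT x|M. quad \<nu> (f x)) - (LINT x|M. quad \<nu> (g x))\<bar>
      \<le> K * L2_norm \<Omega> (\<lambda>x. f x - g x) * (L2_norm \<Omega> f + L2_norm \<Omega> g)"
proof -
  obtain K where K: "0 \<le> K" "\<And>x y. \<bar>quad \<nu> x - quad \<nu> y\<bar> \<le> K * norm (x - y) * (norm x + norm y)"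
    using quad_diff_bound by metis
  have "\<bar>(LINT x|M. quad \<nu> (f x)) - (LINT x|M. quad \<nu> (g x))\<bar>
      \<le> K * L2_norm \<Omega> (\<lambda>x. f x - g x) * (L2_norm \<Omega> f + L2_norm \<Omega> g)"
    if f: "f \<in> L2 \<Omega> V" and g: "g \<in> L2 \<Omega> W" for f g V W
  proof -
    have d: "(\<lambda>x. f x - g x) \<in> L2 \<Omega> UNIV" by (rule L2_diff[OF f g]) simp
    note p = L2_product[OF d f] L2_product[OF d g]
    have "\<bar>(LINT x|M. quad \<nu> (f x)) - (LINT x|M. quad \<nu> (g x))\<bar> = \<bar>LINT x|M. quad \<nu> (f x) - quad \<nu> (g x)\<bar>"
      using quad_integrable[OF f] quad_integrable[OF g] by simp
    also have "\<dots> \<le> (LINT x|M. \<bar>quad \<nu> (f x) - quad \<nu> (g x)\<bar>)"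
      by (rule integral_abs_bound)
    also have "\<dots> \<le> (LINT x|M. K * (norm (f x - g x) * norm (f x)) + K * (norm (f x - g x) * norm (g x)))"
    proof (rule integral_mono)
      show "integrable M (\<lambda>x. \<bar>quad \<nu> (f x) - quad \<nu> (g x)\<bar>)"
        using quad_integrable[OF f] quad_integrable[OF g] by simp
      show "\<bar>quad \<nu> (f x) - quad \<nu> (g x)\<bar> \<le> K * (norm (f x - g x) * norm (f x)) + K * (norm (f x - g x) * norm (g x))" for x
        using K(2)[of "f x" "g x"] by (simp add: algebra_simps)
    qed (use p in simp)
    also have "\<dots> = K * (LINT x|M. norm (f x - g x) * norm (f x)) + K * (LINT x|M. norm (f x - g x) * norm (g x))"
      using p by simp
    also have "\<dots> \<le> K * (L2_norm \<Omega> (\<lambda>x. f x - g x) * L2_norm \<Omega> f) + K * (L2_norm \<Omega> (\<lambda>x. f x - g x) * L2_norm \<Omega> g)"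
      using p K(1) by (intro add_mono mult_left_mono) auto
    finally show ?thesis by (simp add: algebra_simps)
  qed
  then show thesis using that K(1) by blast
qed

definition Q :: "real \<Rightarrow> state \<Rightarrow> real"
  where "Q \<nu> y = (LINT x|M. quad \<nu> (Y_jet \<nu> y x))"

lemma Y_norm_triangle:
  assumes "y \<in> Y_space \<Omega> \<nu>" "y' \<in> Y_space \<Omega> \<nu>"
  shows "Y_norm \<Omega> \<nu> y \<le> Y_norm \<Omega> \<nu> (y - y') + Y_norm \<Omega> \<nu> y'"
  using L2_norm_triangle_diff[OF Y_jet_L2[OF assms(1)] Y_jet_L2[OF assms(2)] L2_const[of 0 UNIV]]
  by (simp add: Y_norm_diff[OF assms] Y_norm_eq assms)

lemma Q_tendsto:
  assumes X: "\<And>n. X n \<in> Y_space \<Omega> \<nu>" and y: "y \<in> Y_space \<Omega> \<nu>"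
    and lim: "(\<lambda>n. Y_norm \<Omega> \<nu> (X n - y)) \<longlonglongrightarrow> 0"
  shows "(\<lambda>n. Q \<nu> (X n)) \<longlonglongrightarrow> Q \<nu> y"
proof -
  obtain K where K: "0 \<le> K" "\<And>f g V W. f \<in> L2 \<Omega> V \<Longrightarrow> g \<in> L2 \<Omega> W \<Longrightarrow>
    \<bar>(LINT x|M. quad \<nu> (f x)) - (LINT x|M. quad \<nu> (g x))\<bar>
      \<le> K * L2_norm \<Omega> (\<lambda>x. f x - g x) * (L2_norm \<Omega> f + L2_norm \<Omega> g)"
    by (rule quad_integral_diff) blast
  let ?d = "\<lambda>n. Y_norm \<Omega> \<nu> (X n - y)"
  have bound: "\<bar>Q \<nu> (X n) - Q \<nu> y\<bar> \<le> K * ?d n * (?d n + 2 * Y_norm \<Omega> \<nu> y)" for n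
  proof -
    have "\<bar>Q \<nu> (X n) - Q \<nu> y\<bar> \<le> K * ?d n * (Y_norm \<Omega> \<nu> (X n) + Y_norm \<Omega> \<nu> y)"
      using K(2)[OF Y_jet_L2[OF X[of n]] Y_jet_L2[OF y]]
      by (simp add: Q_def Y_norm_diff[OF X y] Y_norm_eq[OF X] Y_norm_eq[OF y])
    also have "\<dots> \<le> K * ?d n * (?d n + 2 * Y_norm \<Omega> \<nu> y)"
      using Y_norm_triangle[OF X[of n] y] K(1) by (intro mult_left_mono) auto
    finally show ?thesis .
  qed
  have "(\<lambda>n. K * ?d n * (?d n + 2 * Y_norm \<Omega> \<nu> y)) \<longlonglongrightarrow> K * 0 * (0 + 2 * Y_norm \<Omega> \<nu> y)"
    by (intro tendsto_mult tendsto_add tendsto_const lim)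
  then have null: "(\<lambda>n. K * ?d n * (?d n + 2 * Y_norm \<Omega> \<nu> y)) \<longlonglongrightarrow> 0" by simp
  have "(\<lambda>n. Q \<nu> (X n) - Q \<nu> y) \<longlonglongrightarrow> 0"
    by (rule Lim_null_comparison[OF always_eventually null]) (use bound in simp)
  then show ?thesis by (simp add: LIM_zero_iff)
qed

text \<open>The pointwise parallelogram identity, integrated; it holds almost everywhere because
  jets are linear only there.\<close>

lemma Q_mid:
  assumes "x \<in> Y_space \<Omega> \<nu>" "y \<in> Y_space \<Omega> \<nu>"
  shows "Q \<nu> ((1/2) *\<^sub>R (x + y)) = 1/2 * Q \<nu> x + 1/2 * Q \<nu> y - 1/4 * Q \<nu> (x - y)"
proof -
  note J = Y_jet_L2[OF assms(1)] Y_jet_L2[OF assms(2)]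
  have d: "x - y \<in> Y_space \<Omega> \<nu>" "(1/2) *\<^sub>R (x + y) \<in> Y_space \<Omega> \<nu>"
    using assms Y_space_subspace by (auto intro: subspace_diff subspace_scale subspace_add)
  have [measurable]: "Y_jet \<nu> x \<in> borel_measurable M" "Y_jet \<nu> y \<in> borel_measurable M"
    "Y_jet \<nu> (x - y) \<in> borel_measurable M" "Y_jet \<nu> ((1/2) *\<^sub>R (x + y)) \<in> borel_measurable M"
    using J[THEN L2_measurable] Y_jet_L2[OF d(1), THEN L2_measurable] Y_jet_L2[OF d(2), THEN L2_measurable] by auto
  have i: "integrable M (\<lambda>t. quad \<nu> (Y_jet \<nu> x t))" "integrable M (\<lambda>t. quad \<nu> (Y_jet \<nu> y t))"
    "integrable M (\<lambda>t. quad \<nu> (Y_jet \<nu> (x - y) t))"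
    using quad_integrable[OF J(1)] quad_integrable[OF J(2)] quad_integrable[OF Y_jet_L2[OF d(1)]] by auto
  have "AE t in M. quad \<nu> (Y_jet \<nu> ((1/2) *\<^sub>R (x + y)) t) = 1/2 * quad \<nu> (Y_jet \<nu> x t)
      + 1/2 * quad \<nu> (Y_jet \<nu> y t) - 1/4 * quad \<nu> (Y_jet \<nu> (x - y) t)"
    using Y_linear(2)[OF assms, of "1/2" "1/2"] Y_linear(2)[OF assms, of 1 "-1"]
  proof eventually_elim
    case (elim t)
    then show ?case
      using quad_parallelogram[of \<nu> "Y_jet \<nu> x t" "Y_jet \<nu> y t"] by (simp add: scaleR_add_right)
  qed
  then have "Q \<nu> ((1/2) *\<^sub>R (x + y)) = (LINT t|M. 1/2 * quad \<nu> (Y_jet \<nu> x t)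
      + 1/2 * quad \<nu> (Y_jet \<nu> y t) - 1/4 * quad \<nu> (Y_jet \<nu> (x - y) t))"
    unfolding Q_def by (intro integral_cong_AE) simp_all
  also have "\<dots> = 1/2 * Q \<nu> x + 1/2 * Q \<nu> y - 1/4 * Q \<nu> (x - y)"
    unfolding Q_def using i by simp
  finally show ?thesis .
qed

lemma strain_eq: "strain \<Omega> u x = sym_part (weak_gradient \<Omega> u x)"
  by (simp add: strain_def sym_part_def)

lemma strain_L2: "u \<in> H1 \<Omega> UNIV \<Longrightarrow> strain \<Omega> u \<in> L2 \<Omega> UNIV"
  unfolding strain_eq[abs_def]
  by (rule L2_linear[OF weak_gradient(1) linear_conv_bounded_linear[THEN iffD1, OF linear_sym_part]])

lemma Z_dev: "y \<in> Y_space \<Omega> \<nu> \<Longrightarrow> x \<in> \<Omega> \<Longrightarrow> snd y x \<in> dev_mat"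
  using L2_in[OF Z_L2] by (auto simp: Y_space_iff)

lemma elastic_strain_jet: "elastic_strain (Y_jet \<nu> y x) = strain \<Omega> (fst y) x - snd y x"
  by (simp add: elastic_strain_def Y_jet_def jet_def Z_jet_def strain_eq)

lemma elastic_strain_sym:
  assumes "y \<in> Y_space \<Omega> \<nu>" "x \<in> \<Omega>"
  shows "strain \<Omega> (fst y) x - snd y x \<in> sym_mat"
  using sym_part_in Z_dev[OF assms] dev_mat_sub_sym_mat subspace_diff[OF subspace_sym_mat]
  by (auto simp: strain_eq)

lemma quad_jet:
  assumes "y \<in> Y_space \<Omega> \<nu>" "x \<in> \<Omega>"
  shows "quad \<nu>' (Y_jet \<nu> y x) = 1/2 * (C (strain \<Omega> (fst y) x - snd y x) \<bullet> (strain \<Omega> (fst y) x - snd y x))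
    + (c\<^sub>2 * (norm (snd y x))\<^sup>2 + \<nu>'/2 * (norm (snd (Z_jet \<nu> (snd y) x)))\<^sup>2)"
  unfolding quad_def elastic_strain_jet sym_part_id[OF elastic_strain_sym[OF assms]]
  by (simp add: Y_jet_def power2_norm_eq_inner) (simp add: Z_jet_def)

lemma quad_lower_bound:
  assumes "0 \<le> \<nu>"
  obtains \<mu> where "0 < \<mu>" "\<And>y x. y \<in> Y_space \<Omega> \<nu> \<Longrightarrow> x \<in> \<Omega> \<Longrightarrow>
    \<mu> * ((norm (strain \<Omega> (fst y) x))\<^sup>2 + (norm (Z_jet \<nu> (snd y) x))\<^sup>2) \<le> quad \<nu> (Y_jet \<nu> y x)"
proof -
  obtain \<kappa> where \<kappa>: "0 < \<kappa>" "\<And>a. a \<in> sym_mat \<Longrightarrow> \<kappa> * (norm a)\<^sup>2 \<le> C a \<bullet> a"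
    using elasticity_tensor_coercive[OF elasticity] by metis
  \<comment> \<open>The strain is the elastic strain plus \<open>z\<close>, so its square costs
    twice each square. The elastic share \<open>2 * \<mu>\<close> must fit into
    \<open>\<kappa>/2\<close> and the share \<open>3 * \<mu>\<close> of \<open>z\<close> into
    \<open>c\<^sub>2\<close>. Without a gradient term the last bound is a dummy 1.\<close>
  define \<mu> where "\<mu> = min (min (\<kappa>/4) (c\<^sub>2/3)) (if \<nu> > 0 then \<nu>/2 else 1)"
  have \<mu>: "0 < \<mu>" "\<mu> \<le> \<kappa>/4" "\<mu> \<le> c\<^sub>2/3" using \<kappa> c2 by (auto simp: \<mu>_def)
  have "\<mu> * ((norm (strain \<Omega> (fst y) x))\<^sup>2 + (norm (Z_jet \<nu> (snd y) x))\<^sup>2) \<le> quad \<nu> (Y_jet \<nu> y x)"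
    if y: "y \<in> Y_space \<Omega> \<nu>" "x \<in> \<Omega>" for y x
  proof -
    let ?s = "strain \<Omega> (fst y) x" and ?z = "snd y x" and ?g = "snd (Z_jet \<nu> (snd y) x)"
    let ?e = "?s - ?z"
    have "(norm ?s)\<^sup>2 \<le> (norm ?e + norm ?z)\<^sup>2"
      using norm_triangle_ineq[of ?e ?z] by (intro power_mono) auto
    also have "\<dots> \<le> 2 * (norm ?e)\<^sup>2 + 2 * (norm ?z)\<^sup>2"
      using sum_squares_bound[of "norm ?e" "norm ?z"] by (simp add: power2_sum)
    finally have 1: "\<mu> * (norm ?s)\<^sup>2 \<le> \<mu> * (2 * (norm ?e)\<^sup>2 + 2 * (norm ?z)\<^sup>2)"
      using \<mu>(1) by (intro mult_left_mono) auto
    have 2: "\<mu> * (norm ?e)\<^sup>2 \<le> \<kappa>/4 * (norm ?e)\<^sup>2" "\<mu> * (norm ?z)\<^sup>2 \<le> c\<^sub>2/3 * (norm ?z)\<^sup>2"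
      using mult_right_mono[OF \<mu>(2), of "(norm ?e)\<^sup>2"] mult_right_mono[OF \<mu>(3), of "(norm ?z)\<^sup>2"] by simp_all
    have 3: "\<mu> * (norm ?g)\<^sup>2 \<le> \<nu>/2 * (norm ?g)\<^sup>2"
    proof (cases "\<nu> > 0")
      case True
      then have "\<mu> \<le> \<nu>/2" by (simp add: \<mu>_def)
      then show ?thesis by (rule mult_right_mono) simp
    qed (use assms in \<open>simp add: Z_jet_def\<close>)
    have n: "(norm (Z_jet \<nu> (snd y) x))\<^sup>2 = (norm ?z)\<^sup>2 + (norm ?g)\<^sup>2"
      by (simp add: Z_jet_def norm_Pair)
    have "\<mu> * ((norm ?s)\<^sup>2 + (norm (Z_jet \<nu> (snd y) x))\<^sup>2)
        = \<mu> * (norm ?s)\<^sup>2 + \<mu> * (norm ?z)\<^sup>2 + \<mu> * (norm ?g)\<^sup>2"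
      unfolding n by (simp only: distrib_left add.assoc)
    also have "\<dots> \<le> 1/2 * (\<kappa> * (norm ?e)\<^sup>2) + (c\<^sub>2 * (norm ?z)\<^sup>2 + \<nu>/2 * (norm ?g)\<^sup>2)"
      using 1 2 3 unfolding distrib_left by linarith
    also have "\<dots> \<le> quad \<nu> (Y_jet \<nu> y x)"
      unfolding quad_jet[OF y] using \<kappa>(2)[OF elastic_strain_sym[OF y]] by simp
    finally show ?thesis .
  qed
  then show thesis using that \<mu>(1) by blast
qed

lemma Q_lower_bound:
  assumes "0 \<le> \<nu>"
  obtains \<mu> where "0 < \<mu>" "\<And>y. y \<in> Y_space \<Omega> \<nu> \<Longrightarrow>
    \<mu> * ((L2_norm \<Omega> (strain \<Omega> (fst y)))\<^sup>2 + (Z_norm \<Omega> \<nu> (snd y))\<^sup>2) \<le> Q \<nu> y"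
proof -
  obtain \<mu> where \<mu>: "0 < \<mu>" "\<And>y x. y \<in> Y_space \<Omega> \<nu> \<Longrightarrow> x \<in> \<Omega> \<Longrightarrow>
    \<mu> * ((norm (strain \<Omega> (fst y) x))\<^sup>2 + (norm (Z_jet \<nu> (snd y) x))\<^sup>2) \<le> quad \<nu> (Y_jet \<nu> y x)"
    using quad_lower_bound[OF assms] by metis
  have "\<mu> * ((L2_norm \<Omega> (strain \<Omega> (fst y)))\<^sup>2 + (Z_norm \<Omega> \<nu> (snd y))\<^sup>2) \<le> Q \<nu> y" if y: "y \<in> Y_space \<Omega> \<nu>" for y
  proof -
    have u: "fst y \<in> H1 \<Omega> UNIV" "snd y \<in> Z_space \<Omega> \<nu>" using y by (auto simp: Y_space_iff)
    note i = L2_square_integrable[OF strain_L2[OF u(1)]] L2_square_integrable[OF Z_jet_L2[OF u(2)]]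
    have "\<mu> * ((L2_norm \<Omega> (strain \<Omega> (fst y)))\<^sup>2 + (Z_norm \<Omega> \<nu> (snd y))\<^sup>2)
        = (LINT x|M. \<mu> * ((norm (strain \<Omega> (fst y) x))\<^sup>2 + (norm (Z_jet \<nu> (snd y) x))\<^sup>2))"
      unfolding Z_norm_eq[OF u(2)] L2_norm_power2 using i by simp
    also have "\<dots> \<le> Q \<nu> y"
      unfolding Q_def
    proof (rule integral_mono)
      show "integrable M (\<lambda>x. quad \<nu> (Y_jet \<nu> y x))" by (rule quad_integrable[OF Y_jet_L2[OF y]])
    qed (use i \<mu>(2)[OF y] in auto)
    finally show ?thesis .
  qed
  then show thesis using that \<mu>(1) by blast
qed

lemma Q_nonneg: "0 \<le> \<nu> \<Longrightarrow> y \<in> Y_space \<Omega> \<nu> \<Longrightarrow> 0 \<le> Q \<nu> y"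
proof -
  assume "0 \<le> \<nu>" and y: "y \<in> Y_space \<Omega> \<nu>"
  then obtain \<mu> where \<mu>: "0 < \<mu>" "\<And>y. y \<in> Y_space \<Omega> \<nu> \<Longrightarrow>
    \<mu> * ((L2_norm \<Omega> (strain \<Omega> (fst y)))\<^sup>2 + (Z_norm \<Omega> \<nu> (snd y))\<^sup>2) \<le> Q \<nu> y"
    using Q_lower_bound by metis
  have "0 \<le> \<mu> * ((L2_norm \<Omega> (strain \<Omega> (fst y)))\<^sup>2 + (Z_norm \<Omega> \<nu> (snd y))\<^sup>2)" using \<mu>(1) by simp
  then show ?thesis using \<mu>(2)[OF y] by linarith
qed

text \<open>With trace 0 the boundary integral drops out of Korn's inequality and the strain alone
  controls the full norm.\<close>

lemma korn_zero_trace: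
  assumes "u \<in> H1 \<Omega> UNIV" "zero_trace \<Gamma> u"
  shows "c\<^sub>0 * (H1_norm \<Omega> u)\<^sup>2 \<le> (L2_norm \<Omega> (strain \<Omega> u))\<^sup>2"
  using korn[unfolded korn_inequality_def, rule_format, OF assms] by simp

text \<open>The elastic form controls strain and plastic variable, and Korn's inequality upgrades
  the strain to the full gradient. The constant depends on \<open>\<nu>\<close>, but on neither h
  nor \<rho>.\<close>

lemma Q_coercive:
  assumes "0 \<le> \<nu>"
  obtains \<alpha> where "0 < \<alpha>" "\<And>y h. y \<in> directions \<nu> h \<Longrightarrow> \<alpha> * (Y_norm \<Omega> \<nu> y)\<^sup>2 \<le> Q \<nu> y"
proof -
  obtain \<mu> where \<mu>: "0 < \<mu>" "\<And>y. y \<in> Y_space \<Omega> \<nu> \<Longrightarrow>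
    \<mu> * ((L2_norm \<Omega> (strain \<Omega> (fst y)))\<^sup>2 + (Z_norm \<Omega> \<nu> (snd y))\<^sup>2) \<le> Q \<nu> y"
    using Q_lower_bound[OF assms] by metis
  let ?m = "min c\<^sub>0 1"
  have "(\<mu> * ?m) * (Y_norm \<Omega> \<nu> y)\<^sup>2 \<le> Q \<nu> y" if y: "y \<in> directions \<nu> h" for y h
  proof -
    have yY: "y \<in> Y_space \<Omega> \<nu>" and t: "zero_trace \<Gamma> (fst y)" using y by (auto simp: directions_def)
    then have u: "fst y \<in> H1 \<Omega> UNIV" by (simp add: Y_space_iff)
    have "?m * (Y_norm \<Omega> \<nu> y)\<^sup>2 = ?m * (H1_norm \<Omega> (fst y))\<^sup>2 + ?m * (Z_norm \<Omega> \<nu> (snd y))\<^sup>2"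
      by (simp add: Y_norm_def distrib_left)
    also have "\<dots> \<le> c\<^sub>0 * (H1_norm \<Omega> (fst y))\<^sup>2 + 1 * (Z_norm \<Omega> \<nu> (snd y))\<^sup>2"
      by (intro add_mono mult_right_mono) auto
    also have "\<dots> \<le> (L2_norm \<Omega> (strain \<Omega> (fst y)))\<^sup>2 + (Z_norm \<Omega> \<nu> (snd y))\<^sup>2"
      using korn_zero_trace[OF u t] by simp
    finally have "\<mu> * (?m * (Y_norm \<Omega> \<nu> y)\<^sup>2) \<le> \<mu> * ((L2_norm \<Omega> (strain \<Omega> (fst y)))\<^sup>2 + (Z_norm \<Omega> \<nu> (snd y))\<^sup>2)"
      using \<mu>(1) by (intro mult_left_mono) auto
    also have "\<dots> \<le> Q \<nu> y" by (rule \<mu>(2)[OF yY])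
    finally show ?thesis by (simp only: mult.assoc)
  qed
  moreover have "0 < \<mu> * ?m" using \<mu>(1) c0 by simp
  ultimately show thesis using that by blast
qed

section \<open>Load and dissipation\<close>

lemma load_add: "u \<in> H1 \<Omega> UNIV \<Longrightarrow> v \<in> H1 \<Omega> UNIV \<Longrightarrow> \<l> (u + v) = \<l> u + \<l> v"
  and load_scale: "u \<in> H1 \<Omega> UNIV \<Longrightarrow> \<l> (c *\<^sub>R u) = c * \<l> u"
  using load by (simp_all add: dual_space_def)

lemma load_bounded: obtains K where "0 \<le> K" "\<And>u. u \<in> H1 \<Omega> UNIV \<Longrightarrow> \<bar>\<l> u\<bar> \<le> K * H1_norm \<Omega> u"
proof -
  obtain K where K: "\<forall>u\<in>H1 \<Omega> UNIV. \<bar>\<l> u\<bar> \<le> K * H1_norm \<Omega> u" using load by (auto simp: dual_space_def)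
  have "\<bar>\<l> u\<bar> \<le> \<bar>K\<bar> * H1_norm \<Omega> u" if "u \<in> H1 \<Omega> UNIV" for u
  proof -
    have "K * H1_norm \<Omega> u \<le> \<bar>K\<bar> * H1_norm \<Omega> u" by (intro mult_right_mono) auto
    then show ?thesis using K that order_trans by blast
  qed
  then show thesis using that[of "\<bar>K\<bar>"] by simp
qed

lemma load_diff:
  assumes "u \<in> H1 \<Omega> UNIV" "v \<in> H1 \<Omega> UNIV"
  shows "\<l> u - \<l> v = \<l> (u - v)"
  using load_add[OF H1_diff[OF assms subspace_UNIV] assms(2)] by simp

text \<open>Nothing is known of \<open>D\<close> off \<open>dev_mat\<close>; its cut-off by 0 is
  Borel, being continuous on a closed subspace, and the arguments take values in that
  subspace.\<close>

lemma dissipation_measurable: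
  assumes "w \<in> L2 \<Omega> dev_mat"
  shows "(\<lambda>x. D (w x)) \<in> borel_measurable M"
proof -
  obtain L where L: "0 \<le> L" "\<And>a b. a \<in> dev_mat \<Longrightarrow> b \<in> dev_mat \<Longrightarrow> \<bar>D a - D b\<bar> \<le> L * norm (a - b)"
    using dissipation_density_lipschitz[OF D] by metis
  have "L-lipschitz_on dev_mat D"
    using L by (intro lipschitz_onI) (auto simp: dist_norm)
  then have "continuous_on dev_mat D" by (rule lipschitz_on_continuous_on)
  then have "(\<lambda>a. if a \<in> dev_mat then D a else 0) \<in> borel_measurable borel"
    using closed_subspace[OF subspace_dev_mat]
    by (intro borel_measurable_continuous_on_if) (auto intro: borel_closed)
  from measurable_compose[OF L2_measurable[OF assms] this]
  show ?thesis
    by (rule measurable_cong[THEN iffD1, rotated]) (simp add: L2_in[OF assms])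
qed

lemma dissipation_integrable:
  assumes "w \<in> L2 \<Omega> dev_mat"
  shows "integrable M (\<lambda>x. D (w x))"
proof -
  obtain L where L: "0 \<le> L" "\<And>a b. a \<in> dev_mat \<Longrightarrow> b \<in> dev_mat \<Longrightarrow> \<bar>D a - D b\<bar> \<le> L * norm (a - b)"
    using dissipation_density_lipschitz[OF D] by metis
  have z: "0 \<in> dev_mat" by (rule subspace_0[OF subspace_dev_mat])
  have "D (0 *\<^sub>R 0) = 0 * D 0" using D z unfolding dissipation_density_def by blast
  then have D0: "D 0 = 0" by simp
  show ?thesis
  proof (rule Bochner_Integration.integrable_bound)
    show "integrable M (\<lambda>x. L * norm (w x))" using L2_integrable(1)[OF assms] by simp
    show "AE x in M. norm (D (w x)) \<le> norm (L * norm (w x))"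
      using L(2)[OF L2_in[OF assms] z] L(1) by (intro AE_I2) (simp add: D0)
  qed (rule dissipation_measurable[OF assms])
qed

abbreviation R :: "(real^3 \<Rightarrow> real^3^3) \<Rightarrow> real"
  where "R z \<equiv> dissipation \<Omega> D (z - zbar)"

lemma diff_zbar: "z \<in> Z_space \<Omega> \<nu> \<Longrightarrow> (\<lambda>x. z x - zbar x) \<in> L2 \<Omega> dev_mat"
  by (rule L2_diff[OF Z_L2 zbar]) (auto intro: subspace_diff[OF subspace_dev_mat])

lemma R_eq: "R z = (LINT x|M. D (z x - zbar x))"
  by (simp add: dissipation_def)

lemma R_nonneg:
  assumes "z \<in> Z_space \<Omega> \<nu>"
  shows "0 \<le> R z"
proof -
  have "\<forall>a\<in>dev_mat. 0 \<le> D a" using D by (simp add: dissipation_density_def)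
  then show ?thesis
    unfolding R_eq using L2_in[OF diff_zbar[OF assms]] by (intro integral_nonneg_AE AE_I2) simp
qed

lemma R_diff_bound:
  obtains K where "0 \<le> K" "\<And>z z' \<nu>. z \<in> Z_space \<Omega> \<nu> \<Longrightarrow> z' \<in> Z_space \<Omega> \<nu> \<Longrightarrow>
    \<bar>R z - R z'\<bar> \<le> K * L2_norm \<Omega> (\<lambda>x. z x - z' x)"
proof -
  obtain L where L: "0 \<le> L" "\<And>a b. a \<in> dev_mat \<Longrightarrow> b \<in> dev_mat \<Longrightarrow> \<bar>D a - D b\<bar> \<le> L * norm (a - b)"
    using dissipation_density_lipschitz[OF D] by metis
  let ?K = "L * sqrt (measure lebesgue \<Omega>)"
  have "\<bar>R z - R z'\<bar> \<le> ?K * L2_norm \<Omega> (\<lambda>x. z x - z' x)"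
    if z: "z \<in> Z_space \<Omega> \<nu>" "z' \<in> Z_space \<Omega> \<nu>" for z z' \<nu>
  proof -
    note w = diff_zbar[OF z(1)] diff_zbar[OF z(2)]
    note i = dissipation_integrable[OF w(1)] dissipation_integrable[OF w(2)]
    have d: "(\<lambda>x. z x - z' x) \<in> L2 \<Omega> UNIV" by (rule L2_diff[OF Z_L2[OF z(1)] Z_L2[OF z(2)]]) simp
    have "\<bar>R z - R z'\<bar> = \<bar>LINT x|M. D (z x - zbar x) - D (z' x - zbar x)\<bar>"
      unfolding R_eq using i by simp
    also have "\<dots> \<le> (LINT x|M. \<bar>D (z x - zbar x) - D (z' x - zbar x)\<bar>)"
      by (rule integral_abs_bound)
    also have "\<dots> \<le> (LINT x|M. L * norm (z x - z' x))"
    proof (rule integral_mono)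
      show "integrable M (\<lambda>x. L * norm (z x - z' x))" using L2_integrable(1)[OF d] by simp
      show "\<bar>D (z x - zbar x) - D (z' x - zbar x)\<bar> \<le> L * norm (z x - z' x)" if "x \<in> space M" for x
        using L(2)[OF L2_in[OF w(1)] L2_in[OF w(2)], of x x] that by simp
    qed (use i in simp)
    also have "\<dots> \<le> ?K * L2_norm \<Omega> (\<lambda>x. z x - z' x)"
      using mult_left_mono[OF L2_integrable(2)[OF d] L(1)] by (simp add: mult.assoc)
    finally show ?thesis .
  qed
  moreover have "0 \<le> ?K" using L(1) by simp
  ultimately show thesis using that by blast
qed

lemma R_mid:
  assumes z: "z \<in> Z_space \<Omega> \<nu>" "z' \<in> Z_space \<Omega> \<nu>"
  shows "R ((1/2) *\<^sub>R (z + z')) \<le> 1/2 * R z + 1/2 * R z'"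
proof -
  have m: "(1/2) *\<^sub>R (z + z') \<in> Z_space \<Omega> \<nu>"
    using Z_linear(1)[OF z, of "1/2" "1/2"] by (simp add: scaleR_add_right)
  note w = diff_zbar[OF z(1)] diff_zbar[OF z(2)]
  note i = dissipation_integrable[OF w(1)] dissipation_integrable[OF w(2)] dissipation_integrable[OF diff_zbar[OF m]]
  have hom: "\<And>a r. a \<in> dev_mat \<Longrightarrow> 0 \<le> r \<Longrightarrow> D (r *\<^sub>R a) = r * D a"
    and sub: "\<And>a b. a \<in> dev_mat \<Longrightarrow> b \<in> dev_mat \<Longrightarrow> D (a + b) \<le> D a + D b"
    using D unfolding dissipation_density_def by blast+
  have "R ((1/2) *\<^sub>R (z + z')) \<le> (LINT x|M. 1/2 * D (z x - zbar x) + 1/2 * D (z' x - zbar x))"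
    unfolding R_eq
  proof (rule integral_mono[OF i(3)])
    fix x assume "x \<in> space M"
    then have d: "z x - zbar x \<in> dev_mat" "z' x - zbar x \<in> dev_mat" using L2_in[OF w(1)] L2_in[OF w(2)] by auto
    have "((1/2) *\<^sub>R (z + z')) x - zbar x = (1/2) *\<^sub>R (z x - zbar x) + (1/2) *\<^sub>R (z' x - zbar x)"
      by (simp add: scaleR_fun_def scaleR_add_right scaleR_diff_right)
    then show "D (((1/2) *\<^sub>R (z + z')) x - zbar x) \<le> 1/2 * D (z x - zbar x) + 1/2 * D (z' x - zbar x)"
      using sub[of "(1/2) *\<^sub>R (z x - zbar x)" "(1/2) *\<^sub>R (z' x - zbar x)"] hom[OF d(1), of "1/2"] hom[OF d(2), of "1/2"]
        subspace_scale[OF subspace_dev_mat d(1)] subspace_scale[OF subspace_dev_mat d(2)] by simp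
  qed (use i in simp)
  also have "\<dots> = 1/2 * R z + 1/2 * R z'" unfolding R_eq using i by simp
  finally show ?thesis .
qed

section \<open>Splitting the energy into a finite and a penalty part\<close>

definition P :: "real \<Rightarrow> (real^3 \<Rightarrow> real^3^3) \<Rightarrow> ennreal"
  where "P \<rho> z = (\<integral>\<^sup>+x. pen \<rho> (z x) \<partial>M)"

text \<open>This part is finite and continuous on the space of states; infinite values can come only
  from \<open>P\<close>, which is independent of \<nu>.\<close>

definition F :: "real \<Rightarrow> state \<Rightarrow> real"
  where "F \<nu> y = Q \<nu> y + R (snd y) - \<l> (fst y)"

text \<open>The quadratic terms in \<open>z\<close> and its gradient, which
  \<open>stored_energy\<close> places in the nonnegative integral, are finite and move into
  \<open>Q\<close>.\<close>

lemma energy_eq: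
  assumes y: "y \<in> Y_space \<Omega> \<nu>" and "0 \<le> \<nu>" "0 \<le> \<rho>"
  shows "energy \<rho> \<nu> y = ereal (F \<nu> y) + enn2ereal (P \<rho> (snd y))"
proof -
  obtain u z where uz: "y = (u, z)" by (cases y)
  have u: "u \<in> H1 \<Omega> UNIV" and z: "z \<in> Z_space \<Omega> \<nu>" using y by (auto simp: uz Y_space_iff)
  let ?e = "\<lambda>x. strain \<Omega> u x - z x" and ?g = "\<lambda>x. snd (Z_jet \<nu> z x)"
  let ?q = "\<lambda>x. c\<^sub>2 * (norm (z x))\<^sup>2 + \<nu>/2 * (norm (?g x))\<^sup>2"
  have [measurable]: "z \<in> borel_measurable M" by (rule L2_measurable[OF Z_L2[OF z]])
  have gL: "?g \<in> L2 \<Omega> UNIV" by (rule L2_linear[OF Z_jet_L2[OF z] bounded_linear_snd])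
  have qi: "integrable M ?q"
    using L2_square_integrable[OF Z_L2[OF z]] L2_square_integrable[OF gL] by simp
  have [measurable]: "?q \<in> borel_measurable M" using qi by simp
  have eq: "quad \<nu> (Y_jet \<nu> y x) = 1/2 * (C (?e x) \<bullet> ?e x) + ?q x" if "x \<in> \<Omega>" for x
    using quad_jet[OF y that] by (simp add: uz)
  \<comment> \<open>Integrability of the elastic density is read off as the difference of
    \<open>quad\<close> and its plastic terms, both known to be integrable.\<close>
  have "integrable M (\<lambda>x. quad \<nu> (Y_jet \<nu> y x) - ?q x)"
    using quad_integrable[OF Y_jet_L2[OF y]] qi by (rule Bochner_Integration.integrable_diff)
  then have ci: "integrable M (\<lambda>x. 1/2 * (C (?e x) \<bullet> ?e x))"
    by (rule Bochner_Integration.integrable_cong[THEN iffD1, rotated 2]) (simp_all add: eq)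
  have "Q \<nu> y = (LINT x|M. 1/2 * (C (?e x) \<bullet> ?e x) + ?q x)"
    unfolding Q_def by (rule Bochner_Integration.integral_cong) (simp_all add: eq)
  also have "\<dots> = (LINT x|M. 1/2 * (C (?e x) \<bullet> ?e x)) + (LINT x|M. ?q x)"
    by (rule Bochner_Integration.integral_add[OF ci qi])
  finally have Q: "Q \<nu> y = 1/2 * (LINT x|M. C (?e x) \<bullet> ?e x) + (LINT x|M. ?q x)" by simp
  have q0: "0 \<le> ?q x" for x using c2 \<open>0 \<le> \<nu>\<close> by simp
  \<comment> \<open>The gradient slot of \<open>Z_jet\<close> is 0 for \<open>\<nu> = 0\<close>, so
    \<open>?q\<close> reproduces the case distinction.\<close>
  have "hardening c\<^sub>1 c\<^sub>2 c\<^sub>3 \<phi> \<rho> (z x) + (if \<nu> = 0 then 0 else ennreal (\<nu>/2 * (norm (weak_gradient \<Omega> z x))\<^sup>2))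
      = pen \<rho> (z x) + ennreal (?q x)" for x
    using \<open>0 \<le> \<nu>\<close> \<open>0 \<le> \<rho>\<close> c2 by (auto simp: hardening_eq Z_jet_def ennreal_plus add_ac)
  then have "(\<integral>\<^sup>+x. hardening c\<^sub>1 c\<^sub>2 c\<^sub>3 \<phi> \<rho> (z x)
      + (if \<nu> = 0 then 0 else ennreal (\<nu>/2 * (norm (weak_gradient \<Omega> z x))\<^sup>2)) \<partial>M)
      = (\<integral>\<^sup>+x. pen \<rho> (z x) + ennreal (?q x) \<partial>M)" by simp
  also have "\<dots> = P \<rho> z + (\<integral>\<^sup>+x. ennreal (?q x) \<partial>M)"
    unfolding P_def by (rule nn_integral_add) measurable
  also have "(\<integral>\<^sup>+x. ennreal (?q x) \<partial>M) = ennreal (LINT x|M. ?q x)"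
    by (rule nn_integral_eq_integral[OF qi AE_I2[OF q0]])
  finally have n: "(\<integral>\<^sup>+x. hardening c\<^sub>1 c\<^sub>2 c\<^sub>3 \<phi> \<rho> (z x)
      + (if \<nu> = 0 then 0 else ennreal (\<nu>/2 * (norm (weak_gradient \<Omega> z x))\<^sup>2)) \<partial>M)
      = P \<rho> z + ennreal (LINT x|M. ?q x)" .
  have "energy \<rho> \<nu> y = ereal (1/2 * (LINT x|M. C (?e x) \<bullet> ?e x))
      + enn2ereal (P \<rho> z + ennreal (LINT x|M. ?q x)) - ereal (\<l> u) + ereal (R z)"
    unfolding incremental_energy_def stored_energy_def uz prod.case n ..
  also have "\<dots> = ereal (1/2 * (LINT x|M. C (?e x) \<bullet> ?e x))
      + (enn2ereal (P \<rho> z) + ereal (LINT x|M. ?q x)) - ereal (\<l> u) + ereal (R z)"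
    unfolding plus_ennreal.rep_eq enn2ereal_ennreal[OF integral_nonneg_AE[OF AE_I2[OF q0]]] ..
  also have "\<dots> = ereal (F \<nu> y) + enn2ereal (P \<rho> (snd y))"
    unfolding F_def uz fst_conv snd_conv Q[unfolded uz] by (cases "enn2ereal (P \<rho> z)") auto
  finally show ?thesis .
qed

text \<open>Together with \<open>energy_leD\<close> this trades extended arithmetic for real levels:
  a bound on the energy is a bound on \<open>P\<close> by what the finite part leaves over.\<close>

lemma energy_leI:
  assumes "y \<in> Y_space \<Omega> \<nu>" "0 \<le> \<nu>" "0 \<le> \<rho>" "P \<rho> (snd y) \<le> ennreal p" "0 \<le> p" "F \<nu> y + p \<le> b"
  shows "energy \<rho> \<nu> y \<le> ereal b"
proof -
  have "enn2ereal (P \<rho> (snd y)) \<le> ereal p"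
    using assms(4,5) by (metis enn2ereal_ennreal less_eq_ennreal.rep_eq)
  then have "ereal (F \<nu> y) + enn2ereal (P \<rho> (snd y)) \<le> ereal (F \<nu> y) + ereal p"
    by (intro add_left_mono)
  also have "\<dots> \<le> ereal b" using assms(6) by simp
  finally show ?thesis unfolding energy_eq[OF assms(1-3)] .
qed

lemma energy_leD:
  assumes "y \<in> Y_space \<Omega> \<nu>" "0 \<le> \<nu>" "0 \<le> \<rho>" "energy \<rho> \<nu> y \<le> ereal b"
  shows "F \<nu> y \<le> b" "P \<rho> (snd y) \<le> ennreal (b - F \<nu> y)"
proof -
  have le: "ereal (F \<nu> y) + enn2ereal (P \<rho> (snd y)) \<le> ereal b" using assms energy_eq by simp
  show 1: "F \<nu> y \<le> b"
    using order_trans[OF ereal_le_add_self[of "enn2ereal (P \<rho> (snd y))" "ereal (F \<nu> y)"] le] by simp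
  show "P \<rho> (snd y) \<le> ennreal (b - F \<nu> y)"
  proof (cases "P \<rho> (snd y)")
    case (real p)
    then show ?thesis using le by (simp add: enn2ereal_ennreal ennreal_leI)
  next
    case top
    then show ?thesis using le by simp
  qed
qed

lemma F_tendsto:
  assumes X: "\<And>n. X n \<in> Y_space \<Omega> \<nu>" and y: "y \<in> Y_space \<Omega> \<nu>"
    and lim: "(\<lambda>n. Y_norm \<Omega> \<nu> (X n - y)) \<longlonglongrightarrow> 0"
  shows "(\<lambda>n. F \<nu> (X n)) \<longlonglongrightarrow> F \<nu> y"
proof -
  have XY: "fst (X n) \<in> H1 \<Omega> UNIV" "snd (X n) \<in> Z_space \<Omega> \<nu>" for n using X[of n] by (auto simp: Y_space_iff)
  have yY: "fst y \<in> H1 \<Omega> UNIV" "snd y \<in> Z_space \<Omega> \<nu>" using y by (auto simp: Y_space_iff)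
  obtain K where K: "0 \<le> K" "\<And>u. u \<in> H1 \<Omega> UNIV \<Longrightarrow> \<bar>\<l> u\<bar> \<le> K * H1_norm \<Omega> u" using load_bounded by metis
  obtain L where L: "0 \<le> L" "\<And>z z' \<nu>. z \<in> Z_space \<Omega> \<nu> \<Longrightarrow> z' \<in> Z_space \<Omega> \<nu> \<Longrightarrow>
    \<bar>R z - R z'\<bar> \<le> L * L2_norm \<Omega> (\<lambda>x. z x - z' x)" by (rule R_diff_bound) blast
  let ?d = "\<lambda>n. Y_norm \<Omega> \<nu> (X n - y)"
  have null: "(\<lambda>n. c * ?d n) \<longlonglongrightarrow> 0" for c using tendsto_mult[OF tendsto_const lim] by simp
  have "\<bar>\<l> (fst (X n)) - \<l> (fst y)\<bar> \<le> K * ?d n" for n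
  proof -
    have "\<bar>\<l> (fst (X n)) - \<l> (fst y)\<bar> \<le> K * H1_norm \<Omega> (fst (X n - y))"
      unfolding load_diff[OF XY(1) yY(1)] fst_diff
      by (rule K(2)[OF H1_diff[OF XY(1) yY(1) subspace_UNIV]])
    also have "\<dots> \<le> K * ?d n" by (intro mult_left_mono Y_norm_components K)
    finally show ?thesis .
  qed
  then have "(\<lambda>n. \<l> (fst (X n)) - \<l> (fst y)) \<longlonglongrightarrow> 0"
    by (intro Lim_null_comparison[OF always_eventually null[of K]]) simp
  then have l: "(\<lambda>n. \<l> (fst (X n))) \<longlonglongrightarrow> \<l> (fst y)" by (simp add: LIM_zero_iff)
  have "\<bar>R (snd (X n)) - R (snd y)\<bar> \<le> L * ?d n" for n
  proof -
    have "\<bar>R (snd (X n)) - R (snd y)\<bar> \<le> L * L2_norm \<Omega> (\<lambda>x. snd (X n) x - snd y x)"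
      by (rule L(2)[OF XY(2) yY(2)])
    also have "\<dots> \<le> L * ?d n"
      unfolding Y_norm_diff[OF X y]
    proof (intro mult_left_mono L(1) L2_norm_mono[OF L2_diff[OF Z_L2[OF XY(2)] Z_L2[OF yY(2)]] L2_diff[OF Y_jet_L2[OF X] Y_jet_L2[OF y]]])
      have "norm (snd (X n) x - snd y x) \<le> norm (Y_jet \<nu> (X n) x - Y_jet \<nu> y x)" for x
      proof -
        have eq: "snd (X n) x - snd y x = fst (snd (Y_jet \<nu> (X n) x - Y_jet \<nu> y x))"
          by (simp add: Y_jet_def Z_jet_def)
        show ?thesis
          unfolding eq
          using norm_fst_le[of "fst (snd (Y_jet \<nu> (X n) x - Y_jet \<nu> y x))" "snd (snd (Y_jet \<nu> (X n) x - Y_jet \<nu> y x))"]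
            norm_snd_le[of "snd (Y_jet \<nu> (X n) x - Y_jet \<nu> y x)" "fst (Y_jet \<nu> (X n) x - Y_jet \<nu> y x)"]
          unfolding prod.collapse by (rule order_trans)
      qed
      then show "AE x in M. norm (snd (X n) x - snd y x) \<le> norm (Y_jet \<nu> (X n) x - Y_jet \<nu> y x)" by simp
    qed auto
    finally show ?thesis .
  qed
  then have "(\<lambda>n. R (snd (X n)) - R (snd y)) \<longlonglongrightarrow> 0"
    by (intro Lim_null_comparison[OF always_eventually null[of L]]) simp
  then have r: "(\<lambda>n. R (snd (X n))) \<longlonglongrightarrow> R (snd y)" by (simp add: LIM_zero_iff)
  show ?thesis
    unfolding F_def by (intro tendsto_add tendsto_diff Q_tendsto[OF X y lim] r l)
qed

text \<open>The gain comes from \<open>Q\<close> alone; the dissipation is convex because it is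
  sublinear, and the load is linear.\<close>

lemma F_mid:
  assumes x: "x \<in> Y_space \<Omega> \<nu>" and y: "y \<in> Y_space \<Omega> \<nu>"
  shows "F \<nu> ((1/2) *\<^sub>R (x + y)) \<le> 1/2 * F \<nu> x + 1/2 * F \<nu> y - 1/4 * Q \<nu> (x - y)"
proof -
  have uz: "fst x \<in> H1 \<Omega> UNIV" "snd x \<in> Z_space \<Omega> \<nu>" "fst y \<in> H1 \<Omega> UNIV" "snd y \<in> Z_space \<Omega> \<nu>"
    using x y by (auto simp: Y_space_iff)
  have "fst x + fst y \<in> H1 \<Omega> UNIV"
    using H1_fun_linear(1)[OF uz(1,3) subspace_UNIV, of 1 1] by simp
  then have "\<l> ((1/2) *\<^sub>R (fst x + fst y)) = 1/2 * \<l> (fst x) + 1/2 * \<l> (fst y)"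
    by (simp add: load_scale load_add[OF uz(1,3)])
  then show ?thesis
    using Q_mid[OF x y] R_mid[OF uz(2,4)] by (simp add: F_def add_divide_distrib diff_divide_distrib)
qed

lemma P_mid:
  assumes x: "x \<in> Y_space \<Omega> \<nu>" and y: "y \<in> Y_space \<Omega> \<nu>" and "0 \<le> \<rho>"
  shows "2 * P \<rho> (snd ((1/2) *\<^sub>R (x + y))) \<le> P \<rho> (snd x) + P \<rho> (snd y)"
proof -
  have [measurable]: "snd x \<in> borel_measurable M" "snd y \<in> borel_measurable M"
    using x y by (auto simp: Y_space_iff intro: L2_measurable[OF Z_L2])
  have "2 * P \<rho> (snd ((1/2) *\<^sub>R (x + y))) = (\<integral>\<^sup>+t. 2 * pen \<rho> ((1/2) *\<^sub>R (snd x t + snd y t)) \<partial>M)"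
    unfolding P_def by (subst nn_integral_cmult[symmetric]) (simp_all add: scaleR_fun_def)
  also have "\<dots> \<le> (\<integral>\<^sup>+t. pen \<rho> (snd x t) + pen \<rho> (snd y t) \<partial>M)"
    by (intro nn_integral_mono pen_convex assms)
  also have "\<dots> = P \<rho> (snd x) + P \<rho> (snd y)"
    unfolding P_def by (rule nn_integral_add) measurable
  finally show ?thesis .
qed

lemma energy_convex:
  assumes x: "x \<in> Y_space \<Omega> \<nu>" and y: "y \<in> Y_space \<Omega> \<nu>" and nn: "0 \<le> \<nu>" "0 \<le> \<rho>"
    and le: "energy \<rho> \<nu> x \<le> ereal a" "energy \<rho> \<nu> y \<le> ereal b"
  shows "energy \<rho> \<nu> ((1/2) *\<^sub>R (x + y)) \<le> ereal ((a + b) / 2 - 1/4 * Q \<nu> (x - y))"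
proof (rule energy_leI[OF _ nn])
  \<comment> \<open>Each state leaves \<open>P\<close> its level minus its finite part, and the
    midpoint receives the mean of the two.\<close>
  let ?p = "((a - F \<nu> x) + (b - F \<nu> y)) / 2"
  note dx = energy_leD[OF x nn le(1)] and dy = energy_leD[OF y nn le(2)]
  show "(1/2) *\<^sub>R (x + y) \<in> Y_space \<Omega> \<nu>"
    using x y Y_space_subspace by (auto intro: subspace_scale subspace_add)
  show "0 \<le> ?p" using dx(1) dy(1) by simp
  have "2 * P \<rho> (snd ((1/2) *\<^sub>R (x + y))) \<le> ennreal (a - F \<nu> x) + ennreal (b - F \<nu> y)"
    using P_mid[OF x y nn(2)] dx(2) dy(2) by (meson add_mono order_trans)
  also have "\<dots> = 2 * ennreal ?p"
    using dx(1) dy(1) by (simp add: ennreal_two_mult flip: ennreal_plus)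
  finally show "P \<rho> (snd ((1/2) *\<^sub>R (x + y))) \<le> ennreal ?p"
    by (subst (asm) ennreal_mult_le_mult_iff) auto
  show "F \<nu> ((1/2) *\<^sub>R (x + y)) + ?p \<le> (a + b) / 2 - 1/4 * Q \<nu> (x - y)"
    using F_mid[OF x y] by (simp add: field_simps)
qed

lemma P_antimono: "0 \<le> \<sigma> \<Longrightarrow> \<sigma> \<le> \<rho> \<Longrightarrow> P \<rho> z \<le> P \<sigma> z"
  unfolding P_def by (intro nn_integral_mono pen_antimono)

lemma energy_antimono:
  assumes "y \<in> Y_space \<Omega> \<nu>" "0 \<le> \<nu>" "0 \<le> \<sigma>" "\<sigma> \<le> \<rho>"
  shows "energy \<rho> \<nu> y \<le> energy \<sigma> \<nu> y"
proof -
  have "enn2ereal (P \<rho> (snd y)) \<le> enn2ereal (P \<sigma> (snd y))"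
    using P_antimono[OF assms(3,4)] by (simp add: less_eq_ennreal.rep_eq)
  then show ?thesis using assms by (simp add: energy_eq add_left_mono)
qed

text \<open>The finite part converges. For the penalty, strong convergence yields a subsequence of
  jets converging almost everywhere, and pointwise lower semicontinuity with Fatou's lemma does the
  rest.\<close>

lemma energy_lsc:
  assumes X: "\<And>n. X n \<in> Y_space \<Omega> \<nu>" and y: "y \<in> Y_space \<Omega> \<nu>" and nn: "0 \<le> \<nu>" "0 \<le> \<rho>"
    and lim: "(\<lambda>n. Y_norm \<Omega> \<nu> (X n - y)) \<longlonglongrightarrow> 0"
    and le: "\<And>n. energy \<rho> \<nu> (X n) \<le> ereal b"
  shows "energy \<rho> \<nu> y \<le> ereal b"
proof -
  have F: "(\<lambda>n. F \<nu> (X n)) \<longlonglongrightarrow> F \<nu> y" by (rule F_tendsto[OF X y lim])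
  have Fb: "F \<nu> y \<le> b" by (rule LIMSEQ_le_const2[OF F]) (use energy_leD(1)[OF X nn le] in blast)
  have "(\<lambda>n. L2_norm \<Omega> (\<lambda>x. Y_jet \<nu> (X n) x - Y_jet \<nu> y x)) \<longlonglongrightarrow> 0"
    using lim by (simp only: Y_norm_diff[OF X y])
  from L2_converges_AE_subseq[OF Y_jet_L2[OF X] Y_jet_L2[OF y] this]
  obtain r where r: "strict_mono r" "AE x in M. (\<lambda>n. Y_jet \<nu> (X (r n)) x) \<longlonglongrightarrow> Y_jet \<nu> y x" by blast
  have [measurable]: "snd (X n) \<in> borel_measurable M" for n
    using X[of n] by (auto simp: Y_space_iff intro: L2_measurable[OF Z_L2])
  have "P \<rho> (snd y) \<le> (\<integral>\<^sup>+x. liminf (\<lambda>n. pen \<rho> (snd (X (r n)) x)) \<partial>M)"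
    unfolding P_def
  proof (rule nn_integral_mono_AE)
    show "AE x in M. pen \<rho> (snd y x) \<le> liminf (\<lambda>n. pen \<rho> (snd (X (r n)) x))"
      using r(2)
    proof eventually_elim
      case (elim x)
      have "(\<lambda>n. fst (snd (Y_jet \<nu> (X (r n)) x))) \<longlonglongrightarrow> fst (snd (Y_jet \<nu> y x))"
        by (intro tendsto_fst tendsto_snd elim)
      then show ?case by (intro pen_lsc nn) (simp add: Y_jet_def Z_jet_def)
    qed
  qed
  also have "\<dots> \<le> liminf (\<lambda>n. P \<rho> (snd (X (r n))))"
    unfolding P_def by (rule nn_integral_liminf) measurable
  also have "\<dots> \<le> liminf (\<lambda>n. ennreal (b - F \<nu> (X (r n))))"
    by (intro Liminf_mono always_eventually allI energy_leD(2)[OF X nn le])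
  also have "\<dots> = ennreal (b - F \<nu> y)"
  proof -
    have "(\<lambda>n. F \<nu> (X (r n))) \<longlonglongrightarrow> F \<nu> y"
      using LIMSEQ_subseq_LIMSEQ[OF F r(1)] by (simp add: o_def)
    then have "(\<lambda>n. ennreal (b - F \<nu> (X (r n)))) \<longlonglongrightarrow> ennreal (b - F \<nu> y)"
      by (intro tendsto_ennrealI tendsto_diff tendsto_const)
    then show ?thesis by (intro lim_imp_Liminf) simp_all
  qed
  finally show ?thesis by (rule energy_leI[OF y nn]) (use Fb in simp_all)
qed

text \<open>Fatou's lemma along parameters \<open>1 / real (Suc n)\<close>; the finite part does not
  depend on \<rho>, so all these problems leave the same bound for \<open>P\<close>.\<close>

lemma energy_sup:
  assumes y: "y \<in> Y_space \<Omega> \<nu>" and \<nu>: "0 \<le> \<nu>" and le: "\<And>\<rho>. 0 < \<rho> \<Longrightarrow> energy \<rho> \<nu> y \<le> ereal b"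
  shows "energy 0 \<nu> y \<le> ereal b"
proof -
  have [measurable]: "snd y \<in> borel_measurable M"
    using y by (auto simp: Y_space_iff intro: L2_measurable[OF Z_L2])
  have pos: "0 < 1 / real (Suc n)" for n by simp
  note d = energy_leD[OF y \<nu> less_imp_le[OF pos] le[OF pos]]
  have "P 0 (snd y) \<le> (\<integral>\<^sup>+x. liminf (\<lambda>n. pen (1 / real (Suc n)) (snd y x)) \<partial>M)"
    unfolding P_def by (intro nn_integral_mono pen_zero_le_liminf)
  also have "\<dots> \<le> liminf (\<lambda>n. P (1 / real (Suc n)) (snd y))"
    unfolding P_def by (rule nn_integral_liminf) measurable
  also have "\<dots> \<le> ennreal (b - F \<nu> y)"
    by (rule Liminf_le) (use d(2) in simp_all)
  finally show ?thesis by (rule energy_leI[OF y \<nu> order_refl]) (use d(1) in simp_all)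
qed

text \<open>The modulus is the coercivity constant times the factor 1/4 of the parallelogram
  identity. No constant depends on \<rho>, so all parameters share one family.\<close>

lemma energy_convex_family:
  assumes nn: "0 \<le> \<nu>" "0 \<le> h"
  obtains \<alpha> K B where
    "convex_family (adm \<nu> h) (Y_norm \<Omega> \<nu>) (\<lambda>\<rho>. energy \<rho> \<nu>) \<alpha> K B (uDir, 0)"
proof -
  obtain \<alpha> where \<alpha>: "0 < \<alpha>" "\<And>y h. y \<in> directions \<nu> h \<Longrightarrow> \<alpha> * (Y_norm \<Omega> \<nu> y)\<^sup>2 \<le> Q \<nu> y"
    using Q_coercive[OF nn(1)] by metis
  obtain K0 where K0: "0 \<le> K0" "\<And>u. u \<in> H1 \<Omega> UNIV \<Longrightarrow> \<bar>\<l> u\<bar> \<le> K0 * H1_norm \<Omega> u"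
    using load_bounded by metis
  \<comment> \<open>\<open>K\<close> serves both the norm of the load on the difference to
    \<open>uDir\<close> and its value at \<open>uDir\<close>; quadratic energy, dissipation and
    penalty are nonnegative.\<close>
  define K where "K = max K0 \<bar>\<l> uDir\<bar>"
  let ?y0 = "(uDir, 0) :: state"
  have y0: "?y0 \<in> adm \<nu> h" "?y0 \<in> Y_space \<Omega> \<nu>" using adm_uDir[OF nn] adm_sub by auto
  have "convex_family (adm \<nu> h) (Y_norm \<Omega> \<nu>) (\<lambda>\<rho>. energy \<rho> \<nu>) (\<alpha>/4) K (F \<nu> ?y0) ?y0"
  proof
    show "0 < \<alpha>/4" "0 \<le> K" using \<alpha>(1) K0(1) by (auto simp: K_def)
    show "0 \<le> Y_norm \<Omega> \<nu> x" for x by simp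
    show "?y0 \<in> adm \<nu> h" by (rule y0)
    show "Y_norm \<Omega> \<nu> ((1/2) *\<^sub>R (x + ?y0) - ?y0) \<le> Y_norm \<Omega> \<nu> (x - ?y0)" if x: "x \<in> adm \<nu> h" for x
    proof -
      have "(1/2) *\<^sub>R (x + ?y0) - ?y0 = (1/2) *\<^sub>R (x + ?y0) - (1/2) *\<^sub>R (?y0 + ?y0)"
        by (simp only: scaleR_half_double)
      also have "\<dots> = (1/2) *\<^sub>R (x - ?y0)" by (simp only: scaleR_diff_right[symmetric]) simp
      finally have eq: "(1/2) *\<^sub>R (x + ?y0) - ?y0 = (1/2) *\<^sub>R (x - ?y0)" .
      have "x - ?y0 \<in> Y_space \<Omega> \<nu>" using adm_sub[OF x] y0(2) by (rule subspace_diff[OF Y_space_subspace])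
      from Y_norm_scaleR[OF this, of "1/2"] show ?thesis
        unfolding eq using Y_norm_nonneg[of \<nu> "x - ?y0"] by linarith
    qed
    \<comment> \<open>At plastic strain 0 the penalty vanishes for every parameter, so one level
      bounds the reference state uniformly.\<close>
    show "energy \<rho> \<nu> ?y0 \<le> ereal (F \<nu> ?y0)" if "0 \<le> \<rho>" for \<rho>
      by (rule energy_leI[OF y0(2) nn(1) that, of 0]) (simp_all add: P_def pen_zero[OF that])
    show "(1/2) *\<^sub>R (x + y) \<in> adm \<nu> h" if "x \<in> adm \<nu> h" "y \<in> adm \<nu> h" for x y
      by (rule adm_mid[OF nn that])
    show "energy \<rho> \<nu> ((1/2) *\<^sub>R (x + y)) \<le> ereal ((a + b) / 2 - \<alpha>/4 * (Y_norm \<Omega> \<nu> (x - y))\<^sup>2)"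
      if "0 \<le> \<rho>" "x \<in> adm \<nu> h" "y \<in> adm \<nu> h" "energy \<rho> \<nu> x \<le> ereal a" "energy \<rho> \<nu> y \<le> ereal b" for \<rho> x y a b
    proof -
      have "energy \<rho> \<nu> ((1/2) *\<^sub>R (x + y)) \<le> ereal ((a + b) / 2 - 1/4 * Q \<nu> (x - y))"
        by (rule energy_convex[OF adm_sub[OF that(2)] adm_sub[OF that(3)] nn(1) that(1,4,5)])
      also have "\<dots> \<le> ereal ((a + b) / 2 - \<alpha>/4 * (Y_norm \<Omega> \<nu> (x - y))\<^sup>2)"
        using \<alpha>(2)[OF adm_diff[OF nn that(2,3)]] by simp
      finally show ?thesis .
    qed
    show "ereal (- K * Y_norm \<Omega> \<nu> (x - ?y0) - K) \<le> energy \<rho> \<nu> x" if "0 \<le> \<rho>" and x: "x \<in> adm \<nu> h" for \<rho> x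
    proof -
      have xY: "x \<in> Y_space \<Omega> \<nu>" by (rule adm_sub[OF x])
      then have u: "fst x \<in> H1 \<Omega> UNIV" "snd x \<in> Z_space \<Omega> \<nu>" by (auto simp: Y_space_iff)
      let ?N = "Y_norm \<Omega> \<nu> (x - ?y0)"
      have "\<l> (fst x) = \<l> uDir + \<l> (fst x - uDir)" using load_diff[OF u(1) uDir] by simp
      also have "\<dots> \<le> \<bar>\<l> uDir\<bar> + K0 * H1_norm \<Omega> (fst x - uDir)"
        using K0(2)[OF H1_diff[OF u(1) uDir subspace_UNIV]] by linarith
      also have "\<dots> \<le> K + K * ?N"
        using Y_norm_components(1)[of "x - ?y0" \<nu>] K0(1)
        by (intro add_mono mult_mono) (auto simp: K_def)
      finally have "- K * ?N - K \<le> F \<nu> x"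
        using Q_nonneg[OF nn(1) xY] R_nonneg[OF u(2)] by (simp add: F_def)
      then have "ereal (- K * ?N - K) \<le> ereal (F \<nu> x) + 0" by simp
      also have "\<dots> \<le> energy \<rho> \<nu> x"
        unfolding energy_eq[OF xY nn(1) that(1)] by (intro add_left_mono) simp
      finally show ?thesis .
    qed
    show "energy \<rho> \<nu> x \<le> energy \<sigma> \<nu> x" if "0 \<le> \<sigma>" "\<sigma> \<le> \<rho>" "x \<in> adm \<nu> h" for \<rho> \<sigma> x
      by (rule energy_antimono[OF adm_sub[OF that(3)] nn(1) that(1,2)])
    show "energy \<rho> \<nu> x \<le> ereal b"
      if "0 \<le> \<rho>" "\<And>n. X n \<in> adm \<nu> h" "x \<in> adm \<nu> h" "(\<lambda>n. Y_norm \<Omega> \<nu> (X n - x)) \<longlonglongrightarrow> 0"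
        "\<And>n. energy \<rho> \<nu> (X n) \<le> ereal b" for \<rho> X x b
      by (rule energy_lsc[OF adm_sub[OF that(2)] adm_sub[OF that(3)] nn(1) that(1,4,5)])
    show "energy 0 \<nu> x \<le> ereal b" if "x \<in> adm \<nu> h" "\<And>\<rho>. 0 < \<rho> \<Longrightarrow> energy \<rho> \<nu> x \<le> ereal b" for x b
      by (rule energy_sup[OF adm_sub[OF that(1)] nn(1) that(2)])
    show "\<exists>x\<in>adm \<nu> h. (\<lambda>n. Y_norm \<Omega> \<nu> (X n - x)) \<longlonglongrightarrow> 0"
      if "\<And>n. X n \<in> adm \<nu> h" "\<And>e. 0 < e \<Longrightarrow> \<exists>M. \<forall>m\<ge>M. \<forall>n\<ge>M. Y_norm \<Omega> \<nu> (X m - X n) < e" for X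
      by (rule adm_complete[OF nn that])
  qed
  then show thesis by (rule that)
qed

text \<open>Distance 0 means equal jets almost everywhere, and the jets contain \<open>u\<close> and
  \<open>z\<close> themselves.\<close>

lemma ae_unique_minimizer_energy:
  assumes nn: "0 \<le> \<nu>" "0 \<le> h" "0 \<le> \<rho>"
  shows "ae_unique_minimizer \<Omega> (energy \<rho> \<nu>) (adm \<nu> h)"
proof -
  obtain \<alpha> K B where "convex_family (adm \<nu> h) (Y_norm \<Omega> \<nu>) (\<lambda>\<rho>. energy \<rho> \<nu>) \<alpha> K B (uDir, 0)"
    using energy_convex_family[OF nn(1,2)] .
  then interpret fam: convex_family "adm \<nu> h" "Y_norm \<Omega> \<nu>" "\<lambda>\<rho>. energy \<rho> \<nu>" \<alpha> K B "(uDir, 0)" .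
  show ?thesis
    unfolding ae_unique_minimizer_def
  proof (intro conjI allI impI)
    show "\<exists>y. is_arg_min (energy \<rho> \<nu>) (\<lambda>y. y \<in> adm \<nu> h) y"
      using fam.minimizer_exists[OF nn(3)] fam.is_arg_min_iff[OF nn(3)] by metis
    fix u z u' z'
    assume m: "is_arg_min (energy \<rho> \<nu>) (\<lambda>y. y \<in> adm \<nu> h) (u, z) \<and>
      is_arg_min (energy \<rho> \<nu>) (\<lambda>y. y \<in> adm \<nu> h) (u', z')"
    then have a: "(u, z) \<in> Y_space \<Omega> \<nu>" "(u', z') \<in> Y_space \<Omega> \<nu>"
      using adm_sub by (auto simp: is_arg_min_def)
    have "Y_norm \<Omega> \<nu> ((u, z) - (u', z')) = 0"
      using fam.minimizers_at_distance_zero[OF nn(3)] m by blast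
    then have "L2_norm \<Omega> (\<lambda>x. Y_jet \<nu> (u, z) x - Y_jet \<nu> (u', z') x) = 0"
      by (simp only: Y_norm_diff[OF a])
    then have "AE x in M. Y_jet \<nu> (u, z) x - Y_jet \<nu> (u', z') x = 0"
      using L2_norm_eq_0_iff[OF L2_diff[OF Y_jet_L2[OF a(1)] Y_jet_L2[OF a(2)], of UNIV]] by simp
    then show "AE x in M. u x = u' x \<and> z x = z' x"
      by eventually_elim (simp add: Y_jet_def jet_def Z_jet_def zero_prod_def)
  qed
qed

lemma energy_mono:
  assumes "0 \<le> \<nu>'" "\<nu>' = \<nu> \<or> \<nu> = 0"
  shows "energy \<rho> \<nu> y \<le> energy \<rho> \<nu>' y"
proof (cases "\<nu>' = \<nu>")
  case False
  then have [simp]: "\<nu> = 0" using assms by blast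
  have *: "enn2ereal (\<integral>\<^sup>+x. hardening c\<^sub>1 c\<^sub>2 c\<^sub>3 \<phi> \<rho> (snd y x)
      + (if \<nu> = 0 then 0 else ennreal (\<nu>/2 * (norm (weak_gradient \<Omega> (snd y) x))\<^sup>2)) \<partial>M)
    \<le> enn2ereal (\<integral>\<^sup>+x. hardening c\<^sub>1 c\<^sub>2 c\<^sub>3 \<phi> \<rho> (snd y x)
      + (if \<nu>' = 0 then 0 else ennreal (\<nu>'/2 * (norm (weak_gradient \<Omega> (snd y) x))\<^sup>2)) \<partial>M)"
    unfolding less_eq_ennreal.rep_eq[symmetric] by (intro nn_integral_mono add_left_mono) simp
  show ?thesis
    unfolding incremental_energy_def stored_energy_def
    using * by (simp only: case_prod_unfold fst_conv snd_conv) (intro add_right_mono ereal_minus_mono add_left_mono order_refl)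
qed simp

text \<open>For a state with square integrable gradient, passing from 0 to \<open>\<nu>\<close>
  changes only \<open>Q\<close>, and by an amount linear in \<open>\<nu>\<close>; this is why a
  fixed competitor becomes cheap.\<close>

lemma energy_gradient_term:
  assumes v: "v \<in> Y_space \<Omega> 1" and nn: "0 < \<nu>" "0 \<le> \<rho>" and le: "energy \<rho> 0 v \<le> ereal b"
  shows "energy \<rho> \<nu> v \<le> ereal (b + \<nu>/2 * (L2_norm \<Omega> (weak_gradient \<Omega> (snd v)))\<^sup>2)"
proof -
  have Y: "v \<in> Y_space \<Omega> \<nu>" "v \<in> Y_space \<Omega> 0" using v Y_space_1_sub[of \<nu>] Y_space_1_sub[of 0] nn by auto
  have g: "weak_gradient \<Omega> (snd v) \<in> L2 \<Omega> UNIV"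
    using v by (auto simp: Y_space_iff Z_space_def intro: weak_gradient(1))
  have eq: "quad \<nu> (Y_jet \<nu> v x) = quad 0 (Y_jet 0 v x) + \<nu>/2 * (norm (weak_gradient \<Omega> (snd v) x))\<^sup>2" if "x \<in> \<Omega>" for x
    unfolding quad_jet[OF Y(1) that] quad_jet[OF Y(2) that] using nn by (simp add: Z_jet_def)
  have "Q \<nu> v = (LINT x|M. quad 0 (Y_jet 0 v x) + \<nu>/2 * (norm (weak_gradient \<Omega> (snd v) x))\<^sup>2)"
    unfolding Q_def by (rule Bochner_Integration.integral_cong) (simp_all add: eq)
  also have "\<dots> = Q 0 v + \<nu>/2 * (L2_norm \<Omega> (weak_gradient \<Omega> (snd v)))\<^sup>2"
    unfolding Q_def L2_norm_power2
    using quad_integrable[OF Y_jet_L2[OF Y(2)], of 0] L2_square_integrable[OF g] by simp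
  finally have F: "F \<nu> v = F 0 v + \<nu>/2 * (L2_norm \<Omega> (weak_gradient \<Omega> (snd v)))\<^sup>2" by (simp add: F_def)
  note d = energy_leD[OF Y(2) order_refl nn(2) le]
  show ?thesis
    by (rule energy_leI[OF Y(1) less_imp_le[OF nn(1)] nn(2) d(2)]) (use d(1) F in simp_all)
qed

lemma P_upper:
  assumes "0 \<le> \<rho>"
  obtains K where "0 \<le> K" "\<And>z z' \<nu>. z \<in> Z_space \<Omega> \<nu> \<Longrightarrow> z' \<in> Z_space \<Omega> \<nu> \<Longrightarrow>
    (\<rho> = 0 \<Longrightarrow> AE x in M. norm (z' x) \<le> c\<^sub>3) \<Longrightarrow>
    P \<rho> z' \<le> P \<rho> z + ennreal (K * L2_norm \<Omega> (\<lambda>x. z' x - z x))"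
proof -
  obtain K where K: "0 \<le> K"
    "\<And>a b. (\<rho> = 0 \<Longrightarrow> norm b \<le> c\<^sub>3) \<Longrightarrow> pen \<rho> b \<le> pen \<rho> a + ennreal (K * norm (b - a))"
    using pen_upper[OF assms] by metis
  let ?K = "K * sqrt (measure lebesgue \<Omega>)"
  have "P \<rho> z' \<le> P \<rho> z + ennreal (?K * L2_norm \<Omega> (\<lambda>x. z' x - z x))"
    if z: "z \<in> Z_space \<Omega> \<nu>" "z' \<in> Z_space \<Omega> \<nu>" and c: "\<rho> = 0 \<Longrightarrow> AE x in M. norm (z' x) \<le> c\<^sub>3" for z z' \<nu>
  proof -
    have [measurable]: "z \<in> borel_measurable M" "z' \<in> borel_measurable M"
      using z[THEN Z_L2, THEN L2_measurable] by auto
    have d: "(\<lambda>x. z' x - z x) \<in> L2 \<Omega> UNIV" by (rule L2_diff[OF Z_L2[OF z(2)] Z_L2[OF z(1)]]) simp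
    have "AE x in M. \<rho> = 0 \<longrightarrow> norm (z' x) \<le> c\<^sub>3" using c by (cases "\<rho> = 0") auto
    then have "P \<rho> z' \<le> (\<integral>\<^sup>+x. pen \<rho> (z x) + ennreal (K * norm (z' x - z x)) \<partial>M)"
      unfolding P_def by (intro nn_integral_mono_AE) (auto elim!: eventually_mono intro: K(2))
    also have "\<dots> = P \<rho> z + (\<integral>\<^sup>+x. ennreal (K * norm (z' x - z x)) \<partial>M)"
      unfolding P_def by (rule nn_integral_add) measurable
    also have "(\<integral>\<^sup>+x. ennreal (K * norm (z' x - z x)) \<partial>M) = ennreal (LINT x|M. K * norm (z' x - z x))"
      using L2_integrable(1)[OF d] K(1) by (intro nn_integral_eq_integral) auto
    also have "\<dots> \<le> ennreal (?K * L2_norm \<Omega> (\<lambda>x. z' x - z x))"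
      using mult_left_mono[OF L2_integrable(2)[OF d] K(1)] by (intro ennreal_leI) (simp add: mult.assoc)
    finally show ?thesis by (simp add: add_left_mono)
  qed
  moreover have "0 \<le> ?K" using K(1) by simp
  ultimately show thesis using that by blast
qed

section \<open>Convergence of the minimizers\<close>

text \<open>A finite integral forces a finite integrand almost everywhere, and for \<rho> = 0 the
  penalty is finite only inside the ball.\<close>

lemma constraint_of_finite_energy:
  assumes "y \<in> Y_space \<Omega> \<nu>" "0 \<le> \<nu>" "energy 0 \<nu> y \<le> ereal b"
  shows "AE x in M. norm (snd y x) \<le> c\<^sub>3"
proof -
  have [measurable]: "snd y \<in> borel_measurable M"
    using assms(1) by (auto simp: Y_space_iff intro: L2_measurable[OF Z_L2])
  have "P 0 (snd y) \<noteq> \<infinity>"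
    using energy_leD(2)[OF assms(1,2) order_refl assms(3)] by (auto simp: top_unique)
  then have "AE x in M. pen 0 (snd y x) \<noteq> \<infinity>"
    unfolding P_def by (intro nn_integral_PInf_AE) simp_all
  then show ?thesis by eventually_elim (auto simp: pen_def split: if_splits)
qed

text \<open>The counterpart from above to lower semicontinuity. For \<rho> = 0 strong convergence
  alone cannot give it, since approximants may leave the ball; once they respect the constraint, the
  one-sided bound \<open>P_upper\<close> applies.\<close>

lemma energy_recovery_sequence:
  assumes X: "\<And>n. X n \<in> Y_space \<Omega> \<nu>" and y: "y \<in> Y_space \<Omega> \<nu>" and nn: "0 \<le> \<nu>" "0 \<le> \<rho>"
    and lim: "(\<lambda>n. Y_norm \<Omega> \<nu> (X n - y)) \<longlonglongrightarrow> 0"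
    and c: "\<And>n. \<rho> = 0 \<Longrightarrow> AE x in M. norm (snd (X n) x) \<le> c\<^sub>3"
    and le: "energy \<rho> \<nu> y \<le> ereal m" and e: "0 < e"
  shows "\<forall>\<^sub>F n in sequentially. energy \<rho> \<nu> (X n) \<le> ereal (m + e)"
proof -
  have Z: "snd (X n) \<in> Z_space \<Omega> \<nu>" "snd y \<in> Z_space \<Omega> \<nu>" for n using X[of n] y by (auto simp: Y_space_iff)
  obtain K where K: "0 \<le> K" "\<And>z z' \<nu>. z \<in> Z_space \<Omega> \<nu> \<Longrightarrow> z' \<in> Z_space \<Omega> \<nu> \<Longrightarrow>
    (\<rho> = 0 \<Longrightarrow> AE x in M. norm (z' x) \<le> c\<^sub>3) \<Longrightarrow>
    P \<rho> z' \<le> P \<rho> z + ennreal (K * L2_norm \<Omega> (\<lambda>x. z' x - z x))"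
    by (rule P_upper[OF nn(2)]) blast
  let ?d = "\<lambda>n. Y_norm \<Omega> \<nu> (X n - y)"
  note d = energy_leD[OF y nn le]
  have L2_le: "L2_norm \<Omega> (\<lambda>x. snd (X n) x - snd y x) \<le> ?d n" for n
  proof -
    have "(\<lambda>x. snd (X n) x - snd y x) \<in> L2 \<Omega> UNIV" by (rule L2_diff[OF Z_L2[OF Z(1)] Z_L2[OF Z(2)]]) simp
    moreover have "snd (X n - y) \<in> Z_space \<Omega> \<nu>"
      using subspace_diff[OF Y_space_subspace X y] by (simp only: Y_space_iff)
    then have "L2_norm \<Omega> (snd (X n - y)) \<le> Z_norm \<Omega> \<nu> (snd (X n - y))"
      unfolding Z_norm_eq[OF \<open>snd (X n - y) \<in> Z_space \<Omega> \<nu>\<close>]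
      by (intro L2_norm_mono[OF Z_L2 Z_jet_L2]) (auto simp: Z_jet_def norm_Pair)
    ultimately show ?thesis
      using Y_norm_components(2)[of \<nu> "X n - y"] by (simp add: fun_diff)
  qed
  have "energy \<rho> \<nu> (X n) \<le> ereal (F \<nu> (X n) + ((m - F \<nu> y) + K * ?d n))" for n
  proof (rule energy_leI[OF X nn _ _ order_refl])
    have "P \<rho> (snd (X n)) \<le> P \<rho> (snd y) + ennreal (K * L2_norm \<Omega> (\<lambda>x. snd (X n) x - snd y x))"
      by (rule K(2)[OF Z(2,1) c])
    also have "\<dots> \<le> ennreal (m - F \<nu> y) + ennreal (K * ?d n)"
      using d(2) K(1) L2_le by (intro add_mono ennreal_leI mult_left_mono)
    also have "\<dots> = ennreal ((m - F \<nu> y) + K * ?d n)"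
      using d(1) K(1) by simp
    finally show "P \<rho> (snd (X n)) \<le> ennreal ((m - F \<nu> y) + K * ?d n)" .
    show "0 \<le> (m - F \<nu> y) + K * ?d n" using d(1) K(1) by simp
  qed
  note bound = this
  have "(\<lambda>n. F \<nu> (X n) + ((m - F \<nu> y) + K * ?d n)) \<longlonglongrightarrow> F \<nu> y + ((m - F \<nu> y) + K * 0)"
    by (intro tendsto_add tendsto_mult tendsto_const lim F_tendsto[OF X y lim])
  then have "\<forall>\<^sub>F n in sequentially. F \<nu> (X n) + ((m - F \<nu> y) + K * ?d n) < m + e"
    by (rule order_tendstoD(2)) (use e in simp)
  then show ?thesis
  proof eventually_elim
    case (elim n)
    show ?case by (rule order_trans[OF bound[of n]]) (use elim in simp)
  qed
qed

text \<open>The competitor \<open>v\<close> does not depend on the parameters of the approximating problems, so no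
  simultaneous limit in \<open>\<nu>\<close> and \<open>h\<close> is needed.\<close>

lemma recovery_energy:
  assumes ops: "approximation_operators \<Omega> c\<^sub>3 Uh Zh q r" and nn: "0 \<le> \<nu>" "0 \<le> \<rho>"
    and y: "y \<in> adm \<nu> 0" and le: "energy \<rho> \<nu> y \<le> ereal m" and e: "0 < e"
  obtains h' v where "0 < h'" "v \<in> Y_space \<Omega> 1" "energy \<rho> \<nu> v \<le> ereal (m + e)"
    "\<forall>\<nu>' h. 0 \<le> \<nu>' \<longrightarrow> 0 \<le> h \<longrightarrow> h \<le> h' \<longrightarrow> v \<in> adm \<nu>' h"
proof -
  have yY: "y \<in> Y_space \<Omega> \<nu>" by (rule adm_sub[OF y])
  \<comment> \<open>A sequence of recovery states is formed only to pass to the limit in the energy;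
    one sufficiently late member becomes the competitor.\<close>
  have "\<exists>v. v \<in> Y_space \<Omega> 1 \<and> Y_norm \<Omega> \<nu> (v - y) < 1 / real (Suc n) \<and>
      (\<rho> = 0 \<longrightarrow> (AE x in M. norm (snd v x) \<le> c\<^sub>3)) \<and>
      (\<exists>h'>0. \<forall>\<nu>' h. 0 \<le> \<nu>' \<longrightarrow> 0 \<le> h \<longrightarrow> h \<le> h' \<longrightarrow> v \<in> adm \<nu>' h)" for n
  proof -
    have pos: "0 < 1 / real (Suc n)" by simp
    obtain h' v where v: "0 < h'" "v \<in> Y_space \<Omega> 1"
      "Y_norm \<Omega> \<nu> (v - y) < 1 / real (Suc n)"
      "\<forall>\<nu>' h. 0 \<le> \<nu>' \<longrightarrow> 0 \<le> h \<longrightarrow> h \<le> h' \<longrightarrow> v \<in> adm \<nu>' h"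
      "(AE x in M. norm (snd y x) \<le> c\<^sub>3) \<longrightarrow> (AE x in M. norm (snd v x) \<le> c\<^sub>3)"
      using recovery[OF ops nn(1) y pos] .
    have "AE x in M. norm (snd v x) \<le> c\<^sub>3" if "\<rho> = 0"
      using v(5) constraint_of_finite_energy[OF yY nn(1) le[unfolded that]] by simp
    then show ?thesis using v(1-4) by (intro exI[of _ v] conjI impI exI[of _ h']) simp_all
  qed
  then have "\<forall>n. \<exists>v. v \<in> Y_space \<Omega> 1 \<and> Y_norm \<Omega> \<nu> (v - y) < 1 / real (Suc n) \<and>
      (\<rho> = 0 \<longrightarrow> (AE x in M. norm (snd v x) \<le> c\<^sub>3)) \<and>
      (\<exists>h'>0. \<forall>\<nu>' h. 0 \<le> \<nu>' \<longrightarrow> 0 \<le> h \<longrightarrow> h \<le> h' \<longrightarrow> v \<in> adm \<nu>' h)" ..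
  from choice[OF this] obtain X where "\<forall>n. X n \<in> Y_space \<Omega> 1 \<and> Y_norm \<Omega> \<nu> (X n - y) < 1 / real (Suc n) \<and>
      (\<rho> = 0 \<longrightarrow> (AE x in M. norm (snd (X n) x) \<le> c\<^sub>3)) \<and>
      (\<exists>h'>0. \<forall>\<nu>' h. 0 \<le> \<nu>' \<longrightarrow> 0 \<le> h \<longrightarrow> h \<le> h' \<longrightarrow> X n \<in> adm \<nu>' h)" ..
  then have X: "\<And>n. X n \<in> Y_space \<Omega> 1"
    "\<And>n. Y_norm \<Omega> \<nu> (X n - y) < 1 / real (Suc n)"
    "\<And>n. \<rho> = 0 \<Longrightarrow> (AE x in M. norm (snd (X n) x) \<le> c\<^sub>3)"
    "\<And>n. \<exists>h'>0. \<forall>\<nu>' h. 0 \<le> \<nu>' \<longrightarrow> 0 \<le> h \<longrightarrow> h \<le> h' \<longrightarrow> X n \<in> adm \<nu>' h" by simp_all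
  have XY: "X n \<in> Y_space \<Omega> \<nu>" for n using X(1) Y_space_1_sub[OF nn(1)] by blast
  have lim: "(\<lambda>n. Y_norm \<Omega> \<nu> (X n - y)) \<longlonglongrightarrow> 0"
    by (rule tendsto_0_bound[OF _ less_imp_le[OF X(2)] LIMSEQ_Suc[OF lim_const_over_n]]) simp
  from energy_recovery_sequence[OF XY yY nn lim X(3) le e]
  obtain n where "energy \<rho> \<nu> (X n) \<le> ereal (m + e)" by (auto simp: eventually_sequentially)
  then show thesis using that X(1)[of n] X(4)[of n] by blast
qed

text \<open>Each \<open>ys k\<close> is regarded in the problem with its own \<rho> but the limit
  values of \<nu> and h. There it is admissible and almost minimal, so that the abstract convergence
  result applies.\<close>

lemma minimizers_converge:
  fixes \<rho>s \<nu>s hs :: "nat \<Rightarrow> real"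
  assumes ops: "approximation_operators \<Omega> c\<^sub>3 Uh Zh q r"
    and \<rho>s: "\<And>k. 0 \<le> \<rho>s k" "\<rho>s \<longlonglongrightarrow> \<rho>" "(\<forall>k. \<rho>s k = \<rho>) \<or> \<rho> = 0"
    and \<nu>s: "\<And>k. 0 \<le> \<nu>s k" "\<nu>s \<longlonglongrightarrow> \<nu>" "(\<forall>k. \<nu>s k = \<nu>) \<or> \<nu> = 0"
    and hs: "\<And>k. 0 \<le> hs k" "hs \<longlonglongrightarrow> h" "(\<forall>k. hs k = h) \<or> h = 0"
    and ys: "\<And>k. is_arg_min (energy (\<rho>s k) (\<nu>s k)) (\<lambda>y. y \<in> adm (\<nu>s k) (hs k)) (ys k)"
    and y: "is_arg_min (energy \<rho> \<nu>) (\<lambda>y. y \<in> adm \<nu> h) y"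
  shows "(\<lambda>k. Y_norm \<Omega> \<nu> (ys k - y)) \<longlonglongrightarrow> 0"
proof -
  have nn: "0 \<le> \<nu>" "0 \<le> h" "0 \<le> \<rho>"
    using LIMSEQ_le_const[OF \<nu>s(2)] LIMSEQ_le_const[OF hs(2)] LIMSEQ_le_const[OF \<rho>s(2)]
      \<nu>s(1) hs(1) \<rho>s(1) by simp_all
  obtain \<alpha> K B where "convex_family (adm \<nu> h) (Y_norm \<Omega> \<nu>) (\<lambda>\<rho>. energy \<rho> \<nu>) \<alpha> K B (uDir, 0)"
    using energy_convex_family[OF nn(1,2)] .
  then interpret fam: convex_family "adm \<nu> h" "Y_norm \<Omega> \<nu>" "\<lambda>\<rho>. energy \<rho> \<nu>" \<alpha> K B "(uDir, 0)" .
  let ?m = "fam.min_value \<rho>"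
  have y': "y \<in> adm \<nu> h" "energy \<rho> \<nu> y \<le> ereal ?m" using y fam.is_arg_min_iff[OF nn(3)] by auto
  show ?thesis
  proof (rule fam.almost_minimizers_converge[OF \<rho>s _ _ y])
    show "ys k \<in> adm \<nu> h" for k
    proof (rule adm_mono[OF \<nu>s(1) nn(1) hs(1) nn(2)])
      show "ys k \<in> adm (\<nu>s k) (hs k)" using ys by (simp add: is_arg_min_def)
    qed (use \<nu>s(3) hs(3) in auto)
    fix e :: real assume e: "0 < e"
    \<comment> \<open>Half of \<open>e\<close> pays for the recovery error, the other half for the
      gradient term.\<close>
    obtain v where v: "v \<in> Y_space \<Omega> 1" "energy \<rho> \<nu> v \<le> ereal (?m + e/2)"
      "\<forall>\<^sub>F k in sequentially. v \<in> adm (\<nu>s k) (hs k)"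
    proof (cases "h = 0")
      case True
      obtain h' v where v: "0 < h'" "v \<in> Y_space \<Omega> 1" "energy \<rho> \<nu> v \<le> ereal (?m + e/2)"
        "\<forall>\<nu>' h. 0 \<le> \<nu>' \<longrightarrow> 0 \<le> h \<longrightarrow> h \<le> h' \<longrightarrow> v \<in> adm \<nu>' h"
        using recovery_energy[OF ops nn(1,3) y'(1)[unfolded True] y'(2) half_gt_zero[OF e]] .
      have "\<forall>\<^sub>F k in sequentially. hs k < h'" using hs(2) v(1) True order_tendstoD(2) by blast
      then have "\<forall>\<^sub>F k in sequentially. v \<in> adm (\<nu>s k) (hs k)"
        by eventually_elim (use v(4) \<nu>s(1) hs(1) less_imp_le in blast)
      then show thesis using that v by blast
    next
      case False
      then have h: "0 < h" "\<And>k. hs k = h" using nn(2) hs(3) by auto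
      have "v \<in> adm (\<nu>s k) (hs k)" if "v = y" for v k
        unfolding that h(2) by (rule adm_positive_step(3)[OF nn(1) h(1) y'(1) \<nu>s(1)])
      moreover have "energy \<rho> \<nu> y \<le> ereal (?m + e/2)" by (rule order_trans[OF y'(2)]) (use e in simp)
      ultimately show thesis using that[of y] adm_positive_step(2)[OF nn(1) h(1) y'(1)] by simp
    qed
    let ?G = "(L2_norm \<Omega> (weak_gradient \<Omega> (snd v)))\<^sup>2"
    have "\<forall>\<^sub>F k in sequentially. energy \<rho> (\<nu>s k) v \<le> ereal (?m + e)"
    proof (cases "\<forall>k. \<nu>s k = \<nu>")
      case True
      have "energy \<rho> (\<nu>s k) v \<le> ereal (?m + e)" for k
        unfolding True[rule_format] by (rule order_trans[OF v(2)]) (use e in simp)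
      then show ?thesis by simp
    next
      case False
      then have \<nu>0: "\<nu> = 0" using \<nu>s(3) by blast
      \<comment> \<open>Since \<open>v\<close> was chosen before \<open>k\<close>, its gradient norm
        is a constant and the price tends to 0 with \<open>\<nu>s\<close>.\<close>
      have "(\<lambda>k. \<nu>s k / 2 * ?G) \<longlonglongrightarrow> 0 / 2 * ?G"
        using \<nu>s(2) \<nu>0 by (intro tendsto_mult tendsto_divide tendsto_const) auto
      then have "\<forall>\<^sub>F k in sequentially. \<nu>s k / 2 * ?G < e / 2"
        by (rule order_tendstoD(2)) (use e in simp)
      then show ?thesis
      proof eventually_elim
        case (elim k)
        have "energy \<rho> (\<nu>s k) v \<le> ereal (?m + e/2 + \<nu>s k / 2 * ?G)"
        proof (cases "\<nu>s k = 0")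
          case True
          then show ?thesis using v(2) \<nu>0 by simp
        next
          case False
          then show ?thesis
            using energy_gradient_term[OF v(1) _ nn(3) v(2)[unfolded \<nu>0], of "\<nu>s k"] \<nu>s(1)[of k] \<nu>0 by simp
        qed
        also have "\<dots> \<le> ereal (?m + e)" using elim by simp
        finally show ?case .
      qed
    qed
    \<comment> \<open>The chain: dropping the gradient term lowers the energy, \<open>ys k\<close>
      beats \<open>v\<close> in its own problem, and \<open>\<rho> \<le> \<rho>s k\<close> allows
      passing to the limit parameter at \<open>v\<close>, whose energy is known.\<close>
    with v(3) show "\<forall>\<^sub>F k in sequentially. energy (\<rho>s k) \<nu> (ys k) \<le> ereal (?m + e)"
    proof eventually_elim
      case (elim k)
      have "energy (\<rho>s k) \<nu> (ys k) \<le> energy (\<rho>s k) (\<nu>s k) (ys k)"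
        using \<nu>s(3) by (intro energy_mono \<nu>s(1)) auto
      also have "\<dots> \<le> energy (\<rho>s k) (\<nu>s k) v"
        using ys[of k] elim(1) unfolding is_arg_min_def not_less[symmetric] by blast
      also have "\<dots> \<le> energy \<rho> (\<nu>s k) v"
        by (rule energy_antimono[OF adm_sub[OF elim(1)] \<nu>s(1) nn(3)]) (use \<rho>s(1)[of k] \<rho>s(3) in auto)
      finally show ?case using elim(2) by (rule order_trans)
    qed
  qed
qed

end

text \<open>A functional in the dual is linear and bounded by a multiple of the seminorm, so strong
  convergence carries over to its values.\<close>

lemma weakly_convergesI:
  assumes S: "subspace S" "\<And>k. X k \<in> S" "x \<in> S" and lim: "(\<lambda>k. N (X k - x)) \<longlonglongrightarrow> 0"
  shows "weakly_converges S N X x"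
  unfolding weakly_converges_def
proof (intro conjI allI ballI)
  fix f assume f: "f \<in> dual_space S N"
  then have "\<exists>K. \<forall>x\<in>S. \<bar>f x\<bar> \<le> K * N x" by (simp add: dual_space_def)
  then obtain K where K: "\<And>x. x \<in> S \<Longrightarrow> \<bar>f x\<bar> \<le> K * N x" by blast
  have d: "X k - x \<in> S" for k using S by (intro subspace_diff)
  have "f (X k) = f (X k - x) + f x" for k
  proof -
    have "f ((X k - x) + x) = f (X k - x) + f x" using f d S(3) unfolding dual_space_def by blast
    then show ?thesis by simp
  qed
  then have le: "norm (f (X k) - f x) \<le> K * N (X k - x)" for k using K[OF d, of k] by simp
  have "(\<lambda>k. K * N (X k - x)) \<longlonglongrightarrow> 0" using tendsto_mult[OF tendsto_const lim] by simp
  then have "(\<lambda>k. f (X k) - f x) \<longlonglongrightarrow> 0"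
    by (rule Lim_null_comparison[OF always_eventually, rotated]) (use le in blast)
  then show "(\<lambda>k. f (X k)) \<longlonglongrightarrow> f x" by (simp add: LIM_zero_iff)
qed (use S in auto)

text \<open>The alternative for the sequence becomes one for its limit, by uniqueness of limits;
  this is the form in which admissible sets and energies are compared.\<close>

lemma constant_or_null:
  fixes s :: "nat \<Rightarrow> real"
  assumes "s \<longlonglongrightarrow> a" "(\<forall>k. s k = s 0) \<or> s \<longlonglongrightarrow> 0"
  shows "(\<forall>k. s k = a) \<or> a = 0"
proof (cases "\<forall>k. s k = s 0")
  case True
  then have "s = (\<lambda>_. s 0)" by blast
  then have "s \<longlonglongrightarrow> s 0" by (metis tendsto_const)
  then have "s 0 = a" using assms(1) LIMSEQ_unique by blast
  then show ?thesis using True by simp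
next
  case False
  then show ?thesis using assms LIMSEQ_unique by blast
qed

text \<open>For positive h the minimizers lie in a translate of the discrete space by
  \<open>(uDir, 0)\<close>. Weak convergence there is therefore expressed through differences, and
  directly for the states when \<open>uDir\<close> is itself discrete.\<close>

theorem theorem7p5:
  fixes \<Omega> \<Gamma>\<^sub>D \<Gamma>\<^sub>t :: "(real^3) set"
    and C :: "real^3^3 \<Rightarrow> real^3^3"
    and c\<^sub>0 c\<^sub>1 c\<^sub>2 c\<^sub>3 :: real
    and \<phi> :: "real \<Rightarrow> real"
    and D :: "real^3^3 \<Rightarrow> real"
    and uDir :: "real^3 \<Rightarrow> real^3"
    and zbar :: "real^3 \<Rightarrow> real^3^3"
    and \<l> :: "(real^3 \<Rightarrow> real^3) \<Rightarrow> real"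
    and Uh :: "real \<Rightarrow> (real^3 \<Rightarrow> real^3) set"
    and Zh :: "real \<Rightarrow> real \<Rightarrow> (real^3 \<Rightarrow> real^3^3) set"
    and q :: "real \<Rightarrow> (real^3 \<Rightarrow> real^3) \<Rightarrow> real^3 \<Rightarrow> real^3"
    and r :: "real \<Rightarrow> real \<Rightarrow> (real^3 \<Rightarrow> real^3^3) \<Rightarrow> real^3 \<Rightarrow> real^3^3"
    and \<rho>s \<nu>s hs :: "nat \<Rightarrow> real"
    and \<rho> \<nu> h :: real
  defines "E \<equiv> incremental_energy \<Omega> C c\<^sub>1 c\<^sub>2 c\<^sub>3 \<phi> D \<l> zbar"
    and "Y \<equiv> admissible \<Omega> \<Gamma>\<^sub>D Uh Zh uDir"
  assumes "elasticity_tensor C"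
    and "\<Omega> \<noteq> {}" "bounded \<Omega>" "connected \<Omega>" "open \<Omega>" "lipschitz_boundary \<Omega>"
    and "boundary_partition \<Omega> \<Gamma>\<^sub>D \<Gamma>\<^sub>t"
    and "0 < c\<^sub>0" "korn_inequality \<Omega> \<Gamma>\<^sub>D c\<^sub>0"
    and "0 < c\<^sub>1" "0 < c\<^sub>2" "0 < c\<^sub>3" "penalty_function \<phi> c\<^sub>3"
    and "dissipation_density D"
    and "uDir \<in> H1 \<Omega> UNIV" "\<l> \<in> dual_space (H1 \<Omega> UNIV) (H1_norm \<Omega>)" "zbar \<in> L2 \<Omega> dev_mat"
    and "approximation_spaces \<Omega> \<Gamma>\<^sub>D Uh Zh"
    and "\<forall>\<^sub>F h in at_right 0. uDir \<in> Uh h"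
    and "approximation_operators \<Omega> c\<^sub>3 Uh Zh q r"
    and "\<forall>k. 0 \<le> \<rho>s k" "\<rho>s \<longlonglongrightarrow> \<rho>" "(\<forall>k. \<rho>s k = \<rho>s 0) \<or> \<rho>s \<longlonglongrightarrow> 0"
    and "\<forall>k. 0 \<le> \<nu>s k" "\<nu>s \<longlonglongrightarrow> \<nu>" "(\<forall>k. \<nu>s k = \<nu>s 0) \<or> \<nu>s \<longlonglongrightarrow> 0"
    and "\<forall>k. 0 \<le> hs k" "hs \<longlonglongrightarrow> h" "(\<forall>k. hs k = hs 0) \<or> hs \<longlonglongrightarrow> 0"
  shows "(\<forall>k. ae_unique_minimizer \<Omega> (E (\<rho>s k) (\<nu>s k)) (Y (\<nu>s k) (hs k))) \<and>
    ae_unique_minimizer \<Omega> (E \<rho> \<nu>) (Y \<nu> h) \<and>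
    (\<forall>ys y. (\<forall>k. is_arg_min (E (\<rho>s k) (\<nu>s k)) (\<lambda>y. y \<in> Y (\<nu>s k) (hs k)) (ys k)) \<and>
       is_arg_min (E \<rho> \<nu>) (\<lambda>y. y \<in> Y \<nu> h) y \<longrightarrow>
         weakly_converges (Y_space \<Omega> \<nu>) (Y_norm \<Omega> \<nu>) ys y \<and>
         (0 < h \<longrightarrow>
            weakly_converges (Y_approx Uh Zh \<nu> h) (Y_norm \<Omega> \<nu>) (\<lambda>k. ys k - y) 0 \<and>
            (uDir \<in> Uh h \<longrightarrow> weakly_converges (Y_approx Uh Zh \<nu> h) (Y_norm \<Omega> \<nu>) ys y)))"
proof -
  have "boundary_partition \<Omega> \<Gamma>\<^sub>D \<Gamma>\<^sub>t" by fact
  then obtain U where U: "open U" "\<Gamma>\<^sub>D = frontier \<Omega> \<inter> U"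
    by (auto simp: boundary_partition_def openin_open)
  \<comment> \<open>A relatively open part of the closed boundary is Borel, which the surface
    integrals in the trace estimates require.\<close>
  have "\<Gamma>\<^sub>D \<in> sets borel" unfolding U(2) by (intro sets.Int borel_closed borel_open U(1) frontier_closed)
  interpret elastoplastic \<Omega> \<Gamma>\<^sub>D Uh Zh uDir c\<^sub>1 c\<^sub>3 \<phi> C c\<^sub>0 c\<^sub>2 D \<l> zbar
    by (unfold_locales; fact)
  have ops: "approximation_operators \<Omega> c\<^sub>3 Uh Zh q r" by fact
  have \<rho>s: "\<And>k. 0 \<le> \<rho>s k" "\<rho>s \<longlonglongrightarrow> \<rho>" "(\<forall>k. \<rho>s k = \<rho>) \<or> \<rho> = 0"
    using \<open>\<forall>k. 0 \<le> \<rho>s k\<close> \<open>\<rho>s \<longlonglongrightarrow> \<rho>\<close>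
      constant_or_null[OF \<open>\<rho>s \<longlonglongrightarrow> \<rho>\<close> \<open>(\<forall>k. \<rho>s k = \<rho>s 0) \<or> \<rho>s \<longlonglongrightarrow> 0\<close>] by blast+
  have \<nu>s: "\<And>k. 0 \<le> \<nu>s k" "\<nu>s \<longlonglongrightarrow> \<nu>" "(\<forall>k. \<nu>s k = \<nu>) \<or> \<nu> = 0"
    using \<open>\<forall>k. 0 \<le> \<nu>s k\<close> \<open>\<nu>s \<longlonglongrightarrow> \<nu>\<close>
      constant_or_null[OF \<open>\<nu>s \<longlonglongrightarrow> \<nu>\<close> \<open>(\<forall>k. \<nu>s k = \<nu>s 0) \<or> \<nu>s \<longlonglongrightarrow> 0\<close>] by blast+
  have hs: "\<And>k. 0 \<le> hs k" "hs \<longlonglongrightarrow> h" "(\<forall>k. hs k = h) \<or> h = 0"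
    using \<open>\<forall>k. 0 \<le> hs k\<close> \<open>hs \<longlonglongrightarrow> h\<close>
      constant_or_null[OF \<open>hs \<longlonglongrightarrow> h\<close> \<open>(\<forall>k. hs k = hs 0) \<or> hs \<longlonglongrightarrow> 0\<close>] by blast+
  have nn: "0 \<le> \<rho>" "0 \<le> \<nu>" "0 \<le> h"
    using LIMSEQ_le_const[OF \<rho>s(2)] LIMSEQ_le_const[OF \<nu>s(2)] LIMSEQ_le_const[OF hs(2)]
      \<rho>s(1) \<nu>s(1) hs(1) by simp_all
  show ?thesis
    unfolding E_def Y_def
  proof (intro conjI allI impI)
    show "ae_unique_minimizer \<Omega> (energy (\<rho>s k) (\<nu>s k)) (adm (\<nu>s k) (hs k))" for k
      by (rule ae_unique_minimizer_energy[OF \<nu>s(1) hs(1) \<rho>s(1)])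
    show "ae_unique_minimizer \<Omega> (energy \<rho> \<nu>) (adm \<nu> h)"
      by (rule ae_unique_minimizer_energy[OF nn(2,3,1)])
    fix ys y
    assume m: "(\<forall>k. is_arg_min (energy (\<rho>s k) (\<nu>s k)) (\<lambda>y. y \<in> adm (\<nu>s k) (hs k)) (ys k)) \<and>
      is_arg_min (energy \<rho> \<nu>) (\<lambda>y. y \<in> adm \<nu> h) y"
    then have ys: "\<And>k. is_arg_min (energy (\<rho>s k) (\<nu>s k)) (\<lambda>y. y \<in> adm (\<nu>s k) (hs k)) (ys k)"
      and y: "is_arg_min (energy \<rho> \<nu>) (\<lambda>y. y \<in> adm \<nu> h) y" by blast+
    have lim: "(\<lambda>k. Y_norm \<Omega> \<nu> (ys k - y)) \<longlonglongrightarrow> 0"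
      by (rule minimizers_converge[OF ops \<rho>s \<nu>s hs ys y])
    have yA: "y \<in> adm \<nu> h" using y by (simp add: is_arg_min_def)
    have ysA: "ys k \<in> adm \<nu> h" for k
    proof (rule adm_mono[OF \<nu>s(1) nn(2) hs(1) nn(3)])
      show "ys k \<in> adm (\<nu>s k) (hs k)" using ys by (simp add: is_arg_min_def)
    qed (use \<nu>s(3) hs(3) in auto)
    show "weakly_converges (Y_space \<Omega> \<nu>) (Y_norm \<Omega> \<nu>) ys y"
      by (rule weakly_convergesI[OF Y_space_subspace adm_sub[OF ysA] adm_sub[OF yA] lim])
    assume h: "0 < h"
    note S = Yh_subspace[OF nn(2) h]
    \<comment> \<open>The Dirichlet datum cancels in differences of admissible states, so these are
      discrete whether or not \<open>uDir\<close> is.\<close>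
    have in_Yh: "x - (uDir, 0) \<in> Yh \<nu> h" if "x \<in> adm \<nu> h" for x
      using that h by (auto simp: adm_iff directions_def)
    show "weakly_converges (Yh \<nu> h) (Y_norm \<Omega> \<nu>) (\<lambda>k. ys k - y) 0"
    proof (rule weakly_convergesI[OF S])
      show "ys k - y \<in> Yh \<nu> h" for k
        using subspace_diff[OF S in_Yh[OF ysA[of k]] in_Yh[OF yA]] by simp
    qed (use lim S in \<open>simp_all add: subspace_0\<close>)
    assume "uDir \<in> Uh h"
    then have D: "(uDir, 0) \<in> Yh \<nu> h" using subspace_0[OF S] by (auto simp: Y_approx_def zero_prod_def)
    have full: "x \<in> Yh \<nu> h" if "x \<in> adm \<nu> h" for x
      using subspace_add[OF S in_Yh[OF that] D] by simp
    show "weakly_converges (Yh \<nu> h) (Y_norm \<Omega> \<nu>) ys y"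
      by (rule weakly_convergesI[OF S full[OF ysA] full[OF yA] lim])
  qed
qed

end
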